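(* Let $\Omega\subset\mathbb{R}^N$ be a bounded convex domain with $\partial\Omega\in C^2$ and positive curvature, let $\eta>0$, let $f:\Omega_\eta\to\mathbb{R}$ be Lipschitz continuous, let $F(x,t)=f(x)$ be the payoff function, and assume that the family of sets $\{\mathcal{A}(x,t)\}_{(x,t)\in\Omega_T}$ satisfies properties A1, A2, A3 and A4. If the values of the game $\{u_\varepsilon\}_{\varepsilon>0}$ converge uniformly (as $\varepsilon\to0$) to $u\in C(\overline{\Omega_T})$, then $u$ is a viscosity solution to $$\begin{cases}G(D^2u(x,t),\nabla u(x,t),u_t(x,t),x,t)=0&\text{in }\Omega_T,\\ u(x,t)=F(x,t)&\text{on }\Gamma,\end{cases}$$ in the sense of the definition given in the context.
   Context: **Domains.** Fix $T>0$; $\Omega_T=\Omega\times(0,T]$ and $\Gamma=\partial\Omega\times[0,T]\cup\Omega\times\{0\}$. For $\varepsilon>0$ let $\Omega_\varepsilon=\{x\in\mathbb{R}^N:\operatorname{dist}(x,\Omega)\le\varepsilon\}$, $\Theta_\varepsilon=\{x\in\mathbb{R}^N\setminus\Omega:\operatorname{dist}(x,\partial\Omega)\le\varepsilon\}$, $\Gamma_\varepsilon=\Omega_\varepsilon\times(-\varepsilon^2,0]\cup\Theta_\varepsilon\times(0,T]$ (similarly with $\eta$ in place of $\varepsilon$). $B(x_0,\rho)$ is the ball of center $x_0\in\mathbb{R}^N$ and radius $\rho$; $\pi_1:\mathbb{R}^{N+1}\to\mathbb{R}^N$, $\pi_2:\mathbb{R}^{N+1}\to\mathbb{R}$ are the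 projections $(y,s)\mapsto y$, $(y,s)\mapsto s$; $\mathbb{S}^N$ is the space of symmetric $N\times N$ matrices; $\nabla$ and $D^2$ are the gradient and Hessian in the space variable $x$. **The sets.** A constant $0<c<1$ is fixed. For every $(x,t)\in\Omega_T$: A1. $\mathcal{A}(x,t)$ is a compact subset of $B(0,1)\times[-\frac c2,\frac c2]$ with $(0,0)\in\mathcal{A}(x,t)$. A2. For all $s\in\pi_2(\mathcal{A}(x,t))$, the set $\{y\in\mathbb{R}^N:(y,s)\in\mathcal{A}(x,t)\}$ is symmetric with respect to the origin. A3. If $\{(x_n,t_n)\}\subset\Omega_T$ and $(x_n,t_n)\to(x,t)$, then for every $(y,s)\in\mathcal{A}(x,t)$ there exist $(y_n,s_n)\in\mathcal{A}(x_n,t_n)$ with $(y_n,s_n)\to(y,s)$; moreover, if $(y_n,s_n)\in\mathcal{A}(x_n,t_n)$ and $(y_n,s_n)\to(y,s)$, then $(y,s)\in\mathcal{A}(x,t)$. A4. For every $v\in\mathbb{R}^N\setminus\{0\}$ there exists a unique $(z,r)\in\mathcal{A}(x,t)$ such that $\min\{\langle v,y\rangle:y\in\pi_1(\mathcal{A}(x,t))\}=\langle v,z\rangle$; denote $J_{(x,t)}(v)=z$, $I_{(x,t)}(v)=r$. In addition, $J_{(x,t)}:\partial B(0,1)\to\partial\pi_1(\mathcal{A}(x,t))$ is surjective. **The game.** For $0<\varepsilon\le\eta$ the set of possible movements at $(x,t)\in\Omega_T$ is $$\mathcal{A}_\varepsilon(x,t)=\Big\{(x,t)+\Big(\varepsilon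 y,\ \varepsilon^2\tfrac{1-c}{c}s-\varepsilon^2\tfrac{c+1}{2}\Big):(y,s)\in\mathcal{A}(x,t)\Big\}\subset\Omega_T\cup\Gamma_\varepsilon .$$ A token starts at $(x_0,t_0)\in\Omega_T$. At each round a fair coin is tossed and the winner chooses the next position $(x_{k+1},t_{k+1})\in\mathcal{A}_\varepsilon(x_k,t_k)$. The game ends at the first round $\tau$ at which $(x_\tau,t_\tau)\in\Gamma_\varepsilon$ ($\tau$ is finite since time decreases by at least $c\varepsilon^2$ in each round), and Player II pays Player I the amount $F(x_\tau,t_\tau)$. A strategy $S_I$ of Player I (and likewise $S_{II}$ of Player II) is a collection of measurable mappings giving the next position in $\mathcal{A}_\varepsilon(x_k,t_k)$, in case that player wins the toss, as a function of the history $((x_0,t_0),\dots,(x_k,t_k))$. Let $\mathbb{E}^{(x_0,t_0)}_{S_I,S_{II}}$ be the expectation for the resulting probability measure on plays. Set $u_I^\varepsilon(x_0,t_0)=\sup_{S_I}\inf_{S_{II}}\mathbb{E}^{(x_0,t_0)}_{S_I,S_{II}}[F(x_\tau,t_\tau)]$ and $u_{II}^\varepsilon(x_0,t_0)=\inf_{S_{II}}\sup_{S_I}\mathbb{E}^{(x_0,t_0)}_{S_I,S_{II}}[F(x_\tau,t_\tau)]$ on $\Omega_T$, with both equal to $F$ on $\Gamma_\varepsilon$. The two functions coincide, and their common value $u_\varepsilon$ is called the ($\varepsilon$-)value of the game; it is the unique function on $\Omega_T\cup\Gamma_\varepsilon$ satisfying $u_\varepsilon(x,t)=\frac12\sup_{\mathcal{A}_\varepsilon(x,t)}u_\varepsilon+\frac12\inf_{\mathcal{A}_\varepsilon(x,t)}u_\varepsilon$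 for $(x,t)\in\Omega_T$ and $u_\varepsilon=F$ on $\Gamma_\varepsilon$. **The equation.** $G:\mathbb{S}^N\times\mathbb{R}^N\times\mathbb{R}\times\Omega_T\to\mathbb{R}$ is $$G(M,v,s,x,t)=\begin{cases}\left(-\frac{1-c}{c}I_{(x,t)}(v)+\frac{c+1}{2}\right)s-\frac12\langle MJ_{(x,t)}(v),J_{(x,t)}(v)\rangle&\text{if }v\ne0,\\[2pt] \left(-\frac{1-c}{c}\hat I_{(x,t)}(s)+\frac{c+1}{2}\right)s&\text{if }v=0,\end{cases}$$ where, for $s\neq0$, $\hat I_{(x,t)}(s)$ is the unique time with $(0,\hat I_{(x,t)}(s))\in\mathcal{A}(x,t)$ and $\hat I_{(x,t)}(s)\,s=\min\{rs:(0,r)\in\mathcal{A}(x,t)\}$, and $\hat I_{(x,t)}(0)=0$. The upper semicontinuous envelope is $G^*(M,v,s,x,t)=\lim_{\varepsilon\to0}\sup\{G(\hat M,\hat v,\hat s,\hat x,\hat t):\|M-\hat M\|+|s-\hat s|+|v-\hat v|+|x-\hat x|+|t-\hat t|<\varepsilon\}$ (with $(\hat M,\hat v,\hat s,\hat x,\hat t)\in\mathbb{S}^N\times\mathbb{R}^N\times\mathbb{R}\times\Omega_T$), and the lower one is $G_*=-(-G)^*$. **Viscosity solution.** $u\in C(\overline{\Omega_T})$ is a viscosity solution to the problem if $u=F$ on $\Gamma$ and: (i) for every $\phi\in C^{2,1}(\overline{\Omega_T})$ ($C^2$ in $x$, $C^1$ in $t$) such that $u-\phi$ has a strict minimum at $(x_0,t_0)\in\Omega_T$,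 $G^*(D^2\phi(x_0,t_0),\nabla\phi(x_0,t_0),\phi_t(x_0,t_0),x_0,t_0)\ge0$; (ii) for every $\phi\in C^{2,1}(\overline{\Omega_T})$ such that $u-\phi$ has a strict maximum at $(x_0,t_0)\in\Omega_T$, $G_*(D^2\phi(x_0,t_0),\nabla\phi(x_0,t_0),\phi_t(x_0,t_0),x_0,t_0)\le0$. *)

theory Defs
  imports "HOL-Probability.Probability"
begin

section \<open>Space-time domains\<close>

definition cylinder :: "(real^'n) set \<Rightarrow> real \<Rightarrow> ((real^'n) \<times> real) set" where
  "cylinder \<Omega> T = \<Omega> \<times> {0<..T}"

definition parabolic_boundary :: "(real^'n) set \<Rightarrow> real \<Rightarrow> ((real^'n) \<times> real) set" where
  "parabolic_boundary \<Omega> T = frontier \<Omega> \<times> {0..T} \<union> \<Omega> \<times> {0}"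

definition enlarged_domain :: "(real^'n) set \<Rightarrow> real \<Rightarrow> (real^'n) set" where
  "enlarged_domain \<Omega> \<epsilon> = {x. infdist x \<Omega> \<le> \<epsilon>}"

definition outer_strip :: "(real^'n) set \<Rightarrow> real \<Rightarrow> (real^'n) set" where
  "outer_strip \<Omega> \<epsilon> = {x. x \<notin> \<Omega> \<and> infdist x (frontier \<Omega>) \<le> \<epsilon>}"

definition terminal_set :: "(real^'n) set \<Rightarrow> real \<Rightarrow> real \<Rightarrow> ((real^'n) \<times> real) set" where
  "terminal_set \<Omega> T \<epsilon> =
     enlarged_domain \<Omega> \<epsilon> \<times> {- (\<epsilon>\<^sup>2)<..0} \<union> outer_strip \<Omega> \<epsilon> \<times> {0<..T}"


section \<open>C2 boundaries and their principal curvatures\<close>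

text \<open>The function \<open>\<gamma>\<close> is of class C2 on the whole space, with gradient \<open>g\<close> and Hessian \<open>H\<close>.\<close>

definition has_C2_derivs ::
  "((real^'n) \<Rightarrow> real) \<Rightarrow> ((real^'n) \<Rightarrow> real^'n) \<Rightarrow> ((real^'n) \<Rightarrow> real^'n^'n) \<Rightarrow> bool" where
  "has_C2_derivs \<gamma> g H \<longleftrightarrow>
     (\<forall>x. GDERIV \<gamma> x :> g x) \<and>
     (\<forall>x. (g has_derivative (\<lambda>w. H x *v w)) (at x)) \<and>
     continuous_on UNIV H"

definition hyperplane_proj :: "real^'n \<Rightarrow> real^'n \<Rightarrow> real^'n" where
  "hyperplane_proj \<nu> x = x - (x \<bullet> \<nu>) *\<^sub>R \<nu>"

text \<open>Near \<open>x0\<close>, the set \<open>\<Omega>\<close> is the region above the graph of a C2 function of the N - 1 variables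
  orthogonal to the unit vector \<open>\<nu>\<close>. A function of these variables is represented by a function on
  the full space that is only evaluated on the hyperplane orthogonal to \<open>\<nu>\<close>; every C2 function on
  that hyperplane arises in this way (compose it with the projection).\<close>

definition C2_graph_chart ::
  "(real^'n) set \<Rightarrow> real^'n \<Rightarrow> real^'n \<Rightarrow> real \<Rightarrow>
    ((real^'n) \<Rightarrow> real) \<Rightarrow> ((real^'n) \<Rightarrow> real^'n) \<Rightarrow> ((real^'n) \<Rightarrow> real^'n^'n) \<Rightarrow> bool" where
  "C2_graph_chart \<Omega> x0 \<nu> r \<gamma> g H \<longleftrightarrow>
     norm \<nu> = 1 \<and> 0 < r \<and> has_C2_derivs \<gamma> g H \<and>
     \<Omega> \<inter> ball x0 r = {x \<in> ball x0 r. x \<bullet> \<nu> > \<gamma> (hyperplane_proj \<nu> x)}"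

definition C2_boundary :: "(real^'n) set \<Rightarrow> bool" where
  "C2_boundary \<Omega> \<longleftrightarrow> (\<forall>x0\<in>frontier \<Omega>. \<exists>\<nu> r \<gamma> g H. C2_graph_chart \<Omega> x0 \<nu> r \<gamma> g H)"

text \<open>Principal curvatures at \<open>x0\<close>, with respect to the inner normal: the eigenvalues of the Hessian
  of \<open>\<gamma>\<close> on the hyperplane orthogonal to \<open>\<nu>\<close>, in a chart in which the graph is tangent to that
  hyperplane at \<open>x0\<close> (that is, \<open>\<nu>\<close> is the inner unit normal). They are nonnegative for convex sets,
  and all equal to 1/R for a ball of radius R.\<close>

definition principal_curvature :: "(real^'n) set \<Rightarrow> real^'n \<Rightarrow> real \<Rightarrow> bool" where
  "principal_curvature \<Omega> x0 k \<longleftrightarrow>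
     (\<exists>\<nu> r \<gamma> g H. C2_graph_chart \<Omega> x0 \<nu> r \<gamma> g H \<and>
        hyperplane_proj \<nu> (g (hyperplane_proj \<nu> x0)) = 0 \<and>
        (\<exists>w. w \<noteq> 0 \<and> w \<bullet> \<nu> = 0 \<and>
             hyperplane_proj \<nu> (H (hyperplane_proj \<nu> x0) *v w) = k *\<^sub>R w))"

definition positive_curvature :: "(real^'n) set \<Rightarrow> bool" where
  "positive_curvature \<Omega> \<longleftrightarrow> (\<forall>x0\<in>frontier \<Omega>. \<forall>k. principal_curvature \<Omega> x0 k \<longrightarrow> 0 < k)"


section \<open>The sets of admissible directions\<close>

text \<open>\<open>minimizer A v\<close> is the pair \<open>(J(v), I(v))\<close>.\<close>

definition is_minimizer ::
  "((real^'n) \<times> real) set \<Rightarrow> real^'n \<Rightarrow> (real^'n) \<times> real \<Rightarrow> bool" where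
  "is_minimizer A v p \<longleftrightarrow> p \<in> A \<and> (\<forall>y\<in>fst ` A. v \<bullet> fst p \<le> v \<bullet> y)"

definition minimizer :: "((real^'n) \<times> real) set \<Rightarrow> real^'n \<Rightarrow> (real^'n) \<times> real" where
  "minimizer A v = (THE p. is_minimizer A v p)"

definition min_dir :: "((real^'n) \<times> real) set \<Rightarrow> real^'n \<Rightarrow> real^'n" where
  "min_dir A v = fst (minimizer A v)"

definition min_time :: "((real^'n) \<times> real) set \<Rightarrow> real^'n \<Rightarrow> real" where
  "min_time A v = snd (minimizer A v)"

definition zero_time :: "((real^'n) \<times> real) set \<Rightarrow> real \<Rightarrow> real" where
  "zero_time A s =
     (if s = 0 then 0 else (THE r. (0, r) \<in> A \<and> (\<forall>r'. (0, r') \<in> A \<longrightarrow> r * s \<le> r' * s)))"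

text \<open>In (A1) the ball is taken closed, so that subsets of the open unit ball are covered as well.\<close>

definition property_A1 ::
  "((real^'n) \<times> real) set \<Rightarrow> real \<Rightarrow> ((real^'n) \<times> real \<Rightarrow> ((real^'n) \<times> real) set) \<Rightarrow> bool" where
  "property_A1 \<Omega>T c \<A> \<longleftrightarrow>
     (\<forall>p\<in>\<Omega>T. compact (\<A> p) \<and> \<A> p \<subseteq> cball 0 1 \<times> {- c/2..c/2} \<and> (0, 0) \<in> \<A> p)"

definition property_A2 ::
  "((real^'n) \<times> real) set \<Rightarrow> ((real^'n) \<times> real \<Rightarrow> ((real^'n) \<times> real) set) \<Rightarrow> bool" where
  "property_A2 \<Omega>T \<A> \<longleftrightarrow>
     (\<forall>p\<in>\<Omega>T. \<forall>s\<in>snd ` \<A> p. uminus ` {y. (y, s) \<in> \<A> p} = {y. (y, s) \<in> \<A> p})"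

definition property_A3 ::
  "((real^'n) \<times> real) set \<Rightarrow> ((real^'n) \<times> real \<Rightarrow> ((real^'n) \<times> real) set) \<Rightarrow> bool" where
  "property_A3 \<Omega>T \<A> \<longleftrightarrow>
     (\<forall>p\<in>\<Omega>T. \<forall>X :: nat \<Rightarrow> (real^'n) \<times> real. (\<forall>n. X n \<in> \<Omega>T) \<longrightarrow> X \<longlonglongrightarrow> p \<longrightarrow>
        (\<forall>q\<in>\<A> p. \<exists>Y. (\<forall>n. Y n \<in> \<A> (X n)) \<and> Y \<longlonglongrightarrow> q) \<and>
        (\<forall>Y q. (\<forall>n. Y n \<in> \<A> (X n)) \<longrightarrow> Y \<longlonglongrightarrow> q \<longrightarrow> q \<in> \<A> p))"

definition property_A4 ::
  "((real^'n) \<times> real) set \<Rightarrow> ((real^'n) \<times> real \<Rightarrow> ((real^'n) \<times> real) set) \<Rightarrow> bool" where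
  "property_A4 \<Omega>T \<A> \<longleftrightarrow>
     (\<forall>p\<in>\<Omega>T. (\<forall>v. v \<noteq> 0 \<longrightarrow> (\<exists>!q. is_minimizer (\<A> p) v q)) \<and>
              min_dir (\<A> p) ` sphere 0 1 = frontier (fst ` \<A> p))"


section \<open>The game\<close>

definition moves ::
  "real \<Rightarrow> ((real^'n) \<times> real \<Rightarrow> ((real^'n) \<times> real) set) \<Rightarrow> real \<Rightarrow>
    (real^'n) \<times> real \<Rightarrow> ((real^'n) \<times> real) set" where
  "moves c \<A> \<epsilon> p =
     (\<lambda>(y, s). p + (\<epsilon> *\<^sub>R y, \<epsilon>\<^sup>2 * ((1 - c) / c) * s - \<epsilon>\<^sup>2 * ((c + 1) / 2))) ` \<A> p"

text \<open>The history up to round \<open>k\<close> is an (extensional) function on \<open>{..k}\<close>. A strategy is, for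
  every \<open>k\<close>, a Borel map on the histories for which the game has not ended yet.\<close>

type_synonym 'n strategy = "nat \<Rightarrow> (nat \<Rightarrow> (real^'n) \<times> real) \<Rightarrow> (real^'n) \<times> real"

definition strategies ::
  "(real^'n) set \<Rightarrow> real \<Rightarrow> real \<Rightarrow> ((real^'n) \<times> real \<Rightarrow> ((real^'n) \<times> real) set) \<Rightarrow> real \<Rightarrow>
    'n strategy set" where
  "strategies \<Omega> T c \<A> \<epsilon> =
     {S. \<forall>k. S k \<in> measurable (Pi\<^sub>M {..k} (\<lambda>_. restrict_space borel (cylinder \<Omega> T))) borel \<and>
             (\<forall>h \<in> {..k} \<rightarrow>\<^sub>E cylinder \<Omega> T. S k h \<in> moves c \<A> \<epsilon> (h k))}"

text \<open>Independent fair coins; Player I wins round \<open>k\<close> iff \<open>\<omega> k\<close>.\<close>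

definition coin_space :: "(nat \<Rightarrow> bool) measure" where
  "coin_space = Pi\<^sub>M UNIV (\<lambda>_. measure_pmf (bernoulli_pmf (1/2)))"

text \<open>The play determined by two strategies and the coin tosses. The law on plays is the image of
  \<open>coin_space\<close>. Positions after the first visit to the terminal set are meaningless
  and are never used.\<close>

primrec history ::
  "'n strategy \<Rightarrow> 'n strategy \<Rightarrow> (real^'n) \<times> real \<Rightarrow> (nat \<Rightarrow> bool) \<Rightarrow> nat \<Rightarrow>
    nat \<Rightarrow> (real^'n) \<times> real" where
  "history S1 S2 p0 \<omega> 0 = (\<lambda>i\<in>{..0}. p0)"
| "history S1 S2 p0 \<omega> (Suc k) =
     (history S1 S2 p0 \<omega> k)
       (Suc k := (if \<omega> k then S1 else S2) k (history S1 S2 p0 \<omega> k))"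

definition position ::
  "'n strategy \<Rightarrow> 'n strategy \<Rightarrow> (real^'n) \<times> real \<Rightarrow> (nat \<Rightarrow> bool) \<Rightarrow> nat \<Rightarrow>
    (real^'n) \<times> real" where
  "position S1 S2 p0 \<omega> k = history S1 S2 p0 \<omega> k k"

definition end_round ::
  "(real^'n) set \<Rightarrow> real \<Rightarrow> real \<Rightarrow> 'n strategy \<Rightarrow> 'n strategy \<Rightarrow> (real^'n) \<times> real \<Rightarrow>
    (nat \<Rightarrow> bool) \<Rightarrow> nat" where
  "end_round \<Omega> T \<epsilon> S1 S2 p0 \<omega> = (LEAST k. position S1 S2 p0 \<omega> k \<in> terminal_set \<Omega> T \<epsilon>)"

definition expected_payoff ::
  "(real^'n) set \<Rightarrow> real \<Rightarrow> real \<Rightarrow> ((real^'n) \<times> real \<Rightarrow> real) \<Rightarrow>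
    'n strategy \<Rightarrow> 'n strategy \<Rightarrow> (real^'n) \<times> real \<Rightarrow> real" where
  "expected_payoff \<Omega> T \<epsilon> F S1 S2 p0 =
     (\<integral>\<omega>. F (position S1 S2 p0 \<omega> (end_round \<Omega> T \<epsilon> S1 S2 p0 \<omega>)) \<partial>coin_space)"

definition value_I ::
  "(real^'n) set \<Rightarrow> real \<Rightarrow> real \<Rightarrow> ((real^'n) \<times> real \<Rightarrow> ((real^'n) \<times> real) set) \<Rightarrow> real \<Rightarrow>
    ((real^'n) \<times> real \<Rightarrow> real) \<Rightarrow> (real^'n) \<times> real \<Rightarrow> real" where
  "value_I \<Omega> T c \<A> \<epsilon> F p0 =
     (SUP S1\<in>strategies \<Omega> T c \<A> \<epsilon>. INF S2\<in>strategies \<Omega> T c \<A> \<epsilon>.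
        expected_payoff \<Omega> T \<epsilon> F S1 S2 p0)"

definition value_II ::
  "(real^'n) set \<Rightarrow> real \<Rightarrow> real \<Rightarrow> ((real^'n) \<times> real \<Rightarrow> ((real^'n) \<times> real) set) \<Rightarrow> real \<Rightarrow>
    ((real^'n) \<times> real \<Rightarrow> real) \<Rightarrow> (real^'n) \<times> real \<Rightarrow> real" where
  "value_II \<Omega> T c \<A> \<epsilon> F p0 =
     (INF S2\<in>strategies \<Omega> T c \<A> \<epsilon>. SUP S1\<in>strategies \<Omega> T c \<A> \<epsilon>.
        expected_payoff \<Omega> T \<epsilon> F S1 S2 p0)"

definition is_game_value ::
  "(real^'n) set \<Rightarrow> real \<Rightarrow> real \<Rightarrow> ((real^'n) \<times> real \<Rightarrow> ((real^'n) \<times> real) set) \<Rightarrow> real \<Rightarrow>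
    ((real^'n) \<times> real \<Rightarrow> real) \<Rightarrow> ((real^'n) \<times> real \<Rightarrow> real) \<Rightarrow> bool" where
  "is_game_value \<Omega> T c \<A> \<epsilon> F v \<longleftrightarrow>
     (\<forall>p\<in>cylinder \<Omega> T. value_I \<Omega> T c \<A> \<epsilon> F p = v p \<and> value_II \<Omega> T c \<A> \<epsilon> F p = v p) \<and>
     (\<forall>p\<in>terminal_set \<Omega> T \<epsilon>. v p = F p)"


section \<open>The equation and its viscosity solutions\<close>

definition G_op ::
  "real \<Rightarrow> ((real^'n) \<times> real \<Rightarrow> ((real^'n) \<times> real) set) \<Rightarrow>
    real^'n^'n \<Rightarrow> real^'n \<Rightarrow> real \<Rightarrow> (real^'n) \<times> real \<Rightarrow> real" where
  "G_op c \<A> M v s p =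
     (if v \<noteq> 0
      then (- ((1 - c) / c) * min_time (\<A> p) v + (c + 1) / 2) * s
             - (1/2) * ((M *v min_dir (\<A> p) v) \<bullet> min_dir (\<A> p) v)
      else (- ((1 - c) / c) * zero_time (\<A> p) s + (c + 1) / 2) * s)"

text \<open>Semicontinuous envelopes, with the matrix argument ranging over symmetric matrices and the
  space-time point over \<open>\<Omega>T\<close>. Under (A1) and (A4) the operator is locally bounded, so the suprema
  are taken over sets that are bounded above.\<close>

definition upper_envelope ::
  "((real^'n) \<times> real) set \<Rightarrow>
    (real^'n^'n \<Rightarrow> real^'n \<Rightarrow> real \<Rightarrow> (real^'n) \<times> real \<Rightarrow> real) \<Rightarrow>
    real^'n^'n \<Rightarrow> real^'n \<Rightarrow> real \<Rightarrow> (real^'n) \<times> real \<Rightarrow> real" where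
  "upper_envelope \<Omega>T G M v s p =
     Lim (at_right 0) (\<lambda>\<epsilon>. Sup {G M' v' s' p' | M' v' s' p'.
        transpose M' = M' \<and> p' \<in> \<Omega>T \<and>
        norm (M - M') + \<bar>s - s'\<bar> + norm (v - v') + norm (fst p - fst p') + \<bar>snd p - snd p'\<bar> < \<epsilon>})"

definition lower_envelope ::
  "((real^'n) \<times> real) set \<Rightarrow>
    (real^'n^'n \<Rightarrow> real^'n \<Rightarrow> real \<Rightarrow> (real^'n) \<times> real \<Rightarrow> real) \<Rightarrow>
    real^'n^'n \<Rightarrow> real^'n \<Rightarrow> real \<Rightarrow> (real^'n) \<times> real \<Rightarrow> real" where
  "lower_envelope \<Omega>T G M v s p =
     - upper_envelope \<Omega>T (\<lambda>M' v' s' p'. - G M' v' s' p') M v s p"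

text \<open>\<open>\<phi>\<close> is of class C2 in \<open>x\<close> and C1 in \<open>t\<close> up to the boundary of the cylinder: spatial gradient
  \<open>g\<close>, spatial Hessian \<open>H\<close> and time derivative \<open>d\<close> exist in the cylinder (one-sided in time at
  \<open>t = T\<close>) and, together with \<open>\<phi>\<close>, are continuous on the closure.\<close>

definition has_C21_derivs ::
  "(real^'n) set \<Rightarrow> real \<Rightarrow> ((real^'n) \<times> real \<Rightarrow> real) \<Rightarrow> ((real^'n) \<times> real \<Rightarrow> real^'n) \<Rightarrow>
    ((real^'n) \<times> real \<Rightarrow> real^'n^'n) \<Rightarrow> ((real^'n) \<times> real \<Rightarrow> real) \<Rightarrow> bool" where
  "has_C21_derivs \<Omega> T \<phi> g H d \<longleftrightarrow>
     (\<forall>(x, t)\<in>cylinder \<Omega> T.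
        (GDERIV (\<lambda>y. \<phi> (y, t)) x :> g (x, t)) \<and>
        ((\<lambda>y. g (y, t)) has_derivative (\<lambda>w. H (x, t) *v w)) (at x) \<and>
        ((\<lambda>s. \<phi> (x, s)) has_real_derivative d (x, t)) (at t within {0..T})) \<and>
     continuous_on (closure (cylinder \<Omega> T)) \<phi> \<and>
     continuous_on (closure (cylinder \<Omega> T)) g \<and>
     continuous_on (closure (cylinder \<Omega> T)) H \<and>
     continuous_on (closure (cylinder \<Omega> T)) d"

definition strict_min_on :: "('a \<Rightarrow> real) \<Rightarrow> 'a set \<Rightarrow> 'a \<Rightarrow> bool" where
  "strict_min_on w S p \<longleftrightarrow> p \<in> S \<and> (\<forall>q\<in>S. q \<noteq> p \<longrightarrow> w p < w q)"

definition strict_max_on :: "('a \<Rightarrow> real) \<Rightarrow> 'a set \<Rightarrow> 'a \<Rightarrow> bool" where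
  "strict_max_on w S p \<longleftrightarrow> p \<in> S \<and> (\<forall>q\<in>S. q \<noteq> p \<longrightarrow> w q < w p)"

definition viscosity_solution ::
  "(real^'n) set \<Rightarrow> real \<Rightarrow> (real^'n^'n \<Rightarrow> real^'n \<Rightarrow> real \<Rightarrow> (real^'n) \<times> real \<Rightarrow> real) \<Rightarrow>
    ((real^'n) \<times> real \<Rightarrow> real) \<Rightarrow> ((real^'n) \<times> real \<Rightarrow> real) \<Rightarrow> bool" where
  "viscosity_solution \<Omega> T G F u \<longleftrightarrow>
     continuous_on (closure (cylinder \<Omega> T)) u \<and>
     (\<forall>p\<in>parabolic_boundary \<Omega> T. u p = F p) \<and>
     (\<forall>\<phi> g H d p. has_C21_derivs \<Omega> T \<phi> g H d \<longrightarrow> p \<in> cylinder \<Omega> T \<longrightarrow>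
        strict_min_on (\<lambda>q. u q - \<phi> q) (closure (cylinder \<Omega> T)) p \<longrightarrow>
        0 \<le> upper_envelope (cylinder \<Omega> T) G (H p) (g p) (d p) p) \<and>
     (\<forall>\<phi> g H d p. has_C21_derivs \<Omega> T \<phi> g H d \<longrightarrow> p \<in> cylinder \<Omega> T \<longrightarrow>
        strict_max_on (\<lambda>q. u q - \<phi> q) (closure (cylinder \<Omega> T)) p \<longrightarrow>
        lower_envelope (cylinder \<Omega> T) G (H p) (g p) (d p) p \<le> 0)"

end

theory Submission
  imports Defs
begin

text \<open>The boundary values come for free: on the parabolic boundary every game stops at once, so all
  the values equal \<open>F\<close> there and so does their limit. In the interior, let \<open>\<phi>\<close> touch \<open>u\<close> from below
  at \<open>p0\<close>.

  The game enters only through the dynamic programming inequality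
  \<open>u\<^sub>\<epsilon>(p) + \<delta> \<ge> (u\<^sub>\<epsilon>(q) + u\<^sub>\<epsilon>(q')) / 2\<close>: for every move \<open>q\<close> there is a move \<open>q'\<close> for which it holds
  (\<open>dynamic_programming_ge\<close>). It is read off the upper value, infimum over the strategies of
  Player II outside. If a nearly optimal strategy of Player II is fixed first, its answer \<open>q'\<close> to
  the opening position is one point, so Player I replies with just two continuation strategies, one
  from \<open>q\<close> and one from \<open>q'\<close>, and the combined strategy is measurable. The opposite inequality is this one for \<open>- F\<close>, because
  exchanging the players does not change the expectation (\<open>is_game_value_uminus\<close>).

  Near-minimum points of \<open>u\<^sub>\<epsilon> - \<phi>\<close> close to \<open>p0\<close> turn it into an inequality for \<open>\<phi>\<close>. Let \<open>q'\<close> be the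
  move that minimizes \<open>\<phi>\<close>, given by \<open>(y, s)\<close>, and \<open>q\<close> the mirror move \<open>(- y, s)\<close>, admissible by
  (A2). In the sum of the two Taylor expansions the gradients cancel; division by \<open>\<epsilon>\<^sup>2\<close> and
  compactness give a pair \<open>(y, s)\<close> in the limit set that minimizes the scalar product with
  \<open>\<nabla>\<phi>(p0)\<close> and at which the operator is nonnegative (\<open>contact\<close>). If \<open>\<nabla>\<phi>(p0) \<noteq> 0\<close>, (A4) says that
  this pair is \<open>(J, I)\<close>, and the inequality for the operator follows.

  If \<open>\<nabla>\<phi>(p0) = 0\<close>, the minimization is void: \<open>y\<close> may lie in the interior of the projected set, with
  a time \<open>s\<close> that no nonzero gradient selects, and the inequality at \<open>(y, s)\<close> need not concern the
  envelope at all. For \<open>\<phi>\<^sub>t(p0) \<ge> 0\<close> the value of the operator at the zero gradient is already nonnegative.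
  For \<open>\<phi>\<^sub>t(p0) < 0\<close> the space variable is doubled: \<open>u(x, t) - \<phi>(y, t) + k |x - y|\<^sup>4\<close> has minimum
  points \<open>(x, y, t)\<close> near \<open>p0\<close> (\<open>doubling\<close>). If \<open>x = y\<close>, a test function with vanishing gradient and
  vanishing Hessian touches \<open>u\<close> at \<open>(x, t)\<close>, and then its time derivative \<open>\<phi>\<^sub>t(x, t)\<close> is
  nonnegative, which is false near \<open>p0\<close>. So \<open>x \<noteq> y\<close>; minimality in \<open>y\<close> gives \<open>\<nabla>\<phi>(y, t) \<noteq> 0\<close>, a
  translate of \<open>\<phi>\<close> touches \<open>u\<close> at \<open>(x, t)\<close>, and the case of a nonzero gradient applies. The
  derivatives of \<open>\<phi>\<close> at \<open>(y, t)\<close> converge to those at \<open>p0\<close>, so the upper envelope at \<open>p0\<close> is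
  nonnegative (\<open>nearby_supersolution\<close>).

  The inequality at maxima follows by changing all signs. The operator is odd off the zero gradient;
  at the zero gradient it is not in general, but there only its sign and a bound enter.\<close>


section \<open>Plays and coin tosses\<close>

definition payoff ::
  "(real^'n) set \<Rightarrow> real \<Rightarrow> real \<Rightarrow> ((real^'n) \<times> real \<Rightarrow> real) \<Rightarrow>
    'n strategy \<Rightarrow> 'n strategy \<Rightarrow> (real^'n) \<times> real \<Rightarrow> (nat \<Rightarrow> bool) \<Rightarrow> real" where
  "payoff \<Omega> T \<epsilon> F S1 S2 p \<omega> = F (position S1 S2 p \<omega> (end_round \<Omega> T \<epsilon> S1 S2 p \<omega>))"

text \<open>The strategy seen from round 1 on, when the opening position \<open>p\<close> is kept in the histories but
  the remaining play is counted from its own round 0.\<close>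

definition continue_from :: "'n strategy \<Rightarrow> (real^'n) \<times> real \<Rightarrow> 'n strategy" where
  "continue_from S p k h = S (Suc k) (case_nat p h)"

lemma history_Suc_shift:
  assumes q: "q = (if b then S1 else S2) 0 (\<lambda>i\<in>{..0}. p)"
  shows "history S1 S2 p (case_nat b \<omega>) (Suc k) =
     case_nat p (history (continue_from S1 p) (continue_from S2 p) q \<omega> k)"
proof (induction k)
  case 0
  show ?case by (auto simp: q fun_eq_iff restrict_def split: nat.splits)
next
  case (Suc k)
  have *: "(case_nat p h)(Suc (Suc k) := z) = case_nat p (h(Suc k := z))" for h :: "nat \<Rightarrow> _" and z
    by (auto simp: fun_eq_iff split: nat.splits)
  have "history S1 S2 p (case_nat b \<omega>) (Suc (Suc k)) =
      (history S1 S2 p (case_nat b \<omega>) (Suc k))(Suc (Suc k) :=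
        (if \<omega> k then S1 else S2) (Suc k) (history S1 S2 p (case_nat b \<omega>) (Suc k)))"
    by (subst history.simps(2)) simp
  also have "\<dots> = case_nat p
      ((history (continue_from S1 p) (continue_from S2 p) q \<omega> k)(Suc k :=
        (if \<omega> k then S1 else S2) (Suc k)
          (case_nat p (history (continue_from S1 p) (continue_from S2 p) q \<omega> k))))"
    unfolding Suc.IH * ..
  also have "\<dots> = case_nat p (history (continue_from S1 p) (continue_from S2 p) q \<omega> (Suc k))"
    by (rule arg_cong[where f="case_nat p"]) (simp add: continue_from_def)
  finally show ?case .
qed

lemma position_0 [simp]: "position S1 S2 p \<omega> 0 = p"
  by (simp add: position_def)

lemma position_Suc_shift:
  "position S1 S2 p (case_nat b \<omega>) (Suc k) =
     position (continue_from S1 p) (continue_from S2 p)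
       ((if b then S1 else S2) 0 (\<lambda>i\<in>{..0}. p)) \<omega> k"
  unfolding position_def history_Suc_shift[OF refl] by simp

lemma history_initial: "history S1 S2 p \<omega> k 0 = p"
  by (induction k) auto

lemma history_extensional: "history S1 S2 p \<omega> k \<in> extensional {..k}"
  by (induction k) (auto simp: extensional_def)

text \<open>A play only consults its strategies on extensional histories with the right first entry. This is
  what allows a strategy to branch on where its play started.\<close>

lemma history_cong:
  assumes "\<And>k h. h \<in> extensional {..k} \<Longrightarrow> h 0 = p \<Longrightarrow> S1 k h = S1' k h"
    and "\<And>k h. h \<in> extensional {..k} \<Longrightarrow> h 0 = p \<Longrightarrow> S2 k h = S2' k h"
  shows "history S1 S2 p \<omega> k = history S1' S2' p \<omega> k"
proof (induction k)
  case (Suc k)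
  have "(if \<omega> k then S1 else S2) k (history S1' S2' p \<omega> k) =
      (if \<omega> k then S1' else S2') k (history S1' S2' p \<omega> k)"
    using assms[OF history_extensional history_initial] by simp
  with Suc show ?case by simp
qed simp

text \<open>The history up to round \<open>k\<close> depends on \<open>k\<close> coin tosses only and so takes finitely many values.
  It is therefore measurable for the discrete \<open>\<sigma>\<close>-algebra on histories, whatever the strategies
  are, and any function of it is measurable as well.\<close>

lemma history_measurable [measurable]:
  "(\<lambda>\<omega>. history S1 S2 p \<omega> k) \<in> measurable coin_space (count_space UNIV)"
proof (induction k)
  case (Suc k)
  have [measurable]: "Measurable.pred coin_space (\<lambda>\<omega>. \<omega> k)"
    unfolding coin_space_def by measurable
  have "(\<lambda>\<omega>. history S1 S2 p \<omega> (Suc k)) =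
    (\<lambda>\<omega>. if \<omega> k then (\<lambda>h. h(Suc k := S1 k h)) (history S1 S2 p \<omega> k)
          else (\<lambda>h. h(Suc k := S2 k h)) (history S1 S2 p \<omega> k))"
    by auto
  also have "\<dots> \<in> measurable coin_space (count_space UNIV)"
    by (rule measurable_If; (rule measurable_compose[OF Suc.IH])?) simp_all
  finally show ?case .
qed simp

lemma payoff_measurable [measurable]: "payoff \<Omega> T \<epsilon> F S1 S2 p \<in> borel_measurable coin_space"
proof -
  have pos: "(\<lambda>\<omega>. position S1 S2 p \<omega> k) \<in> measurable coin_space (count_space UNIV)" for k
    unfolding position_def by (rule measurable_compose[OF history_measurable]) simp
  have e: "(\<lambda>\<omega>. end_round \<Omega> T \<epsilon> S1 S2 p \<omega>) \<in> measurable coin_space (count_space UNIV)"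
    unfolding end_round_def
    by (rule measurable_Least, rule measurable_compose[OF pos]) simp
  have "(\<lambda>\<omega>. F (position S1 S2 p \<omega> k)) \<in> borel_measurable coin_space" for k
    by (rule measurable_compose[OF pos]) simp
  from measurable_compose_countable[OF this e] show ?thesis
    unfolding payoff_def[abs_def] .
qed

interpretation coins: sequence_space "measure_pmf (bernoulli_pmf (1/2))"
  by unfold_locales

interpretation coin_prob: prob_space coin_space
  unfolding coin_space_def by unfold_locales

text \<open>The coin space is invariant under putting one more independent fair coin in front; integrating
  that coin out gives the average.\<close>

lemma coin_space_expectation:
  fixes X :: "(nat \<Rightarrow> bool) \<Rightarrow> real"
  assumes [measurable]: "X \<in> borel_measurable coin_space" and B: "\<And>\<omega>. \<bar>X \<omega>\<bar> \<le> B"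
  shows "(\<integral>\<omega>. X \<omega> \<partial>coin_space) =
    ((\<integral>\<omega>. X (case_nat True \<omega>) \<partial>coin_space) + (\<integral>\<omega>. X (case_nat False \<omega>) \<partial>coin_space)) / 2"
proof -
  let ?B = "measure_pmf (bernoulli_pmf (1/2))"
  interpret pair_prob_space ?B coin_space ..
  have cons: "(\<lambda>(s, \<omega>). case_nat s \<omega>) \<in> measurable (?B \<Otimes>\<^sub>M coin_space) coin_space"
    unfolding coin_space_def by measurable
  have [measurable]: "(\<lambda>x. X (case x of (s, \<omega>) \<Rightarrow> case_nat s \<omega>)) \<in> borel_measurable (?B \<Otimes>\<^sub>M coin_space)"
    by (rule measurable_compose[OF cons]) measurable
  have "(\<integral>\<omega>. X \<omega> \<partial>coin_space) = (\<integral>\<omega>. X \<omega> \<partial>distr (?B \<Otimes>\<^sub>M coin_space) coin_space (\<lambda>(s, \<omega>). case_nat s \<omega>))"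
    using coins.PiM_iter by (simp add: coin_space_def)
  also have "\<dots> = (\<integral>x. X (case x of (s, \<omega>) \<Rightarrow> case_nat s \<omega>) \<partial>(?B \<Otimes>\<^sub>M coin_space))"
    by (rule integral_distr[OF cons]) measurable
  also have "\<dots> = (\<integral>s. (\<integral>\<omega>. X (case_nat s \<omega>) \<partial>coin_space) \<partial>?B)"
    by (subst integral_fst'[symmetric]) (auto intro!: integrable_const_bound[where B=B] B)
  also have "\<dots> = ((\<integral>\<omega>. X (case_nat True \<omega>) \<partial>coin_space) + (\<integral>\<omega>. X (case_nat False \<omega>) \<partial>coin_space)) / 2"
    by (subst integral_measure_pmf_real[where A=UNIV]) (auto simp: UNIV_bool)
  finally show ?thesis .
qed

section \<open>The game\<close>

text \<open>A move \<open>(y, s)\<close> takes the time \<open>\<epsilon>\<^sup>2 * delay c s\<close>; the same factor multiplies the time derivative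
  in the operator.\<close>

definition delay :: "real \<Rightarrow> real \<Rightarrow> real" where
  "delay c s = - ((1 - c) / c) * s + (c + 1) / 2"

lemma delay_bounds:
  assumes "0 < c" "c < 1" "s \<in> {- c/2..c/2}"
  shows "c \<le> delay c s" "delay c s \<le> 1"
proof -
  define k where "k = (1 - c) / c"
  have k: "0 \<le> k" "k * (c/2) = (1 - c) / 2" "k * (-(c/2)) = - ((1 - c) / 2)"
    using assms by (simp_all add: k_def)
  have u: "k * s \<le> k * (c/2)" and l: "k * (-(c/2)) \<le> k * s"
    using assms k(1) by (intro mult_left_mono; simp)+
  have d: "delay c s = - (k * s) + (c + 1) / 2"
    by (simp add: delay_def k_def)
  show "c \<le> delay c s"
    using u unfolding d k(2) by (auto simp: field_simps)
  show "delay c s \<le> 1"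
    using l unfolding d k(3) by (auto simp: field_simps)
qed

lemma moves_delay:
  "moves c \<A> \<epsilon> p =
     (\<lambda>q. (fst p + \<epsilon> *\<^sub>R fst q, snd p - \<epsilon>\<^sup>2 * delay c (snd q))) ` \<A> p"
  unfolding moves_def delay_def
  by (intro image_cong refl) (auto simp: prod_eq_iff algebra_simps)

lemma cylinder_terminal_disjoint: "p \<in> cylinder \<Omega> T \<Longrightarrow> p \<notin> terminal_set \<Omega> T \<epsilon>"
  by (auto simp: cylinder_def terminal_set_def outer_strip_def)

text \<open>The segment from \<open>x\<close> to \<open>z\<close> meets the boundary, so a token that leaves the domain with a step of
  length at most \<open>\<epsilon>\<close> lands in the strip.\<close>

lemma infdist_frontier_le:
  fixes \<Omega> :: "(real^'n) set"
  assumes "x \<in> \<Omega>" "z \<notin> \<Omega>"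
  shows "infdist z (frontier \<Omega>) \<le> dist x z"
proof -
  have "closed_segment x z \<inter> frontier \<Omega> \<noteq> {}"
    by (rule connected_Int_frontier) (use assms in auto)
  then obtain w where w: "w \<in> closed_segment x z" "w \<in> frontier \<Omega>" by auto
  have "infdist z (frontier \<Omega>) \<le> dist z w" by (rule infdist_le[OF w(2)])
  also have "\<dots> \<le> dist x z"
    using dist_in_closed_segment[OF w(1)] by (simp add: dist_commute)
  finally show ?thesis .
qed

locale admissible_sets =
  fixes \<Omega> :: "(real^'n) set" and T c :: real
    and \<A> :: "(real^'n) \<times> real \<Rightarrow> ((real^'n) \<times> real) set"
  assumes c: "0 < c" "c < 1"
    and A1: "property_A1 (cylinder \<Omega> T) c \<A>"
begin

lemma A1D:
  assumes "p \<in> cylinder \<Omega> T"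
  shows "compact (\<A> p)" "q \<in> \<A> p \<Longrightarrow> norm (fst q) \<le> 1" "q \<in> \<A> p \<Longrightarrow> snd q \<in> {- c/2..c/2}"
    "(0, 0) \<in> \<A> p"
  using A1 assms unfolding property_A1_def by (force simp: mem_Times_iff)+

lemma delay_A:
  assumes "p \<in> cylinder \<Omega> T" "a \<in> \<A> p"
  shows "c \<le> delay c (snd a)" "delay c (snd a) \<le> 1"
  using delay_bounds[OF c A1D(3)[OF assms]] .

end

locale tug_game = admissible_sets \<Omega> T c \<A>
  for \<Omega> :: "(real^'n) set" and T c :: real
    and \<A> :: "(real^'n) \<times> real \<Rightarrow> ((real^'n) \<times> real) set" +
  fixes \<epsilon> :: real
  assumes eps: "0 < \<epsilon>"
begin

lemma moves_time:
  assumes "p \<in> cylinder \<Omega> T" "q \<in> moves c \<A> \<epsilon> p"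
  shows "snd q \<le> snd p - c * \<epsilon>\<^sup>2" "snd p - \<epsilon>\<^sup>2 \<le> snd q"
proof -
  obtain a where a: "a \<in> \<A> p" "snd q = snd p - \<epsilon>\<^sup>2 * delay c (snd a)"
    using assms(2) by (auto simp: moves_delay)
  have "\<epsilon>\<^sup>2 * c \<le> \<epsilon>\<^sup>2 * delay c (snd a)" "\<epsilon>\<^sup>2 * delay c (snd a) \<le> \<epsilon>\<^sup>2 * 1"
    using delay_A[OF assms(1) a(1)] by (intro mult_left_mono; simp)+
  then show "snd q \<le> snd p - c * \<epsilon>\<^sup>2" "snd p - \<epsilon>\<^sup>2 \<le> snd q"
    using a by (simp_all add: mult.commute)
qed

lemma moves_space:
  assumes "p \<in> cylinder \<Omega> T" "q \<in> moves c \<A> \<epsilon> p"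
  shows "dist (fst p) (fst q) \<le> \<epsilon>"
  using assms A1D(2)[OF assms(1)] eps
  by (auto simp: moves_delay dist_norm mult_left_le)

lemma moves_subset:
  assumes p: "p \<in> cylinder \<Omega> T"
  shows "moves c \<A> \<epsilon> p \<subseteq> cylinder \<Omega> T \<union> terminal_set \<Omega> T \<epsilon>"
proof
  fix q assume q: "q \<in> moves c \<A> \<epsilon> p"
  have p': "fst p \<in> \<Omega>" "0 < snd p" "snd p \<le> T"
    using p by (auto simp: cylinder_def mem_Times_iff)
  have d: "dist (fst p) (fst q) \<le> \<epsilon>" by (rule moves_space[OF p q])
  have i: "infdist (fst q) \<Omega> \<le> \<epsilon>"
    using infdist_le2[OF p'(1)] d by (simp add: dist_commute)
  have "0 \<le> c * \<epsilon>\<^sup>2" using c by simp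
  then have t: "- (\<epsilon>\<^sup>2) < snd q" "snd q \<le> T"
    using moves_time[OF p q] p' by linarith+
  obtain x s where xs: "q = (x, s)" by fastforce
  show "q \<in> cylinder \<Omega> T \<union> terminal_set \<Omega> T \<epsilon>"
  proof (cases "s \<le> 0")
    case True
    then show ?thesis
      using i t by (simp add: xs terminal_set_def enlarged_domain_def)
  next
    case s: False
    show ?thesis
    proof (cases "x \<in> \<Omega>")
      case True
      then show ?thesis using s t by (simp add: xs cylinder_def)
    next
      case False
      then have "infdist x (frontier \<Omega>) \<le> \<epsilon>"
        using infdist_frontier_le[OF p'(1) False] d by (simp add: xs)
      then show ?thesis using False s t by (simp add: xs terminal_set_def outer_strip_def)
    qed
  qed
qed

abbreviation "\<S> \<equiv> strategies \<Omega> T c \<A> \<epsilon>"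

abbreviation histories :: "nat \<Rightarrow> (nat \<Rightarrow> (real^'n) \<times> real) measure" where
  "histories k \<equiv> Pi\<^sub>M {..k} (\<lambda>_. restrict_space borel (cylinder \<Omega> T))"

lemma space_histories: "space (histories k) = {..k} \<rightarrow>\<^sub>E cylinder \<Omega> T"
  by (simp add: space_PiM space_restrict_space)

lemma strategy_move:
  "S \<in> \<S> \<Longrightarrow> h \<in> {..k} \<rightarrow>\<^sub>E cylinder \<Omega> T \<Longrightarrow> S k h \<in> moves c \<A> \<epsilon> (h k)"
  by (simp add: strategies_def)

lemma start_history: "p \<in> cylinder \<Omega> T \<Longrightarrow> (\<lambda>i\<in>{..0::nat}. p) \<in> {..0} \<rightarrow>\<^sub>E cylinder \<Omega> T"
  unfolding restrict_PiE_iff by simp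

text \<open>Both claims are carried through the induction together: legality of the next move needs the
  history to lie in the cylinder, and the bound on the time drops by \<open>c \<epsilon>\<^sup>2\<close> with each legal move.\<close>

lemma running_play:
  assumes S: "S1 \<in> \<S>" "S2 \<in> \<S>" and p: "p \<in> cylinder \<Omega> T"
    and "\<And>i. i \<le> k \<Longrightarrow> position S1 S2 p \<omega> i \<notin> terminal_set \<Omega> T \<epsilon>"
  shows "history S1 S2 p \<omega> k \<in> {..k} \<rightarrow>\<^sub>E cylinder \<Omega> T"
    and "snd (position S1 S2 p \<omega> k) \<le> snd p - real k * (c * \<epsilon>\<^sup>2)"
  using assms(4)
proof (induction k)
  case 0
  { case 1 show ?case unfolding history.simps by (rule start_history[OF p]) }
  { case 2 show ?case by simp }
next
  case (Suc k)
  let ?h = "history S1 S2 p \<omega> k"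
  let ?q = "position S1 S2 p \<omega> (Suc k)"
  have IH: "?h \<in> {..k} \<rightarrow>\<^sub>E cylinder \<Omega> T"
    "snd (position S1 S2 p \<omega> k) \<le> snd p - real k * (c * \<epsilon>\<^sup>2)"
    if "\<And>i. i \<le> Suc k \<Longrightarrow> position S1 S2 p \<omega> i \<notin> terminal_set \<Omega> T \<epsilon>"
    using Suc.IH that by simp_all
  have q: "?q \<in> moves c \<A> \<epsilon> (?h k)" and hk: "?h k \<in> cylinder \<Omega> T"
    if "\<And>i. i \<le> Suc k \<Longrightarrow> position S1 S2 p \<omega> i \<notin> terminal_set \<Omega> T \<epsilon>"
    using strategy_move[OF S(1) IH(1)] strategy_move[OF S(2) IH(1)] IH(1) that
    by (auto simp: position_def)
  { case 1
    have "?q \<in> cylinder \<Omega> T"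
      using q[OF 1] moves_subset[OF hk[OF 1]] 1[of "Suc k"] by auto
    then show ?case
      using IH(1)[OF 1] by (auto simp: PiE_iff extensional_def position_def le_Suc_eq)
  next
    case 2
    show ?case
      using moves_time(1)[OF hk[OF 2] q[OF 2]] IH(2)[OF 2]
      by (simp add: position_def algebra_simps)
  }
qed

lemma play_terminates:
  assumes S: "S1 \<in> \<S>" "S2 \<in> \<S>" and p: "p \<in> cylinder \<Omega> T \<union> terminal_set \<Omega> T \<epsilon>"
  shows "\<exists>k. position S1 S2 p \<omega> k \<in> terminal_set \<Omega> T \<epsilon>"
proof (rule ccontr)
  assume "\<not> ?thesis"
  then have n: "\<And>k. position S1 S2 p \<omega> k \<notin> terminal_set \<Omega> T \<epsilon>" by auto
  from n[of 0] p have p: "p \<in> cylinder \<Omega> T" by simp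
  obtain k where k: "snd p < real k * (c * \<epsilon>\<^sup>2)"
    using reals_Archimedean3[of "c * \<epsilon>\<^sup>2"] c eps by auto
  have "position S1 S2 p \<omega> k \<in> cylinder \<Omega> T"
    using running_play(1)[OF S p n] unfolding position_def by (auto simp: PiE_iff)
  then show False
    using running_play(2)[OF S p n, of k] k by (auto simp: cylinder_def mem_Times_iff)
qed

text \<open>Measurability survives because placing the constant \<open>p\<close> in front of a history is a measurable map
  between the spaces of histories.\<close>

lemma continue_strategy:
  assumes S: "S \<in> \<S>" and p: "p \<in> cylinder \<Omega> T"
  shows "continue_from S p \<in> \<S>"
proof -
  have "continue_from S p k \<in> measurable (histories k) borel" for k
  proof -
    have m: "(\<lambda>h. \<lambda>i\<in>{..Suc k}. case i of 0 \<Rightarrow> p | Suc j \<Rightarrow> h j) \<in> measurable (histories k) (histories (Suc k))"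
    proof (rule measurable_restrict)
      fix i assume i: "i \<in> {..Suc k}"
      show "(\<lambda>h. case i of 0 \<Rightarrow> p | Suc j \<Rightarrow> h j)
          \<in> measurable (histories k) (restrict_space borel (cylinder \<Omega> T))"
      proof (cases i)
        case 0
        have "p \<in> space (restrict_space borel (cylinder \<Omega> T))"
          using p by (simp add: space_restrict_space)
        then show ?thesis unfolding 0 by simp
      next
        case (Suc j)
        then have "j \<in> {..k}" using i by simp
        then show ?thesis
          unfolding Suc nat.case by (rule measurable_component_singleton)
      qed
    qed
    have Sk: "S (Suc k) \<in> measurable (histories (Suc k)) borel"
      using S unfolding strategies_def by blast
    have "(\<lambda>i\<in>{..Suc k}. case i of 0 \<Rightarrow> p | Suc j \<Rightarrow> h j) = case_nat p h"
      if "h \<in> space (histories k)" for h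
    proof
      fix i
      show "(\<lambda>i\<in>{..Suc k}. case i of 0 \<Rightarrow> p | Suc j \<Rightarrow> h j) i = case_nat p h i"
        using that by (cases i) (simp_all add: space_histories PiE_iff extensional_def)
    qed
    then have "continue_from S p k h =
        S (Suc k) (\<lambda>i\<in>{..Suc k}. case i of 0 \<Rightarrow> p | Suc j \<Rightarrow> h j)"
      if "h \<in> space (histories k)" for h
      using that by (simp add: continue_from_def)
    with measurable_compose[OF m Sk] show ?thesis
      by (subst measurable_cong) 
  qed
  moreover have "continue_from S p k h \<in> moves c \<A> \<epsilon> (h k)" if "h \<in> {..k} \<rightarrow>\<^sub>E cylinder \<Omega> T" for k h
  proof -
    have "case_nat p h \<in> {..Suc k} \<rightarrow>\<^sub>E cylinder \<Omega> T"
      using that p by (auto simp: PiE_iff extensional_def split: nat.splits)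
    from strategy_move[OF S this] show ?thesis by (simp add: continue_from_def)
  qed
  ultimately show ?thesis by (simp add: strategies_def)
qed

text \<open>The move \<open>(0, 0)\<close> is always admissible. This gives a strategy that can be used at every position.\<close>

definition stay :: "'n strategy" where
  "stay k h = (fst (h k), snd (h k) - \<epsilon>\<^sup>2 * delay c 0)"

lemma component_borel:
  "i \<le> k \<Longrightarrow> (\<lambda>h. h i) \<in> measurable (histories k) borel"
  by (rule measurable_compose[OF measurable_component_singleton[of i]])
    (simp, rule measurable_restrict_space1, simp)

lemma stay_measurable: "stay k \<in> measurable (histories k) borel"
proof -
  have [measurable]: "(\<lambda>h. h k) \<in> measurable (histories k) (borel \<Otimes>\<^sub>M borel)"
    using component_borel[of k k] by (simp add: borel_prod)
  have "stay k \<in> measurable (histories k) (borel \<Otimes>\<^sub>M borel)"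
    unfolding stay_def[abs_def] by measurable
  then show ?thesis by (simp add: borel_prod)
qed

lemma stay_move:
  assumes "h \<in> {..k} \<rightarrow>\<^sub>E cylinder \<Omega> T"
  shows "stay k h \<in> moves c \<A> \<epsilon> (h k)"
proof -
  have "h k \<in> cylinder \<Omega> T" using assms by auto
  from A1D(4)[OF this] show ?thesis
    unfolding stay_def moves_delay by (force intro: rev_image_eqI)
qed

lemma strategies_nonempty: "\<S> \<noteq> {}"
  using stay_measurable stay_move unfolding strategies_def by blast

text \<open>Moves from \<open>p\<close> to \<open>q\<close>, then follows \<open>R1\<close> if the token indeed went to \<open>q\<close>, and \<open>R2\<close> if the
  opponent won the toss and moved it elsewhere. Off \<open>p\<close> it opens with the move of \<open>stay\<close>, because a strategy has
  to be legal at every position.\<close>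

definition open_with ::
  "(real^'n) \<times> real \<Rightarrow> (real^'n) \<times> real \<Rightarrow> 'n strategy \<Rightarrow> 'n strategy \<Rightarrow> 'n strategy" where
  "open_with p q R1 R2 k h =
     (case k of
        0 \<Rightarrow> if h 0 = p then q else stay 0 h
      | Suc j \<Rightarrow> (if h 1 = q then R1 else R2) j (\<lambda>i\<in>{..j}. h (Suc i)))"

lemma open_with_strategy:
  assumes p: "p \<in> cylinder \<Omega> T" and q: "q \<in> moves c \<A> \<epsilon> p" and R: "R1 \<in> \<S>" "R2 \<in> \<S>"
  shows "open_with p q R1 R2 \<in> \<S>"
proof -
  have tail: "(\<lambda>h. \<lambda>i\<in>{..j}. h (Suc i)) \<in> measurable (histories (Suc j)) (histories j)" for j
    by (rule measurable_restrict, rule measurable_component_singleton) simp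
  have eq: "{h \<in> space (histories k). h i = x} \<in> sets (histories k)" if "i \<le> k" for i k x
  proof -
    have "(\<lambda>h. h i) -` {x} \<inter> space (histories k) \<in> sets (histories k)"
      by (rule measurable_sets[OF component_borel[OF that]]) simp
    then show ?thesis by (simp add: vimage_def Int_def conj_commute)
  qed
  have Rm: "(\<lambda>h. R j (\<lambda>i\<in>{..j}. h (Suc i))) \<in> measurable (histories (Suc j)) borel"
    if "R \<in> \<S>" for j R
  proof (rule measurable_compose[OF tail])
    show "R j \<in> measurable (histories j) borel"
      using that unfolding strategies_def by blast
  qed
  have "open_with p q R1 R2 k \<in> measurable (histories k) borel" for k
  proof (cases k)
    case 0
    have "(\<lambda>h. if h 0 = p then q else stay 0 h) \<in> measurable (histories 0) borel"
      by (rule measurable_If[OF _ stay_measurable eq]) simp_all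
    then show ?thesis
      unfolding 0 open_with_def[abs_def] nat.case .
  next
    case (Suc j)
    have "(\<lambda>h. if h 1 = q then R1 j (\<lambda>i\<in>{..j}. h (Suc i)) else R2 j (\<lambda>i\<in>{..j}. h (Suc i)))
        \<in> measurable (histories (Suc j)) borel"
      by (rule measurable_If[OF Rm[OF R(1)] Rm[OF R(2)] eq]) simp
    then show ?thesis
      unfolding Suc open_with_def[abs_def] nat.case by (simp only: if_distribR)
  qed
  moreover have "open_with p q R1 R2 k h \<in> moves c \<A> \<epsilon> (h k)"
    if h: "h \<in> {..k} \<rightarrow>\<^sub>E cylinder \<Omega> T" for k h
  proof (cases k)
    case 0
    then show ?thesis using stay_move[of h 0] h q by (auto simp: open_with_def)
  next
    case (Suc j)
    have "(\<lambda>i\<in>{..j}. h (Suc i)) \<in> {..j} \<rightarrow>\<^sub>E cylinder \<Omega> T"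
      using h Suc by auto
    from strategy_move[OF R(1) this] strategy_move[OF R(2) this] show ?thesis
      using Suc by (simp add: open_with_def)
  qed
  ultimately show ?thesis by (simp add: strategies_def)
qed

end

section \<open>Dynamic programming\<close>

locale tug_payoff = tug_game \<Omega> T c \<A> \<epsilon>
  for \<Omega> :: "(real^'n) set" and T c :: real
    and \<A> :: "(real^'n) \<times> real \<Rightarrow> ((real^'n) \<times> real) set" and \<epsilon> :: real +
  fixes F :: "(real^'n) \<times> real \<Rightarrow> real" and B :: real
  assumes payoff_bound: "\<And>p. p \<in> terminal_set \<Omega> T \<epsilon> \<Longrightarrow> \<bar>F p\<bar> \<le> B"
begin

abbreviation "E \<equiv> expected_payoff \<Omega> T \<epsilon> F"

lemma expected_payoff_eq: "E S1 S2 p = (\<integral>\<omega>. payoff \<Omega> T \<epsilon> F S1 S2 p \<omega> \<partial>coin_space)"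
  by (simp add: expected_payoff_def payoff_def)

lemma abs_payoff_le:
  assumes "S1 \<in> \<S>" "S2 \<in> \<S>" "p \<in> cylinder \<Omega> T \<union> terminal_set \<Omega> T \<epsilon>"
  shows "\<bar>payoff \<Omega> T \<epsilon> F S1 S2 p \<omega>\<bar> \<le> B"
  unfolding payoff_def end_round_def
  by (rule payoff_bound, rule LeastI_ex, rule play_terminates[OF assms])

lemma abs_expected_payoff_le:
  assumes "S1 \<in> \<S>" "S2 \<in> \<S>" "p \<in> cylinder \<Omega> T \<union> terminal_set \<Omega> T \<epsilon>"
  shows "\<bar>E S1 S2 p\<bar> \<le> B"
proof -
  note le = abs_payoff_le[OF assms]
  have int: "integrable coin_space (payoff \<Omega> T \<epsilon> F S1 S2 p)"
    by (rule coin_prob.integrable_const_bound[where B=B]) (use le in auto)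
  have "E S1 S2 p \<le> B"
    unfolding expected_payoff_eq
    by (rule coin_prob.integral_le_const[OF int]) (use le in \<open>simp add: abs_le_iff\<close>)
  moreover have "- B \<le> E S1 S2 p"
    unfolding expected_payoff_eq
    by (rule coin_prob.integral_ge_const[OF int]) (use le in \<open>simp add: abs_le_iff minus_le_iff\<close>)
  ultimately show ?thesis by (simp add: abs_le_iff)
qed

lemma payoff_Suc:
  assumes S: "S1 \<in> \<S>" "S2 \<in> \<S>" and p: "p \<in> cylinder \<Omega> T"
  shows "payoff \<Omega> T \<epsilon> F S1 S2 p (case_nat b \<omega>) =
    payoff \<Omega> T \<epsilon> F (continue_from S1 p) (continue_from S2 p)
      ((if b then S1 else S2) 0 (\<lambda>i\<in>{..0}. p)) \<omega>"
proof -
  obtain k where "position S1 S2 p (case_nat b \<omega>) k \<in> terminal_set \<Omega> T \<epsilon>"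
    using play_terminates[OF S] p by blast
  moreover have "position S1 S2 p (case_nat b \<omega>) 0 \<notin> terminal_set \<Omega> T \<epsilon>"
    using cylinder_terminal_disjoint[OF p] by simp
  ultimately have "end_round \<Omega> T \<epsilon> S1 S2 p (case_nat b \<omega>) =
      Suc (LEAST k. position S1 S2 p (case_nat b \<omega>) (Suc k) \<in> terminal_set \<Omega> T \<epsilon>)"
    unfolding end_round_def by (rule Least_Suc)
  then show ?thesis
    unfolding payoff_def end_round_def position_Suc_shift by (simp only: position_Suc_shift)
qed

lemma expected_payoff_terminal:
  "p \<in> terminal_set \<Omega> T \<epsilon> \<Longrightarrow> E S1 S2 p = F p"
proof -
  assume "p \<in> terminal_set \<Omega> T \<epsilon>"
  then have "end_round \<Omega> T \<epsilon> S1 S2 p \<omega> = 0" for \<omega>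
    unfolding end_round_def by (intro Least_eq_0) simp
  then show ?thesis
    by (simp add: expected_payoff_eq payoff_def coin_prob.prob_space)
qed

lemma expected_payoff_step:
  assumes S: "S1 \<in> \<S>" "S2 \<in> \<S>" and p: "p \<in> cylinder \<Omega> T"
  shows "E S1 S2 p =
    (E (continue_from S1 p) (continue_from S2 p) (S1 0 (\<lambda>i\<in>{..0}. p)) +
     E (continue_from S1 p) (continue_from S2 p) (S2 0 (\<lambda>i\<in>{..0}. p))) / 2"
proof -
  have "E S1 S2 p =
     ((\<integral>\<omega>. payoff \<Omega> T \<epsilon> F S1 S2 p (case_nat True \<omega>) \<partial>coin_space) +
      (\<integral>\<omega>. payoff \<Omega> T \<epsilon> F S1 S2 p (case_nat False \<omega>) \<partial>coin_space)) / 2"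
    unfolding expected_payoff_eq
    by (rule coin_space_expectation[OF payoff_measurable abs_payoff_le[OF S]]) (use p in simp)
  then show ?thesis
    unfolding payoff_Suc[OF S p] expected_payoff_eq by simp
qed

lemma first_move:
  assumes "S \<in> \<S>" "p \<in> cylinder \<Omega> T"
  shows "S 0 (\<lambda>i\<in>{..0}. p) \<in> moves c \<A> \<epsilon> p"
  using strategy_move[OF assms(1) start_history[OF assms(2)]] by simp

text \<open>The coin is fair, so the one-step recursion is symmetric in the two strategies; induction over
  the remaining time.\<close>

lemma expected_payoff_swap:
  assumes "S1 \<in> \<S>" "S2 \<in> \<S>" "p \<in> cylinder \<Omega> T \<union> terminal_set \<Omega> T \<epsilon>"
  shows "E S1 S2 p = E S2 S1 p"
proof -
  have "E S1 S2 p = E S2 S1 p"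
    if "snd p \<le> real n * (c * \<epsilon>\<^sup>2)" "S1 \<in> \<S>" "S2 \<in> \<S>" "p \<in> cylinder \<Omega> T \<union> terminal_set \<Omega> T \<epsilon>" for n
    using that
  proof (induction n arbitrary: S1 S2 p)
    case 0
    then have "p \<in> terminal_set \<Omega> T \<epsilon>" by (auto simp: cylinder_def)
    then show ?case by (simp add: expected_payoff_terminal)
  next
    case (Suc n)
    show ?case
    proof (cases "p \<in> terminal_set \<Omega> T \<epsilon>")
      case True
      then show ?thesis by (simp add: expected_payoff_terminal)
    next
      case False
      with Suc.prems have p: "p \<in> cylinder \<Omega> T" by simp
      have "E (continue_from S1 p) (continue_from S2 p) (S 0 (\<lambda>i\<in>{..0}. p)) =
          E (continue_from S2 p) (continue_from S1 p) (S 0 (\<lambda>i\<in>{..0}. p))" if "S \<in> \<S>" for S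
      proof (rule Suc.IH)
        have m: "S 0 (\<lambda>i\<in>{..0}. p) \<in> moves c \<A> \<epsilon> p" by (rule first_move[OF that p])
        show "snd (S 0 (\<lambda>i\<in>{..0}. p)) \<le> real n * (c * \<epsilon>\<^sup>2)"
          using moves_time(1)[OF p m] Suc.prems(1) by (simp add: algebra_simps)
        show "S 0 (\<lambda>i\<in>{..0}. p) \<in> cylinder \<Omega> T \<union> terminal_set \<Omega> T \<epsilon>"
          using m moves_subset[OF p] by blast
      qed (use Suc.prems p continue_strategy in auto)
      then show ?thesis
        unfolding expected_payoff_step[OF Suc.prems(2,3) p] expected_payoff_step[OF Suc.prems(3,2) p]
        using Suc.prems by simp
    qed
  qed
  moreover obtain n where "snd p < real n * (c * \<epsilon>\<^sup>2)"
    using reals_Archimedean3[of "c * \<epsilon>\<^sup>2"] c eps by auto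
  ultimately show ?thesis using assms by (meson less_imp_le)
qed

text \<open>Against a strategy of Player II that is known in advance, Player I secures the upper value up to
  an arbitrarily small loss.\<close>

lemma value_II_attained:
  assumes S2: "S2 \<in> \<S>" and p: "p \<in> cylinder \<Omega> T" and d: "0 < d"
  shows "\<exists>R\<in>\<S>. value_II \<Omega> T c \<A> \<epsilon> F p - d \<le> E R S2 p"
proof -
  have bdd: "bdd_above ((\<lambda>S1. E S1 S p) ` \<S>)" if "S \<in> \<S>" for S
    using abs_expected_payoff_le[OF _ that] p by (intro bdd_aboveI2[where M=B]) (auto simp: abs_le_iff)
  have below: "bdd_below ((\<lambda>S2. SUP S1\<in>\<S>. E S1 S2 p) ` \<S>)"
  proof (rule bdd_belowI2[where m="-B"])
    fix S assume S: "S \<in> \<S>"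
    obtain S1 where S1: "S1 \<in> \<S>" using strategies_nonempty by blast
    have "- B \<le> E S1 S p"
      using abs_expected_payoff_le[OF S1 S, of p] p by (auto simp: abs_le_iff)
    also have "\<dots> \<le> (SUP S1\<in>\<S>. E S1 S p)"
      by (rule cSUP_upper[OF S1 bdd[OF S]])
    finally show "- B \<le> (SUP S1\<in>\<S>. E S1 S p)" .
  qed
  have "value_II \<Omega> T c \<A> \<epsilon> F p - d < (SUP S1\<in>\<S>. E S1 S2 p)"
    using cINF_lower[OF below S2] d unfolding value_II_def by linarith
  then show ?thesis
    unfolding less_cSUP_iff[OF strategies_nonempty bdd[OF S2]] by (meson less_imp_le)
qed

lemma value_II_approx:
  assumes p: "p \<in> cylinder \<Omega> T" and d: "0 < d"
  shows "\<exists>S2\<in>\<S>. \<forall>S1\<in>\<S>. E S1 S2 p \<le> value_II \<Omega> T c \<A> \<epsilon> F p + d"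
proof -
  have bdd: "bdd_above ((\<lambda>S1. E S1 S p) ` \<S>)" if "S \<in> \<S>" for S
    using abs_expected_payoff_le[OF _ that] p by (intro bdd_aboveI2[where M=B]) (auto simp: abs_le_iff)
  have "value_II \<Omega> T c \<A> \<epsilon> F p < value_II \<Omega> T c \<A> \<epsilon> F p + d" using d by simp
  then obtain S2 where S2: "S2 \<in> \<S>" "(SUP S1\<in>\<S>. E S1 S2 p) < value_II \<Omega> T c \<A> \<epsilon> F p + d"
    unfolding value_II_def[of \<Omega> T c \<A> \<epsilon> F p]
    using cInf_lessD[of "(\<lambda>S2. SUP S1\<in>\<S>. E S1 S2 p) ` \<S>"] strategies_nonempty by blast
  have "E S1 S2 p \<le> value_II \<Omega> T c \<A> \<epsilon> F p + d" if "S1 \<in> \<S>" for S1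
    using cSUP_upper[OF that bdd[OF S2(1)]] S2(2) by linarith
  with S2(1) show ?thesis by blast
qed

lemma expected_payoff_cong:
  assumes "\<And>k h. h \<in> extensional {..k} \<Longrightarrow> h 0 = p \<Longrightarrow> S1 k h = S1' k h"
  shows "E S1 S2 p = E S1' S2 p"
proof -
  have "history S1 S2 p \<omega> k = history S1' S2 p \<omega> k" for \<omega> k
    by (rule history_cong[OF assms refl])
  then show ?thesis
    by (simp add: expected_payoff_def end_round_def position_def)
qed

lemma continue_open_with:
  assumes "h \<in> extensional {..k}"
  shows "continue_from (open_with p q R1 R2) p k h = (if h 0 = q then R1 else R2) k h"
proof -
  have "(\<lambda>i\<in>{..k}. case_nat p h (Suc i)) = h"
    using assms by (auto simp: fun_eq_iff extensional_def)
  then show ?thesis by (simp add: continue_from_def open_with_def)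
qed

text \<open>Player II fixes a nearly optimal strategy from \<open>p\<close>, and its first move is \<open>q2\<close>. Player I opens with
  \<open>q1\<close> and afterwards answers nearly optimally from \<open>q1\<close> or from \<open>q2\<close>. Since both points are known
  beforehand, only two continuations have to be glued.\<close>

lemma dynamic_programming_ge:
  assumes v: "is_game_value \<Omega> T c \<A> \<epsilon> F v"
    and p: "p \<in> cylinder \<Omega> T" and sub: "moves c \<A> \<epsilon> p \<subseteq> cylinder \<Omega> T"
    and q1: "q1 \<in> moves c \<A> \<epsilon> p" and d: "0 < d"
  shows "\<exists>q2\<in>moves c \<A> \<epsilon> p. (v q1 + v q2) / 2 \<le> v p + d"
proof -
  have v': "value_II \<Omega> T c \<A> \<epsilon> F q = v q" if "q \<in> cylinder \<Omega> T" for q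
    using v that by (simp add: is_game_value_def)
  have d2: "0 < d / 2" using d by simp
  obtain S2 where S2: "S2 \<in> \<S>" and opt: "\<And>S1. S1 \<in> \<S> \<Longrightarrow> E S1 S2 p \<le> v p + d / 2"
    using value_II_approx[OF p d2] v'[OF p] by auto
  define q2 where "q2 = S2 0 (\<lambda>i\<in>{..0}. p)"
  have q2: "q2 \<in> moves c \<A> \<epsilon> p" unfolding q2_def by (rule first_move[OF S2 p])
  let ?S2 = "continue_from S2 p"
  have S2': "?S2 \<in> \<S>" by (rule continue_strategy[OF S2 p])
  have cyl: "q1 \<in> cylinder \<Omega> T" "q2 \<in> cylinder \<Omega> T" using q1 q2 sub by auto
  obtain R1 where R1: "R1 \<in> \<S>" "v q1 - d / 2 \<le> E R1 ?S2 q1"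
    using value_II_attained[OF S2' cyl(1) d2] v'[OF cyl(1)] by auto
  obtain R2 where R2: "R2 \<in> \<S>" "v q2 - d / 2 \<le> E R2 ?S2 q2"
    using value_II_attained[OF S2' cyl(2) d2] v'[OF cyl(2)] by auto
  \<comment> \<open>If both first moves coincide, the glued strategy cannot tell who won the toss and plays \<open>R1\<close>.\<close>
  define R2' where "R2' = (if q2 = q1 then R1 else R2)"
  have R2': "R2' \<in> \<S>" "v q2 - d / 2 \<le> E R2' ?S2 q2"
    using R1 R2 by (simp_all add: R2'_def)
  define S1 where "S1 = open_with p q1 R1 R2'"
  have S1: "S1 \<in> \<S>" unfolding S1_def by (rule open_with_strategy[OF p q1 R1(1) R2'(1)])
  have first: "S1 0 (\<lambda>i\<in>{..0}. p) = q1" by (simp add: S1_def open_with_def)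
  have "E (continue_from S1 p) ?S2 q1 = E R1 ?S2 q1"
    by (rule expected_payoff_cong) (simp add: S1_def continue_open_with)
  moreover have "E (continue_from S1 p) ?S2 q2 = E R2' ?S2 q2"
    by (rule expected_payoff_cong) (simp add: S1_def continue_open_with R2'_def)
  ultimately have "E S1 S2 p = (E R1 ?S2 q1 + E R2' ?S2 q2) / 2"
    using expected_payoff_step[OF S1 S2 p] unfolding first q2_def[symmetric] by simp
  then have "(v q1 + v q2) / 2 \<le> v p + d"
    using opt[OF S1] R1(2) R2'(2) by (simp add: field_simps)
  with q2 show ?thesis by blast
qed

text \<open>Negating the payoff exchanges the roles of the players, and by \<open>expected_payoff_swap\<close> the roles
  may be exchanged back. So the upper value for \<open>- F\<close> is minus the lower value for \<open>F\<close>.\<close>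

lemma is_game_value_uminus:
  assumes "is_game_value \<Omega> T c \<A> \<epsilon> F v"
  shows "is_game_value \<Omega> T c \<A> \<epsilon> (\<lambda>p. - F p) (\<lambda>p. - v p)"
proof -
  have minus: "expected_payoff \<Omega> T \<epsilon> (\<lambda>p. - F p) S1 S2 p = - E S1 S2 p" for S1 S2 p
    by (simp add: expected_payoff_def)
  have "value_I \<Omega> T c \<A> \<epsilon> (\<lambda>p. - F p) p = - value_II \<Omega> T c \<A> \<epsilon> F p \<and>
        value_II \<Omega> T c \<A> \<epsilon> (\<lambda>p. - F p) p = - value_I \<Omega> T c \<A> \<epsilon> F p" if p: "p \<in> cylinder \<Omega> T" for p
  proof -
    have swap: "E S1 S2 p = E S2 S1 p" if "S1 \<in> \<S>" "S2 \<in> \<S>" for S1 S2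
      using expected_payoff_swap[OF that] p by simp
    have neg_INF: "(INF x\<in>\<S>. - g x) = - (SUP x\<in>\<S>. g x)"
      and neg_SUP: "(SUP x\<in>\<S>. - g x) = - (INF x\<in>\<S>. g x)" for g :: "'n strategy \<Rightarrow> real"
      by (simp_all add: Inf_real_def image_image)
    have "value_I \<Omega> T c \<A> \<epsilon> (\<lambda>p. - F p) p = (SUP S1\<in>\<S>. INF S2\<in>\<S>. - E S2 S1 p)"
      unfolding value_I_def minus by (intro SUP_cong INF_cong refl) (simp add: swap)
    moreover have "value_II \<Omega> T c \<A> \<epsilon> (\<lambda>p. - F p) p = (INF S2\<in>\<S>. SUP S1\<in>\<S>. - E S2 S1 p)"
      unfolding value_II_def minus by (intro SUP_cong INF_cong refl) (simp add: swap)
    ultimately show ?thesis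
      by (simp add: neg_INF neg_SUP value_I_def value_II_def)
  qed
  then show ?thesis using assms by (simp add: is_game_value_def)
qed

end

section \<open>Calculus of test functions\<close>

lemma norm_matrix_vector_mult_le:
  fixes A :: "real^'n^'m"
  shows "norm (A *v x) \<le> norm A * norm x"
proof -
  have "norm (A *v x) = L2_set (\<lambda>i. norm ((A $ i) \<bullet> x)) UNIV"
    by (simp add: norm_vec_def matrix_vector_mul_component)
  also have "\<dots> \<le> L2_set (\<lambda>i. norm (A $ i) * norm x) UNIV"
    by (intro L2_set_mono) (simp_all add: Cauchy_Schwarz_ineq2)
  also have "\<dots> = norm A * norm x"
    by (simp add: norm_vec_def[of A] L2_set_left_distrib)
  finally show ?thesis .
qed

lemma abs_quadratic_form_le:
  fixes A :: "real^'n^'n"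
  assumes "norm A \<le> e" "norm h \<le> \<rho>"
  shows "\<bar>(A *v h) \<bullet> h\<bar> \<le> e * \<rho>\<^sup>2"
proof -
  have "\<bar>(A *v h) \<bullet> h\<bar> \<le> norm (A *v h) * norm h" by (rule Cauchy_Schwarz_ineq2)
  also have "\<dots> \<le> (norm A * norm h) * norm h"
    by (intro mult_right_mono norm_matrix_vector_mult_le) simp
  also have "\<dots> \<le> (e * \<rho>) * \<rho>"
    using assms by (intro mult_mono mult_nonneg_nonneg) (auto intro: order_trans[OF norm_ge_zero])
  finally show ?thesis by (simp add: power2_eq_square mult.assoc)
qed

lemma GDERIV_along_line:
  assumes "GDERIV \<phi> (p + s *\<^sub>R w) :> G"
  shows "((\<lambda>s. \<phi> (p + s *\<^sub>R w)) has_real_derivative (w \<bullet> G)) (at s)"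
proof -
  have "((\<lambda>s. p + s *\<^sub>R w) has_derivative (\<lambda>h. h *\<^sub>R w)) (at s)"
    by (auto intro!: derivative_eq_intros)
  from has_derivative_compose[OF this assms[unfolded gderiv_def]]
  show ?thesis by (simp add: has_field_derivative_def mult.commute[of _ "w \<bullet> G"])
qed

text \<open>The first half of Schwarz' theorem: the mixed second difference, written as a mean value of first
  differences of the gradient in direction \<open>a\<close>, is \<open>\<theta>\<^sup>2\<close> times the Hessian form up to a small error.\<close>

lemma second_difference_approx:
  fixes \<phi> :: "real^'n \<Rightarrow> real" and H :: "real^'n^'n"
  assumes S: "open S" "x \<in> S" and g: "\<And>y. y \<in> S \<Longrightarrow> GDERIV \<phi> y :> g y"
    and H: "(g has_derivative (\<lambda>w. H *v w)) (at x)" and e: "0 < e"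
  shows "\<exists>d>0. \<forall>\<theta>. 0 < \<theta> \<longrightarrow> \<theta> < d \<longrightarrow>
    \<bar>\<phi> (x + \<theta> *\<^sub>R a + \<theta> *\<^sub>R b) - \<phi> (x + \<theta> *\<^sub>R a) - \<phi> (x + \<theta> *\<^sub>R b) + \<phi> x
      - \<theta>\<^sup>2 * ((H *v a) \<bullet> b)\<bar> \<le> e * \<theta>\<^sup>2 * ((norm a + 2 * norm b) * norm b)"
proof -
  obtain d1 where d1: "0 < d1" "ball x d1 \<subseteq> S" using S open_contains_ball by blast
  obtain d2 where d2: "0 < d2" and
    app: "\<And>w. norm w < d2 \<Longrightarrow> norm (g (x + w) - g x - H *v w) \<le> e * norm w"
    using H e unfolding has_derivative_at_alt by (metis add_diff_cancel_left')
  let ?n = "norm a + norm b + 1"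
  have n: "0 < ?n" by (simp add: add_nonneg_pos)
  show ?thesis
  proof (intro exI conjI allI impI)
    show "0 < min d1 d2 / ?n" using d1 d2 n by simp
    fix \<theta> :: real assume \<theta>: "0 < \<theta>" "\<theta> < min d1 d2 / ?n"
    then have small: "\<theta> * ?n < min d1 d2" using n by (simp add: pos_less_divide_eq)
    have bnd: "norm (\<alpha> *\<^sub>R (\<theta> *\<^sub>R a) + s *\<^sub>R (\<theta> *\<^sub>R b)) \<le> \<theta> * (\<alpha> * norm a + s * norm b)"
      if "0 \<le> s" "0 \<le> \<alpha>" for s \<alpha>
      by (rule order_trans[OF norm_triangle_ineq]) (use that \<theta> in \<open>simp add: algebra_simps\<close>)
    have bnd1: "norm (\<alpha> *\<^sub>R (\<theta> *\<^sub>R a) + s *\<^sub>R (\<theta> *\<^sub>R b)) < min d1 d2"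
      if "0 \<le> s" "s \<le> 1" "0 \<le> \<alpha>" "\<alpha> \<le> 1" for s \<alpha>
    proof -
      have "\<theta> * (\<alpha> * norm a + s * norm b) \<le> \<theta> * ?n"
        using that \<theta> mult_right_mono[OF that(2), of "norm b"] mult_right_mono[OF that(4), of "norm a"]
        by (intro mult_left_mono) auto
      with bnd[OF that(1,3)] small show ?thesis by linarith
    qed
    have inS: "x + (\<alpha> *\<^sub>R (\<theta> *\<^sub>R a) + s *\<^sub>R (\<theta> *\<^sub>R b)) \<in> S"
      if "0 \<le> s" "s \<le> 1" "0 \<le> \<alpha>" "\<alpha> \<le> 1" for s \<alpha>
      using bnd1[OF that] d1(2) by (auto simp: dist_norm subset_iff norm_minus_commute)
    let ?f = "\<lambda>s. \<phi> ((x + \<theta> *\<^sub>R a) + s *\<^sub>R (\<theta> *\<^sub>R b)) - \<phi> (x + s *\<^sub>R (\<theta> *\<^sub>R b))"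
    let ?f' = "\<lambda>s. (\<theta> *\<^sub>R b) \<bullet> g ((x + \<theta> *\<^sub>R a) + s *\<^sub>R (\<theta> *\<^sub>R b)) - (\<theta> *\<^sub>R b) \<bullet> g (x + s *\<^sub>R (\<theta> *\<^sub>R b))"
    have "(?f has_real_derivative ?f' s) (at s)" if "0 \<le> s" "s \<le> 1" for s
      using inS[OF that, of 1] inS[OF that, of 0]
      by (intro DERIV_diff GDERIV_along_line g) (simp_all add: add.assoc)
    then have "\<exists>s. 0 < s \<and> s < 1 \<and> ?f 1 - ?f 0 = (1 - 0) * ?f' s"
      by (intro MVT2) auto
    then obtain s where s: "0 < s" "s < 1" "?f 1 - ?f 0 = ?f' s" by auto
    define w1 where "w1 = \<theta> *\<^sub>R a + s *\<^sub>R (\<theta> *\<^sub>R b)"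
    define w0 where "w0 = s *\<^sub>R (\<theta> *\<^sub>R b)"
    have "norm w1 \<le> \<theta> * (norm a + s * norm b)" "norm w1 < d2" "norm w0 \<le> \<theta> * (s * norm b)" "norm w0 < d2"
      using bnd[of s 1] bnd1[of s 1] bnd[of s 0] bnd1[of s 0] s by (simp_all add: w1_def w0_def)
    moreover have "\<theta> * (s * norm b) \<le> \<theta> * norm b"
      using s \<theta> by (intro mult_left_mono mult_left_le_one_le) auto
    ultimately have w: "norm w1 + norm w0 \<le> \<theta> * (norm a + 2 * norm b)" "norm w1 < d2" "norm w0 < d2"
      by (auto simp: algebra_simps)
    define r where "r = (g (x + w1) - g x - H *v w1) - (g (x + w0) - g x - H *v w0)"
    have "norm r \<le> e * norm w1 + e * norm w0"
      unfolding r_def by (rule order_trans[OF norm_triangle_ineq4]) (intro add_mono app w)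
    also have "\<dots> \<le> e * (\<theta> * (norm a + 2 * norm b))"
      using mult_left_mono[OF w(1), of e] e by (simp add: algebra_simps)
    finally have r: "norm r \<le> e * (\<theta> * (norm a + 2 * norm b))" .
    have "g (x + w1) - g (x + w0) = \<theta> *\<^sub>R (H *v a) + r"
      by (simp add: r_def w1_def w0_def matrix_vector_right_distrib matrix_vector_mult_scaleR)
    moreover have "?f 1 - ?f 0 = \<theta> * (b \<bullet> (g (x + w1) - g (x + w0)))"
      unfolding s(3) w1_def w0_def by (simp add: inner_diff_right algebra_simps)
    ultimately have "?f 1 - ?f 0 = \<theta>\<^sup>2 * ((H *v a) \<bullet> b) + \<theta> * (b \<bullet> r)"
      by (simp add: inner_add_right inner_commute power2_eq_square algebra_simps)
    moreover have "\<bar>\<theta> * (b \<bullet> r)\<bar> \<le> e * \<theta>\<^sup>2 * ((norm a + 2 * norm b) * norm b)"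
    proof -
      have "\<bar>\<theta> * (b \<bullet> r)\<bar> \<le> \<theta> * (norm b * norm r)"
        using \<theta> Cauchy_Schwarz_ineq2[of b r] by (simp add: abs_mult)
      also have "\<dots> \<le> \<theta> * (norm b * (e * (\<theta> * (norm a + 2 * norm b))))"
        using \<theta> r by (intro mult_left_mono) auto
      finally show ?thesis by (simp add: power2_eq_square algebra_simps)
    qed
    ultimately show "\<bar>\<phi> (x + \<theta> *\<^sub>R a + \<theta> *\<^sub>R b) - \<phi> (x + \<theta> *\<^sub>R a) - \<phi> (x + \<theta> *\<^sub>R b) + \<phi> x
      - \<theta>\<^sup>2 * ((H *v a) \<bullet> b)\<bar> \<le> e * \<theta>\<^sup>2 * ((norm a + 2 * norm b) * norm b)"
      by (simp add: algebra_simps)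
  qed
qed

text \<open>The second difference is symmetric in the two directions. The symmetry matters because the
  envelopes only look at symmetric matrices.\<close>

lemma symmetric_Hessian:
  fixes \<phi> :: "real^'n \<Rightarrow> real" and H :: "real^'n^'n"
  assumes S: "open S" "x \<in> S" and g: "\<And>y. y \<in> S \<Longrightarrow> GDERIV \<phi> y :> g y"
    and H: "(g has_derivative (\<lambda>w. H *v w)) (at x)"
  shows "transpose H = H"
proof -
  have "(H *v a) \<bullet> b = (H *v b) \<bullet> a" for a b
  proof (rule ccontr)
    assume "(H *v a) \<bullet> b \<noteq> (H *v b) \<bullet> a"
    then have D: "0 < \<bar>(H *v a) \<bullet> b - (H *v b) \<bullet> a\<bar>" (is "0 < ?D") by simp
    define C where "C = (norm a + 2 * norm b) * norm b + (norm b + 2 * norm a) * norm a + 1"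
    have C: "0 < C" unfolding C_def by (intro add_nonneg_pos add_nonneg_nonneg mult_nonneg_nonneg) auto
    define e where "e = ?D / (2 * C)"
    have e: "0 < e" using D C by (simp add: e_def)
    obtain d1 where d1: "0 < d1" "\<And>\<theta>. 0 < \<theta> \<Longrightarrow> \<theta> < d1 \<Longrightarrow>
      \<bar>\<phi> (x + \<theta> *\<^sub>R a + \<theta> *\<^sub>R b) - \<phi> (x + \<theta> *\<^sub>R a) - \<phi> (x + \<theta> *\<^sub>R b) + \<phi> x
      - \<theta>\<^sup>2 * ((H *v a) \<bullet> b)\<bar> \<le> e * \<theta>\<^sup>2 * ((norm a + 2 * norm b) * norm b)"
      using second_difference_approx[OF S g H e, of a b] by blast
    obtain d2 where d2: "0 < d2" "\<And>\<theta>. 0 < \<theta> \<Longrightarrow> \<theta> < d2 \<Longrightarrow>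
      \<bar>\<phi> (x + \<theta> *\<^sub>R b + \<theta> *\<^sub>R a) - \<phi> (x + \<theta> *\<^sub>R b) - \<phi> (x + \<theta> *\<^sub>R a) + \<phi> x
      - \<theta>\<^sup>2 * ((H *v b) \<bullet> a)\<bar> \<le> e * \<theta>\<^sup>2 * ((norm b + 2 * norm a) * norm a)"
      using second_difference_approx[OF S g H e, of b a] by blast
    define \<theta> where "\<theta> = min d1 d2 / 2"
    have \<theta>: "0 < \<theta>" "\<theta> < d1" "\<theta> < d2" using d1(1) d2(1) by (auto simp: \<theta>_def)
    have swap: "x + \<theta> *\<^sub>R b + \<theta> *\<^sub>R a = x + \<theta> *\<^sub>R a + \<theta> *\<^sub>R b" by simp
    have "\<bar>\<theta>\<^sup>2 * ((H *v a) \<bullet> b) - \<theta>\<^sup>2 * ((H *v b) \<bullet> a)\<bar> \<le>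
        e * \<theta>\<^sup>2 * ((norm a + 2 * norm b) * norm b) + e * \<theta>\<^sup>2 * ((norm b + 2 * norm a) * norm a)"
      using d1(2)[OF \<theta>(1,2)] d2(2)[OF \<theta>(1,3)] unfolding swap by linarith
    also have "\<dots> = \<theta>\<^sup>2 * (e * (C - 1))" by (simp add: C_def algebra_simps)
    finally have "\<theta>\<^sup>2 * ?D \<le> \<theta>\<^sup>2 * (e * (C - 1))"
      by (simp add: abs_mult flip: right_diff_distrib)
    then have "?D \<le> e * (C - 1)" using \<theta> by simp
    also have "\<dots> \<le> e * C" using e by simp
    also have "\<dots> = ?D / 2" using C by (simp add: e_def)
    finally show False using D by simp
  qed
  then have sym: "(H *v axis j 1) \<bullet> axis i 1 = (H *v axis i 1) \<bullet> axis j 1" for i j by blast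
  have "H $ i $ j = H $ j $ i" for i j
    using sym[of j i] by (simp add: inner_axis matrix_vector_mult_basis column_def)
  then show ?thesis by (simp add: transpose_def vec_eq_iff)
qed

text \<open>A step of parabolic size \<open>\<rho>\<close>, backwards in time, from a point \<open>(x, t)\<close> close to \<open>p0\<close>. The moves of
  the \<open>\<epsilon>\<close>-game are such steps with \<open>\<rho> = \<epsilon>\<close>.\<close>

definition parabolic_step ::
  "real \<Rightarrow> (real^'n) \<times> real \<Rightarrow> real \<Rightarrow> real^'n \<Rightarrow> real \<Rightarrow> real^'n \<Rightarrow> real \<Rightarrow> real \<Rightarrow> bool" where
  "parabolic_step T p0 \<delta> x t h \<tau> \<rho> \<longleftrightarrow>
     norm (x - fst p0) < \<delta> \<and> \<bar>t - snd p0\<bar> < \<delta> \<and> t \<le> T \<and>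
     0 < \<rho> \<and> \<rho> < \<delta> \<and> norm h \<le> \<rho> \<and> 0 \<le> \<tau> \<and> \<tau> \<le> \<rho>\<^sup>2"

lemma parabolic_step_mono:
  "parabolic_step T p0 \<delta> x t h \<tau> \<rho> \<Longrightarrow> \<delta> \<le> \<delta>' \<Longrightarrow> parabolic_step T p0 \<delta>' x t h \<tau> \<rho>"
  by (auto simp: parabolic_step_def)

text \<open>Everything the game needs to know about a test function at \<open>p0\<close>: a first-order expansion with
  error \<open>o(\<rho>)\<close>, and a second-order one with error \<open>o(\<rho>\<^sup>2)\<close> for the symmetric sum, in which the gradient
  has cancelled. Both are uniform over the base points near \<open>p0\<close>, because the points at which they are
  used only converge to \<open>p0\<close>. Unlike the class \<open>C\<^sup>2\<^sup>,\<^sup>1\<close> on the cylinder this is a local notion, stable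
  under translations and under subtraction of the powers used below.\<close>

definition parabolic_expansion ::
  "real \<Rightarrow> ((real^'n) \<times> real \<Rightarrow> real) \<Rightarrow> (real^'n) \<times> real \<Rightarrow> real^'n \<Rightarrow> real^'n^'n \<Rightarrow> real \<Rightarrow> bool" where
  "parabolic_expansion T \<phi> p0 v M s \<longleftrightarrow>
     (\<forall>e>0. \<exists>\<delta>>0. \<forall>x t h \<tau> \<rho>. parabolic_step T p0 \<delta> x t h \<tau> \<rho> \<longrightarrow>
        \<bar>\<phi> (x + h, t - \<tau>) - \<phi> (x, t) - v \<bullet> h\<bar> \<le> e * \<rho> \<and>
        \<bar>\<phi> (x + h, t - \<tau>) + \<phi> (x - h, t - \<tau>) - 2 * \<phi> (x, t) + 2 * s * \<tau> - (M *v h) \<bullet> h\<bar> \<le> e * \<rho>\<^sup>2)"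

lemma parabolic_expansion_translate:
  assumes "parabolic_expansion T \<phi> (y, t) v M s"
  shows "parabolic_expansion T (\<lambda>q. \<phi> (fst q + (y - x), snd q)) (x, t) v M s"
proof -
  have step: "parabolic_step T (y, t) \<delta> (x' + (y - x)) t' h \<tau> \<rho>"
    if "parabolic_step T (x, t) \<delta> x' t' h \<tau> \<rho>" for \<delta> x' t' h \<tau> \<rho>
    using that by (simp add: parabolic_step_def algebra_simps)
  have eq: "x' + h + (y - x) = x' + (y - x) + h" "x' - h + (y - x) = x' + (y - x) - h" for x' h
    by (simp_all add: algebra_simps)
  show ?thesis
    using assms step unfolding parabolic_expansion_def fst_conv snd_conv eq by meson
qed

lemma parabolic_expansion_diff_flat:
  assumes 1: "parabolic_expansion T \<phi> p0 v M s" and 2: "parabolic_expansion T \<psi> p0 0 0 0" and k: "0 \<le> k"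
  shows "parabolic_expansion T (\<lambda>q. \<phi> q - k * \<psi> q) p0 v M s"
  unfolding parabolic_expansion_def
proof (intro allI impI)
  fix e :: real assume e: "0 < e"
  then have e1: "0 < e / 2" and e2: "0 < e / (2 * (k + 1))" using k by auto
  have ke: "k * (e / (2 * (k + 1))) \<le> e / 2" using e k by (simp add: field_simps)
  obtain \<delta>1 where \<delta>1: "0 < \<delta>1" and A: "\<forall>x t h \<tau> \<rho>. parabolic_step T p0 \<delta>1 x t h \<tau> \<rho> \<longrightarrow>
        \<bar>\<phi> (x + h, t - \<tau>) - \<phi> (x, t) - v \<bullet> h\<bar> \<le> e / 2 * \<rho> \<and>
        \<bar>\<phi> (x + h, t - \<tau>) + \<phi> (x - h, t - \<tau>) - 2 * \<phi> (x, t) + 2 * s * \<tau> - (M *v h) \<bullet> h\<bar> \<le> e / 2 * \<rho>\<^sup>2"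
    using 1 e1 unfolding parabolic_expansion_def by blast
  obtain \<delta>2 where \<delta>2: "0 < \<delta>2" and B: "\<forall>x t h \<tau> \<rho>. parabolic_step T p0 \<delta>2 x t h \<tau> \<rho> \<longrightarrow>
        \<bar>\<psi> (x + h, t - \<tau>) - \<psi> (x, t) - 0 \<bullet> h\<bar> \<le> e / (2 * (k + 1)) * \<rho> \<and>
        \<bar>\<psi> (x + h, t - \<tau>) + \<psi> (x - h, t - \<tau>) - 2 * \<psi> (x, t) + 2 * 0 * \<tau> - (0 *v h) \<bullet> h\<bar> \<le> e / (2 * (k + 1)) * \<rho>\<^sup>2"
    using 2 e2 unfolding parabolic_expansion_def by blast
  have scale: "\<bar>k * b\<bar> \<le> e / 2 * r" if "\<bar>b\<bar> \<le> e / (2 * (k + 1)) * r" "0 \<le> r" for b r :: real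
  proof -
    have "\<bar>k * b\<bar> \<le> k * (e / (2 * (k + 1)) * r)"
      using that k by (simp only: abs_mult abs_of_nonneg mult_left_mono)
    also have "\<dots> = (k * (e / (2 * (k + 1)))) * r" by simp
    also have "\<dots> \<le> e / 2 * r" by (rule mult_right_mono[OF ke that(2)])
    finally show ?thesis .
  qed
  have comb: "\<bar>a - k * b\<bar> \<le> e * r" if "\<bar>a\<bar> \<le> e / 2 * r" "\<bar>b\<bar> \<le> e / (2 * (k + 1)) * r" "0 \<le> r" for a b r
    using that(1) scale[OF that(2,3)] by simp
  show "\<exists>\<delta>>0. \<forall>x t h \<tau> \<rho>. parabolic_step T p0 \<delta> x t h \<tau> \<rho> \<longrightarrow>
        \<bar>\<phi> (x + h, t - \<tau>) - k * \<psi> (x + h, t - \<tau>) - (\<phi> (x, t) - k * \<psi> (x, t)) - v \<bullet> h\<bar> \<le> e * \<rho> \<and>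
        \<bar>\<phi> (x + h, t - \<tau>) - k * \<psi> (x + h, t - \<tau>) + (\<phi> (x - h, t - \<tau>) - k * \<psi> (x - h, t - \<tau>))
          - 2 * (\<phi> (x, t) - k * \<psi> (x, t)) + 2 * s * \<tau> - (M *v h) \<bullet> h\<bar> \<le> e * \<rho>\<^sup>2"
  proof (intro exI[of _ "min \<delta>1 \<delta>2"] conjI allI impI)
    show "0 < min \<delta>1 \<delta>2" using \<delta>1 \<delta>2 by simp
    fix x h :: "real^'a" and t \<tau> \<rho> :: real
    assume st: "parabolic_step T p0 (min \<delta>1 \<delta>2) x t h \<tau> \<rho>"
    then have r: "0 \<le> \<rho>" by (simp add: parabolic_step_def)
    note A' = A[rule_format, OF parabolic_step_mono[OF st]]
    note B' = B[rule_format, OF parabolic_step_mono[OF st]]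
    have "\<bar>(\<phi> (x + h, t - \<tau>) - \<phi> (x, t) - v \<bullet> h) - k * (\<psi> (x + h, t - \<tau>) - \<psi> (x, t) - 0 \<bullet> h)\<bar> \<le> e * \<rho>"
      using A' B' r by (intro comb) auto
    then show "\<bar>\<phi> (x + h, t - \<tau>) - k * \<psi> (x + h, t - \<tau>) - (\<phi> (x, t) - k * \<psi> (x, t)) - v \<bullet> h\<bar> \<le> e * \<rho>"
      by (simp add: algebra_simps)
    have "\<bar>(\<phi> (x + h, t - \<tau>) + \<phi> (x - h, t - \<tau>) - 2 * \<phi> (x, t) + 2 * s * \<tau> - (M *v h) \<bullet> h) -
        k * (\<psi> (x + h, t - \<tau>) + \<psi> (x - h, t - \<tau>) - 2 * \<psi> (x, t) + 2 * 0 * \<tau> - (0 *v h) \<bullet> h)\<bar> \<le> e * \<rho>\<^sup>2"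
      using A' B' by (intro comb) auto
    then show "\<bar>\<phi> (x + h, t - \<tau>) - k * \<psi> (x + h, t - \<tau>) + (\<phi> (x - h, t - \<tau>) - k * \<psi> (x - h, t - \<tau>))
          - 2 * (\<phi> (x, t) - k * \<psi> (x, t)) + 2 * s * \<tau> - (M *v h) \<bullet> h\<bar> \<le> e * \<rho>\<^sup>2"
      by (simp add: algebra_simps)
  qed
qed

text \<open>The exponent 4 is the smallest even one for which gradient and Hessian both vanish at the centre,
  so subtracting this function from a test function changes none of its derivatives there.\<close>

lemma parabolic_expansion_quartic:
  "parabolic_expansion T (\<lambda>q. norm (fst q - x0) ^ 4) (x0, t0) 0 0 0"
  unfolding parabolic_expansion_def
proof (intro allI impI)
  fix e :: real assume e: "0 < e"
  define \<delta> where "\<delta> = min 1 (e / 32)"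
  have \<delta>: "0 < \<delta>" "\<delta> \<le> 1" "32 * \<delta> \<le> e" using e by (auto simp: \<delta>_def)
  then have \<delta>2: "\<delta>\<^sup>2 \<le> \<delta>" by (simp add: power2_eq_square mult_left_le)
  have E1: "\<bar>norm (z + h) ^ 4 - norm z ^ 4\<bar> \<le> e * \<rho>"
    if "norm z < \<delta>" "norm h \<le> \<rho>" "\<rho> < \<delta>" for z h :: "real^'a" and \<rho>
  proof -
    define a where "a = norm (z + h)"
    define b where "b = norm z"
    have ab: "0 \<le> a" "0 \<le> b" "b \<le> \<delta>" "\<bar>a - b\<bar> \<le> \<rho>" "a \<le> 2 * \<delta>"
      using that norm_triangle_ineq3[of "z + h" z] norm_triangle_ineq[of z h] by (auto simp: a_def b_def)
    have "a\<^sup>2 \<le> (2 * \<delta>)\<^sup>2" "b\<^sup>2 \<le> \<delta>\<^sup>2" using ab by (intro power_mono; simp)+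
    then have "a\<^sup>2 + b\<^sup>2 \<le> 5 * \<delta>" using \<delta>2 by (simp add: power_mult_distrib)
    then have "(a + b) * (a\<^sup>2 + b\<^sup>2) \<le> (3 * \<delta>) * (5 * \<delta>)" using ab by (intro mult_mono) auto
    also have "\<dots> = 15 * \<delta>\<^sup>2" by (simp add: power2_eq_square)
    also have "\<dots> \<le> e" using \<delta> \<delta>2 by linarith
    finally have f: "(a + b) * (a\<^sup>2 + b\<^sup>2) \<le> e" .
    have "a ^ 4 - b ^ 4 = ((a + b) * (a\<^sup>2 + b\<^sup>2)) * (a - b)"
      by (simp add: power4_eq_xxxx power2_eq_square algebra_simps)
    then have "\<bar>a ^ 4 - b ^ 4\<bar> = ((a + b) * (a\<^sup>2 + b\<^sup>2)) * \<bar>a - b\<bar>"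
      using ab by (simp add: abs_mult)
    also have "\<dots> \<le> e * \<rho>" using f ab e by (intro mult_mono) auto
    finally show ?thesis by (simp add: a_def b_def)
  qed
  have E2: "\<bar>norm (z + h) ^ 4 + norm (z - h) ^ 4 - 2 * norm z ^ 4\<bar> \<le> e * \<rho>\<^sup>2"
    if "norm z < \<delta>" "norm h \<le> \<rho>" "\<rho> < \<delta>" for z h :: "real^'a" and \<rho>
  proof -
    have four: "norm w ^ 4 = (w \<bullet> w)\<^sup>2" for w :: "real^'a"
      by (simp add: dot_square_norm flip: power_mult)
    have eq: "norm (z + h) ^ 4 + norm (z - h) ^ 4 - 2 * norm z ^ 4 =
        (4 * (z \<bullet> z) + 2 * (h \<bullet> h)) * (h \<bullet> h) + 8 * (z \<bullet> h)\<^sup>2"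
      unfolding four by (simp add: inner_add inner_diff inner_commute[of h z] power2_eq_square algebra_simps)
    have hh: "h \<bullet> h \<le> \<rho>\<^sup>2" "\<rho>\<^sup>2 \<le> \<delta>\<^sup>2"
      using that norm_ge_zero[of h] by (auto simp: dot_square_norm intro!: power_mono simp del: norm_ge_zero)
    have zz: "z \<bullet> z \<le> \<delta>\<^sup>2"
      using that by (simp add: dot_square_norm power_mono)
    have "(z \<bullet> h)\<^sup>2 \<le> (z \<bullet> z) * (h \<bullet> h)" by (rule Cauchy_Schwarz_ineq)
    then have "(4 * (z \<bullet> z) + 2 * (h \<bullet> h)) * (h \<bullet> h) + 8 * (z \<bullet> h)\<^sup>2 \<le> (12 * (z \<bullet> z) + 2 * (h \<bullet> h)) * (h \<bullet> h)"
      by (simp add: algebra_simps)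
    also have "\<dots> \<le> e * \<rho>\<^sup>2"
    proof (rule mult_mono)
      show "12 * (z \<bullet> z) + 2 * (h \<bullet> h) \<le> e" using zz hh \<delta> \<delta>2 by linarith
    qed (use e hh in auto)
    finally show ?thesis unfolding eq by simp
  qed
  show "\<exists>\<delta>>0. \<forall>x t h \<tau> \<rho>. parabolic_step T (x0, t0) \<delta> x t h \<tau> \<rho> \<longrightarrow>
        \<bar>norm (fst (x + h, t - \<tau>) - x0) ^ 4 - norm (fst (x, t) - x0) ^ 4 - 0 \<bullet> h\<bar> \<le> e * \<rho> \<and>
        \<bar>norm (fst (x + h, t - \<tau>) - x0) ^ 4 + norm (fst (x - h, t - \<tau>) - x0) ^ 4
          - 2 * norm (fst (x, t) - x0) ^ 4 + 2 * 0 * \<tau> - (0 *v h) \<bullet> h\<bar> \<le> e * \<rho>\<^sup>2"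
  proof (intro exI[of _ \<delta>] conjI \<delta>(1) allI impI)
    fix x h :: "real^'a" and t \<tau> \<rho> :: real
    assume st: "parabolic_step T (x0, t0) \<delta> x t h \<tau> \<rho>"
    have eq: "x + h - x0 = (x - x0) + h" "x - h - x0 = (x - x0) - h" by simp_all
    have "norm (x - x0) < \<delta>" "norm h \<le> \<rho>" "\<rho> < \<delta>" using st by (simp_all add: parabolic_step_def)
    from E1[OF this] E2[OF this]
    show "\<bar>norm (fst (x + h, t - \<tau>) - x0) ^ 4 - norm (fst (x, t) - x0) ^ 4 - 0 \<bullet> h\<bar> \<le> e * \<rho>"
      "\<bar>norm (fst (x + h, t - \<tau>) - x0) ^ 4 + norm (fst (x - h, t - \<tau>) - x0) ^ 4
          - 2 * norm (fst (x, t) - x0) ^ 4 + 2 * 0 * \<tau> - (0 *v h) \<bullet> h\<bar> \<le> e * \<rho>\<^sup>2"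
      unfolding fst_conv eq by simp_all
  qed
qed

lemma parabolic_expansion_time_square:
  "parabolic_expansion T (\<lambda>q. (snd q - t0)\<^sup>2) (x0, t0) 0 0 0"
  unfolding parabolic_expansion_def
proof (intro allI impI)
  fix e :: real assume e: "0 < e"
  define \<delta> where "\<delta> = min 1 (e / 6)"
  have \<delta>: "0 < \<delta>" "\<delta> \<le> 1" "6 * \<delta> \<le> e" using e by (auto simp: \<delta>_def)
  have E: "\<bar>(t - \<tau> - t0)\<^sup>2 - (t - t0)\<^sup>2\<bar> \<le> e / 2 * \<rho>\<^sup>2 \<and> e / 2 * \<rho>\<^sup>2 \<le> e * \<rho>"
    if "\<bar>t - t0\<bar> < \<delta>" "0 < \<rho>" "\<rho> < \<delta>" "0 \<le> \<tau>" "\<tau> \<le> \<rho>\<^sup>2" for t \<tau> \<rho>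
  proof -
    have r: "\<rho>\<^sup>2 \<le> \<rho>" using that \<delta> by (simp add: power2_eq_square mult_left_le)
    have "\<bar>(t - \<tau> - t0)\<^sup>2 - (t - t0)\<^sup>2\<bar> = \<bar>\<tau> - 2 * (t - t0)\<bar> * \<tau>"
    proof -
      have "(t - \<tau> - t0)\<^sup>2 - (t - t0)\<^sup>2 = (\<tau> - 2 * (t - t0)) * \<tau>"
        by (simp add: power2_eq_square algebra_simps)
      then show ?thesis using that by (simp add: abs_mult)
    qed
    also have "\<dots> \<le> (3 * \<delta>) * \<rho>\<^sup>2"
      using that r by (intro mult_mono) (auto simp: abs_le_iff)
    also have "\<dots> \<le> e / 2 * \<rho>\<^sup>2" using \<delta> by (intro mult_right_mono) auto
    finally have 1: "\<bar>(t - \<tau> - t0)\<^sup>2 - (t - t0)\<^sup>2\<bar> \<le> e / 2 * \<rho>\<^sup>2" .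
    have "e / 2 * \<rho>\<^sup>2 \<le> e * \<rho>" using e r that by (intro mult_mono) auto
    with 1 show ?thesis by simp
  qed
  show "\<exists>\<delta>>0. \<forall>x t h \<tau> \<rho>. parabolic_step T (x0, t0) \<delta> x t h \<tau> \<rho> \<longrightarrow>
        \<bar>(snd (x + h, t - \<tau>) - t0)\<^sup>2 - (snd (x, t) - t0)\<^sup>2 - 0 \<bullet> h\<bar> \<le> e * \<rho> \<and>
        \<bar>(snd (x + h, t - \<tau>) - t0)\<^sup>2 + (snd (x - h, t - \<tau>) - t0)\<^sup>2
          - 2 * (snd (x, t) - t0)\<^sup>2 + 2 * 0 * \<tau> - (0 *v h) \<bullet> h\<bar> \<le> e * \<rho>\<^sup>2"
  proof (intro exI[of _ \<delta>] conjI \<delta>(1) allI impI)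
    fix x h :: "real^'a" and t \<tau> \<rho> :: real
    assume "parabolic_step T (x0, t0) \<delta> x t h \<tau> \<rho>"
    then have E': "\<bar>(t - \<tau> - t0)\<^sup>2 - (t - t0)\<^sup>2\<bar> \<le> e / 2 * \<rho>\<^sup>2" "e / 2 * \<rho>\<^sup>2 \<le> e * \<rho>"
      using E[of t \<rho> \<tau>] by (simp_all add: parabolic_step_def)
    then show "\<bar>(snd (x + h, t - \<tau>) - t0)\<^sup>2 - (snd (x, t) - t0)\<^sup>2 - 0 \<bullet> h\<bar> \<le> e * \<rho>"
      by simp
    have "\<bar>2 * ((t - \<tau> - t0)\<^sup>2 - (t - t0)\<^sup>2)\<bar> \<le> e * \<rho>\<^sup>2"
      using E'(1) unfolding abs_mult by simp
    then show "\<bar>(snd (x + h, t - \<tau>) - t0)\<^sup>2 + (snd (x - h, t - \<tau>) - t0)\<^sup>2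
          - 2 * (snd (x, t) - t0)\<^sup>2 + 2 * 0 * \<tau> - (0 *v h) \<bullet> h\<bar> \<le> e * \<rho>\<^sup>2"
      by simp
  qed
qed


lemma continuous_on_closure_near:
  fixes f :: "(real^'n) \<times> real \<Rightarrow> 'b::real_normed_vector"
  assumes "continuous_on (closure C) f" "p \<in> C" "0 < e"
  obtains \<delta> where "0 < \<delta>"
    "\<And>x t. (x, t) \<in> C \<Longrightarrow> norm (x - fst p) < \<delta> \<Longrightarrow> \<bar>t - snd p\<bar> < \<delta> \<Longrightarrow> norm (f (x, t) - f p) < e"
proof -
  have "continuous_on C f" by (rule continuous_on_subset[OF assms(1) closure_subset])
  with assms(2,3) obtain d where d: "0 < d" "\<And>q. q \<in> C \<Longrightarrow> dist q p < d \<Longrightarrow> dist (f q) (f p) < e"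
    unfolding continuous_on_iff by blast
  show thesis
  proof (rule that[of "d / 2"])
    show "0 < d / 2" using d by simp
    fix x t assume a: "(x, t) \<in> C" "norm (x - fst p) < d / 2" "\<bar>t - snd p\<bar> < d / 2"
    have "dist (x, t) p \<le> norm (x - fst p) + \<bar>t - snd p\<bar>"
      using norm_Pair_le[of "x - fst p" "t - snd p"] by (simp add: dist_norm minus_prod_def)
    with a d(2)[OF a(1)] show "norm (f (x, t) - f p) < e" by (simp add: dist_norm)
  qed
qed

lemma closure_cylinder_time:
  assumes "q \<in> closure (cylinder \<Omega> T)" "x \<in> closure \<Omega>"
  shows "(x, snd q) \<in> closure (cylinder \<Omega> T)"
  using assms unfolding cylinder_def closure_Times by (auto simp: mem_Times_iff)

lemma Taylor_along_line:
  fixes \<phi> :: "real^'n \<Rightarrow> real" and H :: "real^'n \<Rightarrow> real^'n^'n"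
  assumes g: "\<And>s. 0 \<le> s \<Longrightarrow> s \<le> 1 \<Longrightarrow> GDERIV \<phi> (x + s *\<^sub>R h) :> g (x + s *\<^sub>R h)"
    and H: "\<And>s. 0 \<le> s \<Longrightarrow> s \<le> 1 \<Longrightarrow> (g has_derivative (\<lambda>w. H (x + s *\<^sub>R h) *v w)) (at (x + s *\<^sub>R h))"
  shows "\<exists>s. 0 < s \<and> s < 1 \<and> \<phi> (x + h) = \<phi> x + h \<bullet> g x + ((H (x + s *\<^sub>R h) *v h) \<bullet> h) / 2"
proof -
  define D where "D = (\<lambda>m::nat. if m = 0 then (\<lambda>s. \<phi> (x + s *\<^sub>R h))
    else if m = 1 then (\<lambda>s. h \<bullet> g (x + s *\<^sub>R h)) else (\<lambda>s. (H (x + s *\<^sub>R h) *v h) \<bullet> h))"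
  have "DERIV (D m) s :> D (Suc m) s" if "m < 2" "0 \<le> s" "s \<le> 1" for m s
  proof (cases "m = 0")
    case True
    then show ?thesis using GDERIV_along_line[OF g[OF that(2,3)]] by (simp add: D_def)
  next
    case False
    then have m: "m = 1" using that by simp
    have "((\<lambda>s. x + s *\<^sub>R h) has_derivative (\<lambda>k. k *\<^sub>R h)) (at s)"
      by (auto intro!: derivative_eq_intros)
    from has_derivative_compose[OF this H[OF that(2,3)]]
    have "((\<lambda>s. h \<bullet> g (x + s *\<^sub>R h)) has_derivative (\<lambda>k. h \<bullet> (H (x + s *\<^sub>R h) *v (k *\<^sub>R h)))) (at s)"
      by (rule has_derivative_inner_right)
    moreover have "(\<lambda>k. h \<bullet> (H (x + s *\<^sub>R h) *v (k *\<^sub>R h))) = (*) ((H (x + s *\<^sub>R h) *v h) \<bullet> h)"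
      by (simp add: fun_eq_iff matrix_vector_mult_scaleR inner_commute mult.commute)
    ultimately show ?thesis
      by (simp add: m D_def has_field_derivative_def)
  qed
  then have "\<exists>s. 0 < s \<and> s < 1 \<and> \<phi> (x + 1 *\<^sub>R h) = (\<Sum>m<2. D m 0 / fact m * 1 ^ m) + D 2 s / fact 2 * 1 ^ 2"
    by (intro Maclaurin) (auto simp: D_def)
  then show ?thesis by (simp add: D_def numeral_2_eq_2)
qed

text \<open>Taylor's theorem along the spatial segments at the time of arrival \<open>t - \<tau>\<close>, and the mean value
  theorem in time at the fixed point \<open>x\<close>. The derivative in time is one-sided at \<open>t = T\<close>,
  which suffices because the steps go backwards.\<close>

lemma C21_parabolic_expansion:
  fixes \<Omega> :: "(real^'n) set"
  assumes C21: "has_C21_derivs \<Omega> T \<phi> g H d" and op: "open \<Omega>" and p0: "p0 \<in> cylinder \<Omega> T"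
  shows "parabolic_expansion T \<phi> p0 (g p0) (H p0) (d p0)"
  unfolding parabolic_expansion_def
proof (intro allI impI)
  fix e :: real assume e: "0 < e"
  let ?C = "cylinder \<Omega> T"
  obtain x0 t0 where p: "p0 = (x0, t0)" by fastforce
  have x0: "x0 \<in> \<Omega>" and t0: "0 < t0" "t0 \<le> T" using p0 by (auto simp: p cylinder_def)
  have cont: "continuous_on (closure ?C) g" "continuous_on (closure ?C) H" "continuous_on (closure ?C) d"
    using C21 by (auto simp: has_C21_derivs_def)
  have dg: "GDERIV (\<lambda>y. \<phi> (y, t)) x :> g (x, t)"
    and dH: "((\<lambda>y. g (y, t)) has_derivative (\<lambda>w. H (x, t) *v w)) (at x)"
    and dt: "((\<lambda>s. \<phi> (x, s)) has_real_derivative d (x, t)) (at t within {0..T})"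
    if "(x, t) \<in> ?C" for x t
    using C21 that by (auto simp: has_C21_derivs_def)
  have e2: "0 < e / 2" and e4: "0 < e / 4" using e by auto
  obtain \<delta>g where \<delta>g: "0 < \<delta>g" "\<And>x t. (x, t) \<in> ?C \<Longrightarrow> norm (x - x0) < \<delta>g \<Longrightarrow> \<bar>t - t0\<bar> < \<delta>g \<Longrightarrow> norm (g (x, t) - g p0) < e / 2"
    using continuous_on_closure_near[OF cont(1) p0 e2] by (metis p fst_conv snd_conv)
  obtain \<delta>H where \<delta>H: "0 < \<delta>H" "\<And>x t. (x, t) \<in> ?C \<Longrightarrow> norm (x - x0) < \<delta>H \<Longrightarrow> \<bar>t - t0\<bar> < \<delta>H \<Longrightarrow> norm (H (x, t) - H p0) < e / 2"
    using continuous_on_closure_near[OF cont(2) p0 e2] by (metis p fst_conv snd_conv)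
  obtain \<delta>d where \<delta>d: "0 < \<delta>d" "\<And>x t. (x, t) \<in> ?C \<Longrightarrow> norm (x - x0) < \<delta>d \<Longrightarrow> \<bar>t - t0\<bar> < \<delta>d \<Longrightarrow> \<bar>d (x, t) - d p0\<bar> < e / 4"
    using continuous_on_closure_near[OF cont(3) p0 e4] by (metis p fst_conv snd_conv real_norm_def)
  obtain r where r: "0 < r" "ball x0 r \<subseteq> \<Omega>" using op x0 open_contains_ball by blast
  define K where "K = \<bar>d p0\<bar> + e"
  have K: "0 < K" using e by (simp add: K_def)
  define m where "m = Min {\<delta>g, \<delta>H, \<delta>d, r, t0, 1, e / K}"
  have m_le: "m \<le> a" if "a \<in> {\<delta>g, \<delta>H, \<delta>d, r, t0, 1, e / K}" for a
    unfolding m_def by (rule Min_le[OF _ that]) simp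
  have "m \<in> {\<delta>g, \<delta>H, \<delta>d, r, t0, 1, e / K}"
    unfolding m_def by (rule Min_in) simp_all
  moreover have "0 < e / K" using e K by simp
  ultimately have m0: "0 < m"
    using \<delta>g(1) \<delta>H(1) \<delta>d(1) r(1) t0(1) zero_less_one by blast
  have m: "0 < m" "m \<le> \<delta>g" "m \<le> \<delta>H" "m \<le> \<delta>d" "m \<le> r" "m \<le> t0" "m \<le> 1" "m \<le> e / K"
    by (rule m0 | rule m_le, blast)+
  show "\<exists>\<delta>>0. \<forall>x t h \<tau> \<rho>. parabolic_step T p0 \<delta> x t h \<tau> \<rho> \<longrightarrow>
        \<bar>\<phi> (x + h, t - \<tau>) - \<phi> (x, t) - g p0 \<bullet> h\<bar> \<le> e * \<rho> \<and>
        \<bar>\<phi> (x + h, t - \<tau>) + \<phi> (x - h, t - \<tau>) - 2 * \<phi> (x, t) + 2 * d p0 * \<tau> - (H p0 *v h) \<bullet> h\<bar> \<le> e * \<rho>\<^sup>2"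
  proof (intro exI[of _ "m / 2"] allI impI conjI)
    show "0 < m / 2" using m by simp
    fix x h :: "real^'n" and t \<tau> \<rho> :: real
    assume "parabolic_step T p0 (m / 2) x t h \<tau> \<rho>"
    then have st: "norm (x - x0) < m / 2" "\<bar>t - t0\<bar> < m / 2" "t \<le> T" "0 < \<rho>" "\<rho> < m / 2"
      "norm h \<le> \<rho>" "0 \<le> \<tau>" "\<tau> \<le> \<rho>\<^sup>2"
      by (auto simp: parabolic_step_def p)
    have "\<rho>\<^sup>2 \<le> \<rho>" using st m by (simp add: power2_eq_square mult_left_le)
    with st have \<tau>: "\<tau> < m / 2" by linarith
    have near: "(x + s *\<^sub>R h', t') \<in> ?C" "norm (x + s *\<^sub>R h' - x0) < m" "\<bar>t' - t0\<bar> < m"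
      if "norm h' \<le> \<rho>" "0 \<le> s" "s \<le> 1" "t - \<tau> \<le> t'" "t' \<le> t" for s h' t'
    proof -
      have "norm (s *\<^sub>R h') \<le> norm h'" using that by (simp add: mult_left_le_one_le)
      moreover have "norm (x + s *\<^sub>R h' - x0) \<le> norm (x - x0) + norm (s *\<^sub>R h')"
        using norm_triangle_ineq[of "x - x0" "s *\<^sub>R h'"] by (simp add: algebra_simps)
      ultimately show 1: "norm (x + s *\<^sub>R h' - x0) < m" using st(1,5) that(1) by linarith
      show 2: "\<bar>t' - t0\<bar> < m" using st(2) \<tau> that(4,5) by linarith
      have "dist (x + s *\<^sub>R h') x0 < r"
        unfolding dist_norm using 1 m(5) by linarith
      then have "x + s *\<^sub>R h' \<in> \<Omega>" using r(2) by (auto simp: dist_commute)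
      moreover have "0 < t'" using 2 m(6) by linarith
      moreover have "t' \<le> T" using st(3) that(5) by linarith
      ultimately show "(x + s *\<^sub>R h', t') \<in> ?C" by (simp add: cylinder_def)
    qed
    \<comment> \<open>The increment in time has error \<open>o(\<tau>)\<close>, and \<open>\<tau> \<le> \<rho>\<^sup>2\<close>.\<close>
    have time: "\<bar>\<phi> (x, t - \<tau>) - \<phi> (x, t) + d p0 * \<tau>\<bar> \<le> e / 4 * \<tau>"
    proof (cases "\<tau> = 0")
      case False
      have C: "(x, s) \<in> ?C" if "t - \<tau> \<le> s" "s \<le> t" for s
        using near(1)[of 0 0 s] that st by simp
      have sub: "{t - \<tau>..t} \<subseteq> {0..T}"
      proof
        fix s assume "s \<in> {t - \<tau>..t}"
        then have "(x, s) \<in> ?C" by (intro C) auto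
        then show "s \<in> {0..T}" by (auto simp: cylinder_def)
      qed
      have "\<exists>\<xi>\<in>{t - \<tau><..<t}. \<phi> (x, t) - \<phi> (x, t - \<tau>) = d (x, \<xi>) * (t - (t - \<tau>))"
      proof (rule mvt_simple)
        show "t - \<tau> < t" using False st by simp
        fix s assume "t - \<tau> \<le> s" "s \<le> t"
        from has_field_derivative_subset[OF dt[OF C[OF this]] sub]
        show "((\<lambda>s. \<phi> (x, s)) has_derivative (*) (d (x, s))) (at s within {t - \<tau>..t})"
          by (simp add: has_field_derivative_def)
      qed
      then obtain \<xi> where \<xi>: "t - \<tau> < \<xi>" "\<xi> < t" "\<phi> (x, t) - \<phi> (x, t - \<tau>) = d (x, \<xi>) * \<tau>" by auto
      have "\<bar>d (x, \<xi>) - d p0\<bar> < e / 4"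
        using near[of 0 0 \<xi>] \<xi> st m by (intro \<delta>d) auto
      then have "\<bar>d (x, \<xi>) - d p0\<bar> * \<tau> \<le> e / 4 * \<tau>"
        using st by (intro mult_right_mono) auto
      moreover have "\<phi> (x, t - \<tau>) - \<phi> (x, t) + d p0 * \<tau> = - ((d (x, \<xi>) - d p0) * \<tau>)"
        using \<xi>(3) by (simp add: algebra_simps)
      ultimately show ?thesis using st by (simp add: abs_mult)
    qed simp
    let ?s = "t - \<tau>"
    have line: "\<exists>s. 0 \<le> s \<and> s \<le> 1 \<and> \<phi> (x + h', ?s) = \<phi> (x, ?s) + h' \<bullet> g (x, ?s) + ((H (x + s *\<^sub>R h', ?s) *v h') \<bullet> h') / 2"
      if "norm h' \<le> \<rho>" for h'
    proof -
      have in_C: "(x + s *\<^sub>R h', ?s) \<in> ?C" if "0 \<le> s" "s \<le> 1" for s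
        by (rule near(1)[OF \<open>norm h' \<le> \<rho>\<close> that]) (use st in auto)
      have "\<exists>s. 0 < s \<and> s < 1 \<and> \<phi> (x + h', ?s) =
          \<phi> (x, ?s) + h' \<bullet> g (x, ?s) + ((H (x + s *\<^sub>R h', ?s) *v h') \<bullet> h') / 2"
        by (rule Taylor_along_line[of "\<lambda>y. \<phi> (y, ?s)" x h' "\<lambda>y. g (y, ?s)" "\<lambda>y. H (y, ?s)"])
          (rule dg[OF in_C] dH[OF in_C]; assumption)+
      then obtain s where "0 < s" "s < 1" "\<phi> (x + h', ?s) =
          \<phi> (x, ?s) + h' \<bullet> g (x, ?s) + ((H (x + s *\<^sub>R h', ?s) *v h') \<bullet> h') / 2"
        by blast
      then show ?thesis by (intro exI[of _ s]) simp
    qed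
    have quad: "\<bar>(H (x + s *\<^sub>R h', ?s) *v h') \<bullet> h' - (H p0 *v h') \<bullet> h'\<bar> \<le> e / 2 * \<rho>\<^sup>2"
      if "norm h' \<le> \<rho>" "0 \<le> s" "s \<le> 1" for s h'
    proof -
      have "norm (H (x + s *\<^sub>R h', ?s) - H p0) < e / 2"
        using near[OF that, of ?s] st m by (intro \<delta>H) auto
      from abs_quadratic_form_le[OF less_imp_le[OF this] that(1)]
      show ?thesis by (simp add: matrix_vector_mult_diff_rdistrib inner_diff_left)
    qed
    obtain s1 where s1: "0 \<le> s1" "s1 \<le> 1"
      "\<phi> (x + h, ?s) = \<phi> (x, ?s) + h \<bullet> g (x, ?s) + ((H (x + s1 *\<^sub>R h, ?s) *v h) \<bullet> h) / 2"
      using line[OF st(6)] by blast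
    have mh: "norm (- h) \<le> \<rho>" using st by simp
    have neg: "N *v (- h) = - (N *v h)" for N :: "real^'n^'n"
      by (rule linear_neg[OF matrix_vector_mul_linear])
    obtain s2 where s2: "0 \<le> s2" "s2 \<le> 1"
      "\<phi> (x - h, ?s) = \<phi> (x, ?s) - h \<bullet> g (x, ?s) + ((H (x - s2 *\<^sub>R h, ?s) *v h) \<bullet> h) / 2"
      using line[OF mh] unfolding neg by auto
    have q1: "\<bar>(H (x + s1 *\<^sub>R h, ?s) *v h) \<bullet> h - (H p0 *v h) \<bullet> h\<bar> \<le> e / 2 * \<rho>\<^sup>2"
      by (rule quad[OF st(6) s1(1,2)])
    have q2: "\<bar>(H (x - s2 *\<^sub>R h, ?s) *v h) \<bullet> h - (H p0 *v h) \<bullet> h\<bar> \<le> e / 2 * \<rho>\<^sup>2"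
      using quad[OF mh s2(1,2)] unfolding neg by simp
    have e\<tau>: "e / 4 * \<tau> \<le> e / 4 * \<rho>\<^sup>2" using st e by (intro mult_left_mono) auto
    show "\<bar>\<phi> (x + h, t - \<tau>) + \<phi> (x - h, t - \<tau>) - 2 * \<phi> (x, t) + 2 * d p0 * \<tau> - (H p0 *v h) \<bullet> h\<bar> \<le> e * \<rho>\<^sup>2"
    proof -
      have gen: "\<bar>a - c\<bar> \<le> E / 2 \<Longrightarrow> \<bar>b - c\<bar> \<le> E / 2 \<Longrightarrow> \<bar>p - q + r\<bar> \<le> F \<Longrightarrow> F \<le> E / 4 \<Longrightarrow>
          \<bar>(p + k + a / 2) + (p - k + b / 2) - 2 * q + 2 * r - c\<bar> \<le> E" for a b c p q r k E F :: real
        by argo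
      have "e / 2 * \<rho>\<^sup>2 = (e * \<rho>\<^sup>2) / 2" "e / 4 * \<rho>\<^sup>2 = (e * \<rho>\<^sup>2) / 4" by simp_all
      from gen[OF q1[unfolded this] q2[unfolded this] time e\<tau>[unfolded this], of "h \<bullet> g (x, ?s)"]
      show ?thesis unfolding s1(3) s2(3) mult.assoc[of 2 "d p0" \<tau>] .
    qed
    have "\<exists>\<xi>. 0 < \<xi> \<and> \<xi> < 1 \<and> \<phi> (x + 1 *\<^sub>R h, ?s) - \<phi> (x + 0 *\<^sub>R h, ?s) = (1 - 0) * (h \<bullet> g (x + \<xi> *\<^sub>R h, ?s))"
      by (rule MVT2) (use GDERIV_along_line[OF dg[OF near(1)[OF st(6)]]] st in auto)
    then obtain \<xi> where \<xi>: "0 < \<xi>" "\<xi> < 1" "\<phi> (x + h, ?s) - \<phi> (x, ?s) = h \<bullet> g (x + \<xi> *\<^sub>R h, ?s)"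
      by auto
    have "norm (g (x + \<xi> *\<^sub>R h, ?s) - g p0) < e / 2"
      using near[OF st(6), of \<xi> ?s] \<xi> st m by (intro \<delta>g) auto
    then have "norm h * norm (g (x + \<xi> *\<^sub>R h, ?s) - g p0) \<le> \<rho> * (e / 2)"
      using st by (intro mult_mono) auto
    then have a: "\<bar>h \<bullet> g (x + \<xi> *\<^sub>R h, ?s) - h \<bullet> g p0\<bar> \<le> \<rho> * (e / 2)"
      using Cauchy_Schwarz_ineq2[of h "g (x + \<xi> *\<^sub>R h, ?s) - g p0"] by (simp add: inner_diff_right)
    have "\<bar>\<phi> (x, ?s) - \<phi> (x, t)\<bar> \<le> K * \<tau>"
    proof -
      have "\<bar>d p0 * \<tau>\<bar> = \<bar>d p0\<bar> * \<tau>" using st by (simp add: abs_mult)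
      moreover have "e / 4 * \<tau> \<le> e * \<tau>" using st e by (intro mult_right_mono) auto
      moreover have "\<bar>\<phi> (x, ?s) - \<phi> (x, t)\<bar> \<le> \<bar>\<phi> (x, ?s) - \<phi> (x, t) + d p0 * \<tau>\<bar> + \<bar>d p0 * \<tau>\<bar>"
        by linarith
      ultimately show ?thesis using time unfolding K_def distrib_right by linarith
    qed
    also have "\<dots> \<le> K * \<rho>\<^sup>2" using st K by (intro mult_left_mono) auto
    also have "\<dots> = (K * \<rho>) * \<rho>" by (simp add: power2_eq_square)
    also have "\<dots> \<le> (e / 2) * \<rho>"
    proof (rule mult_right_mono)
      have "K * \<rho> \<le> K * (m / 2)" using st K by (intro mult_left_mono) auto
      moreover have "m * K \<le> e" using m(8) K by (simp add: pos_le_divide_eq)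
      ultimately show "K * \<rho> \<le> e / 2" by (simp add: field_simps)
    qed (use st in simp)
    finally have b: "\<bar>\<phi> (x, ?s) - \<phi> (x, t)\<bar> \<le> (e / 2) * \<rho>" .
    show "\<bar>\<phi> (x + h, t - \<tau>) - \<phi> (x, t) - g p0 \<bullet> h\<bar> \<le> e * \<rho>"
      using a b \<xi>(3) unfolding inner_commute[of "g p0"] mult.commute[of \<rho>] by argo
  qed
qed

text \<open>The test function of time alone that remains when doubled variables collapse, \<open>x = y\<close>.\<close>

lemma parabolic_expansion_time_slice:
  fixes \<Omega> :: "(real^'n) set"
  assumes C21: "has_C21_derivs \<Omega> T \<phi> g H d" and op: "open \<Omega>" and x: "(x, t) \<in> cylinder \<Omega> T"
  shows "parabolic_expansion T (\<lambda>q. \<phi> (x, snd q)) (x, t) 0 0 (d (x, t))"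
proof -
  have xO: "x \<in> \<Omega>" using x by (simp add: cylinder_def)
  have cont: "continuous_on (closure (cylinder \<Omega> T)) (\<lambda>q. f (x, snd q))"
    if "continuous_on (closure (cylinder \<Omega> T)) f" for f :: "(real^'n) \<times> real \<Rightarrow> real"
    by (rule continuous_on_compose2[OF that])
      (use xO closure_subset[of \<Omega>] in \<open>auto intro!: continuous_intros closure_cylinder_time\<close>)
  have [simp]: "(*v) (0 :: real^'n^'n) = (\<lambda>w. 0)" by (simp add: fun_eq_iff)
  have "has_C21_derivs \<Omega> T (\<lambda>q. \<phi> (x, snd q)) (\<lambda>q. 0) (\<lambda>q. 0) (\<lambda>q. d (x, snd q))"
    using C21 xO cont unfolding has_C21_derivs_def
    by (auto simp: cylinder_def gderiv_def)
  from C21_parabolic_expansion[OF this op x] show ?thesis by simp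
qed

section \<open>Envelopes of the operator\<close>

text \<open>The suprema decrease with the radius, hence converge to their infimum, and each of them is at
  least the value at one of the given nearby points.\<close>

lemma upper_envelope_nonneg:
  fixes G :: "real^'n^'n \<Rightarrow> real^'n \<Rightarrow> real \<Rightarrow> (real^'n) \<times> real \<Rightarrow> real"
  assumes bound: "\<And>M v s p. p \<in> C \<Longrightarrow> \<bar>G M v s p\<bar> \<le> \<bar>s\<bar> + norm M"
    and ex: "\<And>\<delta>. 0 < \<delta> \<Longrightarrow> \<exists>M' v' s' p'. transpose M' = M' \<and> p' \<in> C \<and>
        norm (M - M') + \<bar>s - s'\<bar> + norm (v - v') + norm (fst p - fst p') + \<bar>snd p - snd p'\<bar> < \<delta> \<and> 0 \<le> G M' v' s' p'"
  shows "0 \<le> upper_envelope C G M v s p"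
proof -
  let ?N = "\<lambda>\<epsilon>. {G M' v' s' p' | M' v' s' p'. transpose M' = M' \<and> p' \<in> C \<and>
        norm (M - M') + \<bar>s - s'\<bar> + norm (v - v') + norm (fst p - fst p') + \<bar>snd p - snd p'\<bar> < \<epsilon>}"
  let ?S = "\<lambda>\<epsilon>. Sup (?N \<epsilon>)"
  have bdd: "bdd_above (?N \<epsilon>)" for \<epsilon>
  proof (rule bdd_aboveI[where M="\<bar>s\<bar> + norm M + \<epsilon>"])
    fix y assume "y \<in> ?N \<epsilon>"
    then obtain M' v' s' p' where y: "y = G M' v' s' p'" "p' \<in> C"
      "norm (M - M') + \<bar>s - s'\<bar> + norm (v - v') + norm (fst p - fst p') + \<bar>snd p - snd p'\<bar> < \<epsilon>" by blast
    have "norm M' \<le> norm M + norm (M - M')" using norm_triangle_ineq2[of M' M] by (simp add: norm_minus_commute)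
    moreover have "0 \<le> norm (v - v')" "0 \<le> norm (fst p - fst p')" "0 \<le> \<bar>snd p - snd p'\<bar>" by simp_all
    ultimately show "y \<le> \<bar>s\<bar> + norm M + \<epsilon>" using bound[OF y(2), of M' v' s'] y by linarith
  qed
  have mono: "?S a \<le> ?S b" if "0 < a" "a \<le> b" for a b
  proof (rule cSup_subset_mono[OF _ bdd])
    show "?N a \<noteq> {}" using ex[OF that(1)] by blast
    show "?N a \<subseteq> ?N b" using that(2) by (blast intro: less_le_trans)
  qed
  have nonneg: "0 \<le> ?S a" if a: "0 < a" for a
  proof -
    obtain M' v' s' p' where "G M' v' s' p' \<in> ?N a" "0 \<le> G M' v' s' p'" using ex[OF a] by blast
    then show ?thesis using cSup_upper[OF _ bdd] by (meson order_trans)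
  qed
  define L where "L = (INF a\<in>{0<..}. ?S a)"
  have bb: "bdd_below (?S ` {0<..})" using nonneg by (intro bdd_belowI2[where m=0]) auto
  have L0: "0 \<le> L" unfolding L_def by (rule cINF_greatest) (use nonneg in auto)
  have "(?S \<longlongrightarrow> L) (at_right 0)"
  proof (rule tendstoI)
    fix e :: real assume "0 < e"
    then have "L < L + e" by simp
    then obtain b where b: "0 < b" "?S b < L + e"
      unfolding L_def using cInf_lessD[of "?S ` {0<..}"] by force
    show "\<forall>\<^sub>F a in at_right 0. dist (?S a) L < e"
      unfolding eventually_at_right_field
    proof (intro exI[of _ b] conjI allI impI)
      fix a assume a: "0 < a" "a < b"
      have "L \<le> ?S a" unfolding L_def by (rule cINF_lower[OF bb]) (use a in simp)
      moreover have "?S a \<le> ?S b" using a by (intro mono) auto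
      ultimately show "dist (?S a) L < e" using b by (simp add: dist_real_def)
    qed (rule b)
  qed
  then have "upper_envelope C G M v s p = L"
    unfolding upper_envelope_def by (intro tendsto_Lim) simp_all
  with L0 show ?thesis by simp
qed

section \<open>Test functions touching the limit from below\<close>

lemma approximate_minimizer:
  fixes f :: "'a \<Rightarrow> real"
  assumes "S \<noteq> {}" "\<And>x. x \<in> S \<Longrightarrow> m \<le> f x" "0 < d"
  obtains x where "x \<in> S" "\<And>y. y \<in> S \<Longrightarrow> f x \<le> f y + d"
proof -
  have bdd: "bdd_below (f ` S)" using assms(2) by (intro bdd_belowI2[where m=m]) auto
  have "Inf (f ` S) < Inf (f ` S) + d" using assms(3) by simp
  then obtain x where x: "x \<in> S" "f x < Inf (f ` S) + d"
    using cInf_lessD[of "f ` S"] assms(1) by blast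
  show thesis
  proof (rule that[OF x(1)])
    fix y assume "y \<in> S"
    then have "Inf (f ` S) \<le> f y" using bdd by (intro cInf_lower) auto
    with x(2) show "f x \<le> f y + d" by simp
  qed
qed

text \<open>A uniform limit of functions that satisfy one half of the dynamic programming principle. Both the
  values of the game and their negatives are of this kind.\<close>

locale game_limit = admissible_sets \<Omega> T c \<A>
  for \<Omega> :: "(real^'n) set" and T c :: real
    and \<A> :: "(real^'n) \<times> real \<Rightarrow> ((real^'n) \<times> real) set" +
  fixes \<eta> :: real and U :: "real \<Rightarrow> (real^'n) \<times> real \<Rightarrow> real" and u :: "(real^'n) \<times> real \<Rightarrow> real"
  assumes eta: "0 < \<eta>" and op: "open \<Omega>"
    and A2: "property_A2 (cylinder \<Omega> T) \<A>"
    and A3: "property_A3 (cylinder \<Omega> T) \<A>"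
    and A4: "property_A4 (cylinder \<Omega> T) \<A>"
    and programming: "\<And>\<epsilon> p q d. 0 < \<epsilon> \<Longrightarrow> \<epsilon> \<le> \<eta> \<Longrightarrow> p \<in> cylinder \<Omega> T \<Longrightarrow>
          moves c \<A> \<epsilon> p \<subseteq> cylinder \<Omega> T \<Longrightarrow> q \<in> moves c \<A> \<epsilon> p \<Longrightarrow> 0 < d \<Longrightarrow>
          \<exists>q'\<in>moves c \<A> \<epsilon> p. (U \<epsilon> q + U \<epsilon> q') / 2 \<le> U \<epsilon> p + d"
    and cont_u: "continuous_on (closure (cylinder \<Omega> T)) u"
    and unif: "uniform_limit (closure (cylinder \<Omega> T)) U u (at_right 0)"
begin

lemma A2D:
  assumes "p \<in> cylinder \<Omega> T" "a \<in> \<A> p"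
  shows "(- fst a, snd a) \<in> \<A> p"
proof -
  have "snd a \<in> snd ` \<A> p" using assms(2) by (rule imageI)
  then have "uminus ` {y. (y, snd a) \<in> \<A> p} = {y. (y, snd a) \<in> \<A> p}"
    using A2 assms(1) unfolding property_A2_def by blast
  moreover have "- fst a \<in> uminus ` {y. (y, snd a) \<in> \<A> p}"
    using assms(2) by (intro imageI) simp
  ultimately show ?thesis by blast
qed

text \<open>The passage from the game to \<open>\<phi>\<close> before the limit. Subtracting \<open>|x - x0|\<^sup>4 + (t - t0)\<^sup>2\<close> from \<open>\<phi>\<close>
  makes the minimum strict with an explicit gap, so near-minimum points of \<open>u\<^sub>\<epsilon> - \<psi>\<close>, for the
  perturbed function \<open>\<psi>\<close>, must be close to \<open>p0\<close>. All minima are replaced by near-minima up to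
  \<open>\<epsilon>\<^sup>3\<close>, an error that vanishes after the division by \<open>\<epsilon>\<^sup>2\<close>.\<close>

lemma approximate_contact:
  assumes p0: "p0 \<in> cylinder \<Omega> T" and r: "0 < r"
    and min: "\<And>q. q \<in> cylinder \<Omega> T \<Longrightarrow> norm (fst q - fst p0) < r \<Longrightarrow> \<bar>snd q - snd p0\<bar> < r \<Longrightarrow>
        u p0 - \<phi> p0 \<le> u q - \<phi> q"
    and exp: "parabolic_expansion T \<phi> p0 v M s" and e: "0 < e"
  shows "\<exists>p a. p \<in> cylinder \<Omega> T \<and> norm (fst p - fst p0) < e \<and> \<bar>snd p - snd p0\<bar> < e \<and> a \<in> \<A> p \<and>
    - e \<le> delay c (snd a) * s - ((M *v fst a) \<bullet> fst a) / 2 \<and>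
    (\<forall>b\<in>\<A> p. v \<bullet> fst a \<le> v \<bullet> fst b + e)"
proof -
  let ?C = "cylinder \<Omega> T"
  obtain x0 t0 where p0_eq: "p0 = (x0, t0)" by fastforce
  have x0: "x0 \<in> \<Omega>" and t0: "0 < t0" "t0 \<le> T" using p0 by (auto simp: p0_eq cylinder_def)
  define Q where "Q = (\<lambda>q::(real^'n) \<times> real. norm (fst q - x0) ^ 4 + (snd q - t0)\<^sup>2)"
  define \<psi> where "\<psi> = (\<lambda>q. \<phi> q - 1 * norm (fst q - x0) ^ 4 - 1 * (snd q - t0)\<^sup>2)"
  have \<psi>Q: "\<psi> q = \<phi> q - Q q" for q by (simp add: \<psi>_def Q_def)
  have "parabolic_expansion T \<psi> p0 v M s"
    unfolding \<psi>_def p0_eq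
    by (intro parabolic_expansion_diff_flat parabolic_expansion_quartic parabolic_expansion_time_square
        exp[unfolded p0_eq]) simp_all
  moreover have e4: "0 < e / 4" using e by simp
  ultimately obtain \<delta> where \<delta>: "0 < \<delta>" and taylor: "\<forall>x t h \<tau> \<rho>. parabolic_step T p0 \<delta> x t h \<tau> \<rho> \<longrightarrow>
        \<bar>\<psi> (x + h, t - \<tau>) - \<psi> (x, t) - v \<bullet> h\<bar> \<le> e / 4 * \<rho> \<and>
        \<bar>\<psi> (x + h, t - \<tau>) + \<psi> (x - h, t - \<tau>) - 2 * \<psi> (x, t) + 2 * s * \<tau> - (M *v h) \<bullet> h\<bar> \<le> e / 4 * \<rho>\<^sup>2"
    unfolding parabolic_expansion_def by blast
  obtain r\<Omega> where r\<Omega>: "0 < r\<Omega>" "ball x0 r\<Omega> \<subseteq> \<Omega>" using op x0 open_contains_ball by blast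
  define R where "R = Min {r, \<delta>, e, r\<Omega>, t0}"
  have R_le: "R \<le> a" if "a \<in> {r, \<delta>, e, r\<Omega>, t0}" for a
    unfolding R_def by (rule Min_le[OF _ that]) simp
  have "R \<in> {r, \<delta>, e, r\<Omega>, t0}" unfolding R_def by (rule Min_in) simp_all
  then have R0: "0 < R" using r \<delta> e r\<Omega>(1) t0(1) by blast
  have R: "R \<le> r" "R \<le> \<delta>" "R \<le> e" "R \<le> r\<Omega>" "R \<le> t0" by (rule R_le, blast)+
  define N where "N = {q \<in> ?C. norm (fst q - x0) < R \<and> \<bar>snd q - t0\<bar> < R}"
  have NI: "(x, t) \<in> N" if "norm (x - x0) < R" "\<bar>t - t0\<bar> < R" "t \<le> T" for x t
  proof -
    have "dist x x0 < r\<Omega>" using that(1) R(4) by (simp add: dist_norm)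
    then have "x \<in> \<Omega>" using r\<Omega>(2) by (auto simp: dist_commute)
    moreover have "0 < t" using that(2) R(5) by argo
    ultimately show ?thesis using that by (simp add: N_def cylinder_def)
  qed
  \<comment> \<open>Outside the inner cylinder of size \<open>R / 2\<close> the perturbation is at least \<open>gap\<close>.\<close>
  define gap where "gap = min ((R / 2) ^ 4) ((R / 2)\<^sup>2)"
  have gap: "0 < gap" using R0 by (simp add: gap_def)
  define b where "b = Min {R / 2, \<eta>, gap / 4, e / 5, 1}"
  have b_le: "b \<le> a" if "a \<in> {R / 2, \<eta>, gap / 4, e / 5, 1}" for a
    unfolding b_def by (rule Min_le[OF _ that]) simp
  have "b \<in> {R / 2, \<eta>, gap / 4, e / 5, 1}" unfolding b_def by (rule Min_in) simp_all
  moreover have "0 < R / 2" "0 < gap / 4" "0 < e / 5" using R0 gap e by simp_all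
  ultimately have b0: "0 < b" using eta zero_less_one by blast
  have "\<forall>\<^sub>F \<epsilon> in at_right 0. \<epsilon> \<in> {0<..<b} \<and> (\<forall>q\<in>closure ?C. dist (U \<epsilon> q) (u q) < gap / 4)"
    by (intro eventually_conj eventually_at_right_real b0 uniform_limitD[OF unif] \<open>0 < gap / 4\<close>)
  from eventually_happens[OF this] obtain \<epsilon> where
    \<epsilon>: "0 < \<epsilon>" "\<epsilon> < b" and close: "\<And>q. q \<in> closure ?C \<Longrightarrow> dist (U \<epsilon> q) (u q) < gap / 4"
    by auto
  have \<epsilon>_le: "\<epsilon> < R / 2" "\<epsilon> \<le> \<eta>" "\<epsilon> < gap / 4" "\<epsilon> < e / 5" "\<epsilon> < 1"
    using b_le[of "R / 2"] b_le[of \<eta>] b_le[of "gap / 4"] b_le[of "e / 5"] b_le[of 1] \<epsilon>(2) by simp_all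
  have \<epsilon>2: "\<epsilon>\<^sup>2 \<le> \<epsilon>" and \<epsilon>3: "\<epsilon> ^ 3 \<le> \<epsilon>" "0 < \<epsilon> ^ 3"
    using \<epsilon> \<epsilon>_le(5) power_decreasing[of 1 2 \<epsilon>] power_decreasing[of 1 3 \<epsilon>] by simp_all
  define w where "w = (\<lambda>q. U \<epsilon> q - \<psi> q)"
  have near: "\<bar>U \<epsilon> q - u q\<bar> < gap / 4" if "q \<in> ?C" for q
    using close[of q] that closure_subset[of ?C] by (auto simp: dist_real_def)
  have w_low: "u p0 - \<phi> p0 - gap / 4 + Q q \<le> w q" if "q \<in> N" for q
  proof -
    have "q \<in> ?C" "norm (fst q - fst p0) < r" "\<bar>snd q - snd p0\<bar> < r"
      using that R(1) by (auto simp: N_def p0_eq)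
    from min[OF this] near[OF this(1)] show ?thesis unfolding w_def \<psi>Q by argo
  qed
  have Q0: "Q p0 = 0" by (simp add: Q_def p0_eq)
  have p0N: "p0 \<in> N" using NI[of x0 t0] R0 t0 by (simp add: p0_eq)
  have w0: "w p0 \<le> u p0 - \<phi> p0 + gap / 4"
    using near[OF p0] Q0 unfolding w_def \<psi>Q by argo
  have Q_nonneg: "0 \<le> Q q" for q by (simp add: Q_def)
  obtain p where p: "p \<in> N" "\<And>q. q \<in> N \<Longrightarrow> w p \<le> w q + \<epsilon> ^ 3"
  proof (rule approximate_minimizer[of N "u p0 - \<phi> p0 - gap / 4" w "\<epsilon> ^ 3"])
    show "N \<noteq> {}" using p0N by blast
    show "u p0 - \<phi> p0 - gap / 4 \<le> w q" if "q \<in> N" for q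
      using w_low[OF that] Q_nonneg[of q] by argo
  qed (use \<epsilon>3 in auto)
  have Qp: "Q p < gap"
    using w_low[OF p(1)] p(2)[OF p0N] w0 \<epsilon>3(1) \<epsilon>_le(3) gap by argo
  define x where "x = fst p"
  define t where "t = snd p"
  have p_eq: "p = (x, t)" by (simp add: x_def t_def)
  have pC: "p \<in> ?C" using p(1) by (simp add: N_def)
  then have tT: "t \<le> T" by (simp add: p_eq cylinder_def)
  have x_near: "norm (x - x0) < R / 2"
  proof (rule power_less_imp_less_base)
    have "norm (x - x0) ^ 4 \<le> Q p" by (simp add: Q_def x_def)
    also have "\<dots> < (R / 2) ^ 4" using Qp by (simp add: gap_def)
    finally show "norm (x - x0) ^ 4 < (R / 2) ^ 4" .
  qed (use R0 in simp)
  have t_near: "\<bar>t - t0\<bar> < R / 2"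
  proof (rule power_less_imp_less_base)
    have "\<bar>t - t0\<bar>\<^sup>2 \<le> Q p" by (simp add: Q_def t_def)
    also have "\<dots> < (R / 2)\<^sup>2" using Qp by (simp add: gap_def)
    finally show "\<bar>t - t0\<bar>\<^sup>2 < (R / 2)\<^sup>2" .
  qed (use R0 in simp)
  define mv where "mv = (\<lambda>a::(real^'n) \<times> real. (x + \<epsilon> *\<^sub>R fst a, t - \<epsilon>\<^sup>2 * delay c (snd a)))"
  have moves_eq: "moves c \<A> \<epsilon> p = mv ` \<A> p"
    by (simp add: moves_delay mv_def p_eq)
  have tau: "0 \<le> \<epsilon>\<^sup>2 * delay c (snd a)" "\<epsilon>\<^sup>2 * delay c (snd a) \<le> \<epsilon>\<^sup>2" and hn: "norm (\<epsilon> *\<^sub>R fst a) \<le> \<epsilon>"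
    if "a \<in> \<A> p" for a
    using delay_A[OF pC that] A1D(2)[OF pC that] c \<epsilon>(1) by (simp_all add: mult_left_le)
  have mvN: "mv a \<in> N" if "a \<in> \<A> p" for a
    unfolding mv_def
  proof (rule NI)
    have "norm (x + \<epsilon> *\<^sub>R fst a - x0) \<le> norm (x - x0) + norm (\<epsilon> *\<^sub>R fst a)"
      using norm_triangle_ineq[of "x - x0" "\<epsilon> *\<^sub>R fst a"] by (simp add: algebra_simps)
    then show "norm (x + \<epsilon> *\<^sub>R fst a - x0) < R" using x_near hn[OF that] \<epsilon>_le(1) by argo
    show "\<bar>t - \<epsilon>\<^sup>2 * delay c (snd a) - t0\<bar> < R"
      using t_near tau[OF that] \<epsilon>2 \<epsilon>_le(1) by argo
    show "t - \<epsilon>\<^sup>2 * delay c (snd a) \<le> T" using tau[OF that] tT by argo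
  qed
  have sub: "moves c \<A> \<epsilon> p \<subseteq> ?C" using mvN by (auto simp: moves_eq N_def)
  have step: "parabolic_step T p0 \<delta> x t (\<epsilon> *\<^sub>R fst a) (\<epsilon>\<^sup>2 * delay c (snd a)) \<epsilon>" if "a \<in> \<A> p" for a
    using x_near t_near R0 R(2) tT \<epsilon>(1) \<epsilon>_le(1) tau[OF that] hn[OF that]
    by (simp add: parabolic_step_def p0_eq)
  have E1: "\<bar>\<psi> (mv a) - \<psi> p - v \<bullet> (\<epsilon> *\<^sub>R fst a)\<bar> \<le> e / 4 * \<epsilon>" if "a \<in> \<A> p" for a
    using taylor[rule_format, OF step[OF that]] by (simp add: mv_def p_eq)
  have "\<psi> p - norm v * \<epsilon> - e / 4 * \<epsilon> \<le> \<psi> (mv a)" if "a \<in> \<A> p" for a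
  proof -
    have "\<bar>v \<bullet> (\<epsilon> *\<^sub>R fst a)\<bar> \<le> norm v * norm (\<epsilon> *\<^sub>R fst a)" by (rule Cauchy_Schwarz_ineq2)
    also have "\<dots> \<le> norm v * \<epsilon>" using hn[OF that] by (rule mult_left_mono) simp
    finally show ?thesis using E1[OF that] by argo
  qed
  moreover have "\<A> p \<noteq> {}" using A1D(4)[OF pC] by blast
  ultimately obtain a where a: "a \<in> \<A> p" "\<And>b. b \<in> \<A> p \<Longrightarrow> \<psi> (mv a) \<le> \<psi> (mv b) + \<epsilon> ^ 3"
    using approximate_minimizer[of "\<A> p" "\<psi> p - norm v * \<epsilon> - e / 4 * \<epsilon>" "\<lambda>a. \<psi> (mv a)" "\<epsilon> ^ 3"] \<epsilon>3(2)
    by blast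
  \<comment> \<open>The first move is the mirror image of the near-minimizing move \<open>a\<close>; the answer \<open>b\<close> makes
     \<open>\<psi>\<close> at most \<open>\<epsilon>\<^sup>3\<close> smaller than \<open>a\<close> does, so \<open>a\<close> may replace it.\<close>
  let ?a = "(- fst a, snd a)"
  have a': "?a \<in> \<A> p" by (rule A2D[OF pC a(1)])
  obtain b where b: "b \<in> \<A> p" "(U \<epsilon> (mv ?a) + U \<epsilon> (mv b)) / 2 \<le> U \<epsilon> p + \<epsilon> ^ 3"
    using programming[OF \<epsilon>(1) \<epsilon>_le(2) pC sub _ \<epsilon>3(2), of "mv ?a"] a' by (auto simp: moves_eq)
  have "w p \<le> w (mv ?a) + \<epsilon> ^ 3" "w p \<le> w (mv b) + \<epsilon> ^ 3"
    using p(2) mvN a' b(1) by blast+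
  then have up: "(\<psi> (mv ?a) + \<psi> (mv a)) / 2 \<le> \<psi> p + 3 * \<epsilon> ^ 3"
    using b(2) a(2)[OF b(1)] \<epsilon>3(2) unfolding w_def by argo
  have mva: "mv ?a = (x - \<epsilon> *\<^sub>R fst a, t - \<epsilon>\<^sup>2 * delay c (snd a))" by (simp add: mv_def)
  have E2: "\<bar>\<psi> (mv a) + \<psi> (mv ?a) - 2 * \<psi> p + 2 * s * (\<epsilon>\<^sup>2 * delay c (snd a)) -
      (M *v (\<epsilon> *\<^sub>R fst a)) \<bullet> (\<epsilon> *\<^sub>R fst a)\<bar> \<le> e / 4 * \<epsilon>\<^sup>2"
    using taylor[rule_format, OF step[OF a(1)]] unfolding mva by (simp add: mv_def p_eq)
  define q where "q = (M *v fst a) \<bullet> fst a"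
  define D where "D = delay c (snd a)"
  have quad: "(M *v (\<epsilon> *\<^sub>R fst a)) \<bullet> (\<epsilon> *\<^sub>R fst a) = \<epsilon>\<^sup>2 * q"
    by (simp add: matrix_vector_mult_scaleR q_def power2_eq_square)
  have "0 \<le> 6 * \<epsilon> ^ 3 + 2 * s * (\<epsilon>\<^sup>2 * D) - \<epsilon>\<^sup>2 * q + e / 4 * \<epsilon>\<^sup>2"
    using up E2 unfolding quad D_def[symmetric] by argo
  also have "\<dots> = \<epsilon>\<^sup>2 * (6 * \<epsilon> + 2 * s * D - q + e / 4)"
    by (simp add: power2_eq_square power3_eq_cube algebra_simps)
  finally have "0 \<le> 6 * \<epsilon> + 2 * s * D - q + e / 4"
    using \<epsilon>(1) by (simp add: zero_le_mult_iff)
  moreover have "2 * s * D = 2 * (D * s)" by simp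
  ultimately have second: "- e \<le> D * s - q / 2" using \<epsilon>_le(4) e by argo
  have first: "v \<bullet> fst a \<le> v \<bullet> fst b + e" if "b \<in> \<A> p" for b
  proof -
    have "v \<bullet> (\<epsilon> *\<^sub>R fst a) \<le> v \<bullet> (\<epsilon> *\<^sub>R fst b) + 2 * (e / 4 * \<epsilon>) + \<epsilon> ^ 3"
      using E1[OF a(1)] E1[OF that] a(2)[OF that] by argo
    then have "\<epsilon> * (v \<bullet> fst a) \<le> \<epsilon> * (v \<bullet> fst b + e / 2 + \<epsilon>\<^sup>2)"
      by (simp add: power2_eq_square power3_eq_cube algebra_simps)
    then have "v \<bullet> fst a \<le> v \<bullet> fst b + e / 2 + \<epsilon>\<^sup>2" using \<epsilon>(1) by simp
    then show ?thesis using \<epsilon>2 \<epsilon>_le(4) e by argo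
  qed
  have "norm (fst p - fst p0) < e" "\<bar>snd p - snd p0\<bar> < e"
    using x_near t_near R0 R(3) unfolding p_eq p0_eq fst_conv snd_conv by argo+
  with pC a(1) second first show ?thesis
    unfolding q_def D_def by blast
qed

text \<open>Compactness of the product containing all the sets gives a limit of the approximate pairs. By (A3)
  the limit belongs to the set at \<open>p0\<close>, and every competitor at \<open>p0\<close> is a limit of competitors.\<close>

lemma contact:
  assumes p0: "p0 \<in> cylinder \<Omega> T" and r: "0 < r"
    and min: "\<And>q. q \<in> cylinder \<Omega> T \<Longrightarrow> norm (fst q - fst p0) < r \<Longrightarrow> \<bar>snd q - snd p0\<bar> < r \<Longrightarrow>
        u p0 - \<phi> p0 \<le> u q - \<phi> q"
    and exp: "parabolic_expansion T \<phi> p0 v M s"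
  obtains a where "a \<in> \<A> p0" "0 \<le> delay c (snd a) * s - ((M *v fst a) \<bullet> fst a) / 2"
    "\<And>b. b \<in> \<A> p0 \<Longrightarrow> v \<bullet> fst a \<le> v \<bullet> fst b"
proof -
  let ?e = "\<lambda>n::nat. 1 / real (Suc n)"
  have "\<forall>n. \<exists>pa. fst pa \<in> cylinder \<Omega> T \<and> norm (fst (fst pa) - fst p0) < ?e n \<and>
      \<bar>snd (fst pa) - snd p0\<bar> < ?e n \<and> snd pa \<in> \<A> (fst pa) \<and>
      - ?e n \<le> delay c (snd (snd pa)) * s - ((M *v fst (snd pa)) \<bullet> fst (snd pa)) / 2 \<and>
      (\<forall>b\<in>\<A> (fst pa). v \<bullet> fst (snd pa) \<le> v \<bullet> fst b + ?e n)"
    using approximate_contact[OF p0 r min exp, of "?e _"] by (simp add: split_paired_Ex)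
  then obtain PA where PA: "\<And>n. fst (PA n) \<in> cylinder \<Omega> T" "\<And>n. norm (fst (fst (PA n)) - fst p0) < ?e n"
      "\<And>n. \<bar>snd (fst (PA n)) - snd p0\<bar> < ?e n" "\<And>n. snd (PA n) \<in> \<A> (fst (PA n))"
      "\<And>n. - ?e n \<le> delay c (snd (snd (PA n))) * s - ((M *v fst (snd (PA n))) \<bullet> fst (snd (PA n))) / 2"
      "\<And>n b. b \<in> \<A> (fst (PA n)) \<Longrightarrow> v \<bullet> fst (snd (PA n)) \<le> v \<bullet> fst b + ?e n"
    by metis
  define P where "P = (\<lambda>n. fst (PA n))"
  define Y where "Y = (\<lambda>n. snd (PA n))"
  have e0: "?e \<longlonglongrightarrow> 0" by (rule lim_1_over_n[THEN LIMSEQ_Suc])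
  have P1: "(\<lambda>n. fst (P n)) \<longlonglongrightarrow> fst p0"
    by (rule LIM_zero_cancel, rule Lim_null_comparison[OF _ e0])
      (use PA(2) in \<open>auto simp: P_def intro!: always_eventually less_imp_le\<close>)
  have P2: "(\<lambda>n. snd (P n)) \<longlonglongrightarrow> snd p0"
    by (rule LIM_zero_cancel, rule Lim_null_comparison[OF _ e0])
      (use PA(3) in \<open>auto simp: P_def intro!: always_eventually less_imp_le\<close>)
  have P_lim: "P \<longlonglongrightarrow> p0" using tendsto_Pair[OF P1 P2] by simp
  let ?K = "cball 0 1 \<times> {- c/2..c/2} :: ((real^'n) \<times> real) set"
  have YK: "Y n \<in> ?K" for n
    using A1D(2,3)[OF PA(1) PA(4)] by (simp add: Y_def mem_Times_iff)
  have "seq_compact ?K" by (intro compact_imp_seq_compact compact_Times) simp_all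
  then obtain a k where k: "strict_mono k" and lim: "(Y \<circ> k) \<longlonglongrightarrow> a"
    using YK unfolding seq_compact_def by blast
  have Pk: "(P \<circ> k) \<longlonglongrightarrow> p0" by (rule LIMSEQ_subseq_LIMSEQ[OF P_lim k])
  have ek: "(?e \<circ> k) \<longlonglongrightarrow> 0" by (rule LIMSEQ_subseq_LIMSEQ[OF e0 k])
  have inC: "\<forall>n. (P \<circ> k) n \<in> cylinder \<Omega> T" using PA(1) by (simp add: P_def)
  have limits: "\<forall>q\<in>\<A> p0. \<exists>Z. (\<forall>n. Z n \<in> \<A> ((P \<circ> k) n)) \<and> Z \<longlonglongrightarrow> q"
    "\<forall>Z q. (\<forall>n. Z n \<in> \<A> ((P \<circ> k) n)) \<longrightarrow> Z \<longlonglongrightarrow> q \<longrightarrow> q \<in> \<A> p0"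
    using A3 p0 inC Pk unfolding property_A3_def by blast+
  have aA: "a \<in> \<A> p0"
    by (rule limits(2)[rule_format, OF _ lim]) (simp add: Y_def P_def PA(4))
  show thesis
  proof (rule that[OF aA])
    have "(\<lambda>n. M *v fst ((Y \<circ> k) n)) \<longlonglongrightarrow> M *v fst a"
      by (intro bounded_linear.tendsto[OF matrix_vector_mul_bounded_linear] tendsto_fst lim)
    then have l1: "(\<lambda>n. delay c (snd ((Y \<circ> k) n)) * s - ((M *v fst ((Y \<circ> k) n)) \<bullet> fst ((Y \<circ> k) n)) / 2)
        \<longlonglongrightarrow> delay c (snd a) * s - ((M *v fst a) \<bullet> fst a) / 2"
      unfolding delay_def by (intro tendsto_intros lim) simp_all
    have l2: "(\<lambda>n. - (?e \<circ> k) n) \<longlonglongrightarrow> - 0" by (rule tendsto_minus[OF ek])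
    have "- 0 \<le> delay c (snd a) * s - ((M *v fst a) \<bullet> fst a) / 2"
      by (rule LIMSEQ_le[OF l2 l1]) (use PA(5) in \<open>auto simp: Y_def\<close>)
    then show "0 \<le> delay c (snd a) * s - ((M *v fst a) \<bullet> fst a) / 2" by simp
    fix b assume "b \<in> \<A> p0"
    then obtain Z where Z: "\<And>n. Z n \<in> \<A> ((P \<circ> k) n)" "Z \<longlonglongrightarrow> b" using limits(1) by blast
    have "(\<lambda>n. v \<bullet> fst ((Y \<circ> k) n)) \<longlonglongrightarrow> v \<bullet> fst a"
      by (intro tendsto_intros lim)
    moreover have "(\<lambda>n. v \<bullet> fst (Z n) + (?e \<circ> k) n) \<longlonglongrightarrow> v \<bullet> fst b + 0"
      by (intro tendsto_intros ek Z)
    ultimately have "v \<bullet> fst a \<le> v \<bullet> fst b + 0"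
      by (rule LIMSEQ_le) (use PA(6) Z(1) in \<open>auto simp: Y_def P_def\<close>)
    then show "v \<bullet> fst a \<le> v \<bullet> fst b" by simp
  qed
qed

lemma minimizer_eq:
  assumes "p \<in> cylinder \<Omega> T" "v \<noteq> 0" "is_minimizer (\<A> p) v a"
  shows "minimizer (\<A> p) v = a"
proof -
  have "\<exists>!q. is_minimizer (\<A> p) v q"
    using A4 assms(1,2) unfolding property_A4_def by blast
  from the1_equality[OF this assms(3)] show ?thesis by (simp add: minimizer_def)
qed

lemma contact_G_op:
  assumes p0: "p0 \<in> cylinder \<Omega> T" and r: "0 < r"
    and min: "\<And>q. q \<in> cylinder \<Omega> T \<Longrightarrow> norm (fst q - fst p0) < r \<Longrightarrow> \<bar>snd q - snd p0\<bar> < r \<Longrightarrow>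
        u p0 - \<phi> p0 \<le> u q - \<phi> q"
    and exp: "parabolic_expansion T \<phi> p0 v M s" and v: "v \<noteq> 0"
  shows "0 \<le> G_op c \<A> M v s p0"
proof -
  obtain a where a: "a \<in> \<A> p0" "0 \<le> delay c (snd a) * s - ((M *v fst a) \<bullet> fst a) / 2"
    "\<And>b. b \<in> \<A> p0 \<Longrightarrow> v \<bullet> fst a \<le> v \<bullet> fst b"
    using contact[OF p0 r min exp] by blast
  have "minimizer (\<A> p0) v = a"
    by (rule minimizer_eq[OF p0 v]) (use a in \<open>auto simp: is_minimizer_def\<close>)
  then show ?thesis
    using a(2) v by (simp add: G_op_def min_time_def min_dir_def delay_def)
qed

text \<open>Without gradient and Hessian only the time derivative is left, multiplied by a positive delay.\<close>

lemma contact_flat: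
  assumes p0: "p0 \<in> cylinder \<Omega> T" and r: "0 < r"
    and min: "\<And>q. q \<in> cylinder \<Omega> T \<Longrightarrow> norm (fst q - fst p0) < r \<Longrightarrow> \<bar>snd q - snd p0\<bar> < r \<Longrightarrow>
        u p0 - \<phi> p0 \<le> u q - \<phi> q"
    and exp: "parabolic_expansion T \<phi> p0 0 0 s"
  shows "0 \<le> s"
proof -
  obtain a where a: "a \<in> \<A> p0" "0 \<le> delay c (snd a) * s - ((0 *v fst a) \<bullet> fst a) / 2"
    using contact[OF p0 r min exp] by blast
  have "0 < delay c (snd a)" using delay_A(1)[OF p0 a(1)] c by linarith
  then show ?thesis using a(2) by (simp add: zero_le_mult_iff)
qed

section \<open>Doubling the space variable at a critical point\<close>

text \<open>Along minimum points for \<open>k \<rightarrow> \<infinity>\<close> the penalty forces \<open>x - y \<rightarrow> 0\<close>, while the value of \<open>u - \<phi>\<close>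
  never exceeds the minimum, taken at \<open>(x0, t0)\<close>; strictness leaves \<open>(x0, t0)\<close> as the only possible limit.\<close>

lemma doubling:
  assumes \<phi>: "continuous_on (closure (cylinder \<Omega> T)) \<phi>"
    and p0: "(x0, t0) \<in> cylinder \<Omega> T"
    and strict: "strict_min_on (\<lambda>q. u q - \<phi> q) (closure (cylinder \<Omega> T)) (x0, t0)"
    and \<delta>: "0 < \<delta>"
  obtains k x y t r where "0 < k" "norm (x - x0) < \<delta>" "norm (y - x0) < \<delta>" "\<bar>t - t0\<bar> < \<delta>"
    "(x, t) \<in> cylinder \<Omega> T" "(y, t) \<in> cylinder \<Omega> T" "0 < r"
    "\<And>x' y' t'. norm (x' - x) < r \<Longrightarrow> norm (y' - y) < r \<Longrightarrow> \<bar>t' - t\<bar> < r \<Longrightarrow> t' \<le> T \<Longrightarrow>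
       u (x, t) - \<phi> (y, t) + k * norm (x - y) ^ 4 \<le> u (x', t') - \<phi> (y', t') + k * norm (x' - y') ^ 4"
proof -
  let ?C = "cylinder \<Omega> T"
  have x0: "x0 \<in> \<Omega>" and t0: "0 < t0" "t0 \<le> T" using p0 by (auto simp: cylinder_def)
  obtain R1 where R1: "0 < R1" "cball x0 R1 \<subseteq> \<Omega>" using op x0 open_contains_cball by blast
  define R where "R = min R1 (t0 / 2)"
  have R: "0 < R" "R \<le> R1" "R < t0" using R1 t0 by (auto simp: R_def)
  define I where "I = {t0 - R..min (t0 + R) T}"
  define W where "W = cball x0 R \<times> cball x0 R \<times> I"
  have W_C: "(x, t) \<in> ?C" if "x \<in> cball x0 R" "t \<in> I" for x t
  proof -
    have "x \<in> \<Omega>" using that(1) R(2) R1(2) by auto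
    then show ?thesis using that(2) R(3) by (auto simp: cylinder_def I_def)
  qed
  have W_closure: "(x, t) \<in> closure ?C" if "x \<in> cball x0 R" "t \<in> I" for x t
    using W_C[OF that] closure_subset by blast
  have "compact W" unfolding W_def I_def by (intro compact_Times) simp_all
  have base: "(x0, x0, t0) \<in> W" using R(1) t0 by (simp add: W_def I_def)
  have cont_u': "continuous_on W (\<lambda>z. u (fst z, snd (snd z)))"
    by (rule continuous_on_compose2[OF cont_u]) (auto intro!: continuous_intros W_closure simp: W_def)
  have cont_\<phi>': "continuous_on W (\<lambda>z. \<phi> (fst (snd z), snd (snd z)))"
    by (rule continuous_on_compose2[OF \<phi>]) (auto intro!: continuous_intros W_closure simp: W_def)
  define d where "d = (\<lambda>z::(real^'n) \<times> (real^'n) \<times> real. u (fst z, snd (snd z)) - \<phi> (fst (snd z), snd (snd z)))"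
  define g where "g = (\<lambda>z::(real^'n) \<times> (real^'n) \<times> real. norm (fst z - fst (snd z)) ^ 4)"
  have cont_d: "continuous_on W d" unfolding d_def by (intro continuous_intros cont_u' cont_\<phi>')
  have cont_g: "continuous_on W g" unfolding g_def by (intro continuous_intros)
  have "\<exists>z\<in>W. \<forall>z'\<in>W. d z + real (Suc n) * g z \<le> d z' + real (Suc n) * g z'" for n
  proof (rule continuous_attains_inf[OF \<open>compact W\<close>])
    show "W \<noteq> {}" using base by blast
    show "continuous_on W (\<lambda>z. d z + real (Suc n) * g z)"
      by (intro continuous_intros cont_d cont_g)
  qed
  then obtain Z where Z: "\<And>n. Z n \<in> W"
    and Zmin: "\<And>n z'. z' \<in> W \<Longrightarrow> d (Z n) + real (Suc n) * g (Z n) \<le> d z' + real (Suc n) * g z'"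
    by metis
  obtain l k where l: "l \<in> W" "strict_mono k" "(Z \<circ> k) \<longlonglongrightarrow> l"
    using compact_imp_seq_compact[OF \<open>compact W\<close>] Z unfolding seq_compact_def by blast
  have g0: "g (x0, x0, t0) = 0" by (simp add: g_def)
  have g_nonneg: "0 \<le> g z" for z by (simp add: g_def)
  define m where "m = d (x0, x0, t0)"
  have bound: "d (Z n) + real (Suc n) * g (Z n) \<le> m" for n
    using Zmin[OF base, of n] g0 by (simp add: m_def)
  have d_le: "d (Z n) \<le> m" for n
    using bound[of n] mult_nonneg_nonneg[OF of_nat_0_le_iff g_nonneg, of "Suc n" "Z n"] by linarith
  obtain z1 where z1: "z1 \<in> W" "\<And>z. z \<in> W \<Longrightarrow> d z1 \<le> d z"
    using continuous_attains_inf[OF \<open>compact W\<close> _ cont_d] base by blast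
  have g_le: "g (Z n) \<le> (m - d z1) * (1 / real (Suc n))" for n
  proof -
    have "real (Suc n) * g (Z n) \<le> m - d z1" using bound[of n] z1(2)[OF Z[of n]] by linarith
    then show ?thesis by (simp add: field_simps)
  qed
  have inW: "\<forall>n. (Z \<circ> k) n \<in> W" using Z by simp
  have lim_g: "(\<lambda>n. g ((Z \<circ> k) n)) \<longlonglongrightarrow> g l" and lim_d: "(\<lambda>n. d ((Z \<circ> k) n)) \<longlonglongrightarrow> d l"
    using cont_g cont_d l inW unfolding continuous_on_sequentially by (auto simp: comp_def)
  have "(\<lambda>n. (m - d z1) * (1 / real (Suc n))) \<longlonglongrightarrow> (m - d z1) * 0"
    by (intro tendsto_intros lim_1_over_n[THEN LIMSEQ_Suc])
  from LIMSEQ_subseq_LIMSEQ[OF this l(2)]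
  have "(\<lambda>n. (m - d z1) * (1 / real (Suc (k n)))) \<longlonglongrightarrow> 0" by (simp add: comp_def)
  from LIMSEQ_le[OF lim_g this] have "g l \<le> 0"
    using g_le by (simp only: comp_def) blast
  then have xy: "fst l = fst (snd l)" by (simp add: g_def)
  have "d l \<le> m" by (rule LIMSEQ_le_const2[OF lim_d]) (use d_le in auto)
  obtain xl tl where l_eq: "l = (xl, xl, tl)" using xy by (metis prod.collapse)
  have "(xl, tl) = (x0, t0)"
  proof (rule ccontr)
    assume "(xl, tl) \<noteq> (x0, t0)"
    moreover have "(xl, tl) \<in> closure ?C" using l(1) by (auto simp: l_eq W_def intro: W_closure)
    ultimately have "m < d l"
      using strict unfolding strict_min_on_def by (simp add: m_def d_def l_eq)
    with \<open>d l \<le> m\<close> show False by simp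
  qed
  then have "(Z \<circ> k) \<longlonglongrightarrow> (x0, x0, t0)" using l(3) by (simp add: l_eq)
  moreover define \<rho> where "\<rho> = min \<delta> (R / 2)"
  have \<rho>: "0 < \<rho>" "\<rho> \<le> \<delta>" "\<rho> \<le> R / 2" using \<delta> R by (auto simp: \<rho>_def)
  ultimately have "\<forall>\<^sub>F n in sequentially. dist ((Z \<circ> k) n) (x0, x0, t0) < \<rho>"
    using \<rho>(1) by (auto dest: tendstoD)
  then obtain n where n: "dist (Z (k n)) (x0, x0, t0) < \<rho>"
    by (auto simp: eventually_sequentially)
  obtain x y t where z: "Z (k n) = (x, y, t)" by (metis prod.collapse)
  have "dist x x0 \<le> dist (x, y, t) (x0, x0, t0)" "dist (y, t) (x0, t0) \<le> dist (x, y, t) (x0, x0, t0)"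
    using dist_fst_le[of "(x, y, t)" "(x0, x0, t0)"] dist_snd_le[of "(x, y, t)" "(x0, x0, t0)"] by simp_all
  moreover have "dist y x0 \<le> dist (y, t) (x0, t0)" "dist t t0 \<le> dist (y, t) (x0, t0)"
    using dist_fst_le[of "(y, t)" "(x0, t0)"] dist_snd_le[of "(y, t)" "(x0, t0)"] by simp_all
  ultimately have near: "norm (x - x0) < \<rho>" "norm (y - x0) < \<rho>" "\<bar>t - t0\<bar> < \<rho>"
    using n unfolding z by (simp_all add: dist_norm)
  have zW: "x \<in> cball x0 R" "y \<in> cball x0 R" "t \<in> I" using Z[of "k n"] by (simp_all add: z W_def)
  show thesis
  proof (rule that[of "real (Suc (k n))" x y t "R / 2"])
    show "norm (x - x0) < \<delta>" "norm (y - x0) < \<delta>" "\<bar>t - t0\<bar> < \<delta>" using near \<rho>(2) by simp_all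
    show "(x, t) \<in> ?C" "(y, t) \<in> ?C" using zW by (simp_all add: W_C)
    show "0 < R / 2" using R by simp
    fix x' y' t' assume a: "norm (x' - x) < R / 2" "norm (y' - y) < R / 2" "\<bar>t' - t\<bar> < R / 2" "t' \<le> T"
    have "norm (x' - x0) \<le> norm (x' - x) + norm (x - x0)" "norm (y' - x0) \<le> norm (y' - y) + norm (y - x0)"
      using norm_triangle_ineq[of "x' - x" "x - x0"] norm_triangle_ineq[of "y' - y" "y - x0"] by simp_all
    then have "dist x' x0 \<le> R" "dist y' x0 \<le> R" "\<bar>t' - t0\<bar> \<le> R"
      using a near \<rho>(3) unfolding dist_norm by argo+
    then have "(x', y', t') \<in> W" using a(4) by (auto simp: W_def I_def dist_commute abs_le_iff)
    from Zmin[OF this, of "k n"]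
    show "u (x, t) - \<phi> (y, t) + real (Suc (k n)) * norm (x - y) ^ 4
        \<le> u (x', t') - \<phi> (y', t') + real (Suc (k n)) * norm (x' - y') ^ 4"
      by (simp add: z d_def g_def)
  qed simp
qed

text \<open>Moving \<open>y\<close> towards \<open>x\<close> decreases the penalty at a positive rate, which a vanishing gradient of \<open>\<phi>\<close>
  could not compensate.\<close>

lemma doubling_gradient:
  assumes G: "GDERIV (\<lambda>y. \<phi> (y, t)) y :> G" and r: "0 < r" and k: "0 < k" and xy: "x \<noteq> y"
    and min: "\<And>y'. norm (y' - y) < r \<Longrightarrow> - \<phi> (y, t) + k * norm (x - y) ^ 4 \<le> - \<phi> (y', t) + k * norm (x - y') ^ 4"
  shows "G \<noteq> (0 :: real^'n)"
proof
  assume G0: "G = 0"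
  let ?w = "x - y"
  let ?h = "\<lambda>s. - \<phi> (y + s *\<^sub>R ?w, t) + k * ((1 - s) ^ 4 * norm ?w ^ 4)"
  have "GDERIV (\<lambda>y. \<phi> (y, t)) (y + 0 *\<^sub>R ?w) :> G" using G by simp
  from GDERIV_along_line[OF this]
  have "((\<lambda>s. \<phi> (y + s *\<^sub>R ?w, t)) has_real_derivative 0) (at 0)" by (simp add: G0)
  then have "(?h has_real_derivative - 4 * k * norm ?w ^ 4) (at 0)"
    by (auto intro!: derivative_eq_intros)
  moreover have "0 < r / norm ?w" using r xy by simp
  moreover have "\<forall>s. \<bar>0 - s\<bar> < r / norm ?w \<longrightarrow> ?h 0 \<le> ?h s"
  proof (intro allI impI)
    fix s assume "\<bar>0 - s\<bar> < r / norm ?w"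
    then have "norm (y + s *\<^sub>R ?w - y) < r" using xy by (simp add: pos_less_divide_eq)
    from min[OF this]
    have "- \<phi> (y, t) + k * norm ?w ^ 4 \<le> - \<phi> (y + s *\<^sub>R ?w, t) + k * norm (x - (y + s *\<^sub>R ?w)) ^ 4" .
    moreover have "x - (y + s *\<^sub>R ?w) = (1 - s) *\<^sub>R ?w" by (simp add: algebra_simps)
    moreover have "norm ((1 - s) *\<^sub>R ?w) ^ 4 = (1 - s) ^ 4 * norm ?w ^ 4"
      by (simp add: power_mult_distrib)
    ultimately show "?h 0 \<le> ?h s" by simp
  qed
  ultimately have "- 4 * k * norm ?w ^ 4 = 0" by (rule DERIV_local_min)
  then show False using k xy by simp
qed

text \<open>The operator is abstract here so that the lemma also covers the reflected operator
  \<open>(M, v, s) \<mapsto> - G(- M, - v, - s)\<close>, which differs from \<open>G\<close> at the zero gradient.\<close>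

lemma nearby_supersolution:
  assumes C21: "has_C21_derivs \<Omega> T \<phi> g H d" and p: "p \<in> cylinder \<Omega> T"
    and strict: "strict_min_on (\<lambda>q. u q - \<phi> q) (closure (cylinder \<Omega> T)) p"
    and G_noncritical: "\<And>M v s q. q \<in> cylinder \<Omega> T \<Longrightarrow> v \<noteq> 0 \<Longrightarrow> G M v s q = G_op c \<A> M v s q"
    and G_critical: "\<And>M s q. q \<in> cylinder \<Omega> T \<Longrightarrow> 0 \<le> s \<Longrightarrow> 0 \<le> G M 0 s q"
    and \<delta>: "0 < \<delta>"
  shows "\<exists>M' v' s' p'. transpose M' = M' \<and> p' \<in> cylinder \<Omega> T \<and>
    norm (H p - M') + \<bar>d p - s'\<bar> + norm (g p - v') + norm (fst p - fst p') + \<bar>snd p - snd p'\<bar> < \<delta> \<and>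
    0 \<le> G M' v' s' p'"
proof -
  let ?C = "cylinder \<Omega> T"
  obtain x0 t0 where p_eq: "p = (x0, t0)" by fastforce
  have dg: "GDERIV (\<lambda>y. \<phi> (y, t)) x :> g (x, t)"
    and dH: "((\<lambda>y. g (y, t)) has_derivative (\<lambda>w. H (x, t) *v w)) (at x)"
    if "(x, t) \<in> ?C" for x t
    using C21 that by (auto simp: has_C21_derivs_def)
  have cont: "continuous_on (closure ?C) \<phi>" "continuous_on (closure ?C) g"
    "continuous_on (closure ?C) H" "continuous_on (closure ?C) d"
    using C21 by (auto simp: has_C21_derivs_def)
  have sym: "transpose (H (x, t)) = H (x, t)" if "(x, t) \<in> ?C" for x t
  proof (rule symmetric_Hessian[OF op])
    show "x \<in> \<Omega>" using that by (simp add: cylinder_def)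
    show "GDERIV (\<lambda>y. \<phi> (y, t)) y :> g (y, t)" if "y \<in> \<Omega>" for y
      using that \<open>(x, t) \<in> ?C\<close> by (intro dg) (simp add: cylinder_def)
  qed (rule dH[OF that])
  show ?thesis
  proof (cases "g p \<noteq> 0 \<or> 0 \<le> d p")
    case True
    have "0 \<le> G (H p) (g p) (d p) p"
    proof (cases "g p = 0")
      case True
      with \<open>g p \<noteq> 0 \<or> 0 \<le> d p\<close> show ?thesis using G_critical[OF p] by simp
    next
      case False
      have "u p - \<phi> p \<le> u q - \<phi> q" if "q \<in> ?C" for q
        using strict that closure_subset[of ?C] unfolding strict_min_on_def
        by (cases "q = p") (auto intro: less_imp_le)
      then have "0 \<le> G_op c \<A> (H p) (g p) (d p) p"
        by (intro contact_G_op[OF p zero_less_one _ C21_parabolic_expansion[OF C21 op p] False])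
      then show ?thesis using G_noncritical[OF p False] by simp
    qed
    then show ?thesis using sym p \<delta> by (intro exI[of _ "H p"] exI[of _ "g p"] exI[of _ "d p"] exI[of _ p]) (simp add: p_eq)
  next
    case False
    then have gp: "g p = 0" and dp: "d p < 0" by auto
    have \<delta>5: "0 < \<delta> / 5" using \<delta> by simp
    have dp': "0 < min (\<delta> / 5) (- d p)" using \<delta> dp by simp
    obtain \<delta>g where \<delta>g: "0 < \<delta>g" "\<And>x t. (x, t) \<in> ?C \<Longrightarrow> norm (x - fst p) < \<delta>g \<Longrightarrow> \<bar>t - snd p\<bar> < \<delta>g \<Longrightarrow> norm (g (x, t) - g p) < \<delta> / 5"
      using continuous_on_closure_near[OF cont(2) p \<delta>5] by metis
    obtain \<delta>H where \<delta>H: "0 < \<delta>H" "\<And>x t. (x, t) \<in> ?C \<Longrightarrow> norm (x - fst p) < \<delta>H \<Longrightarrow> \<bar>t - snd p\<bar> < \<delta>H \<Longrightarrow> norm (H (x, t) - H p) < \<delta> / 5"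
      using continuous_on_closure_near[OF cont(3) p \<delta>5] by metis
    obtain \<delta>d where \<delta>d: "0 < \<delta>d" "\<And>x t. (x, t) \<in> ?C \<Longrightarrow> norm (x - fst p) < \<delta>d \<Longrightarrow> \<bar>t - snd p\<bar> < \<delta>d \<Longrightarrow> norm (d (x, t) - d p) < min (\<delta> / 5) (- d p)"
      using continuous_on_closure_near[OF cont(4) p dp'] by metis
    define m where "m = min (\<delta> / 5) (min \<delta>g (min \<delta>H \<delta>d))"
    have m: "0 < m" "m \<le> \<delta> / 5" "m \<le> \<delta>g" "m \<le> \<delta>H" "m \<le> \<delta>d"
      using \<delta>5 \<delta>g(1) \<delta>H(1) \<delta>d(1) by (simp_all add: m_def min_le_iff_disj)
    obtain k x y t r where k: "0 < k" and near: "norm (x - x0) < m" "norm (y - x0) < m" "\<bar>t - t0\<bar> < m"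
      and xC: "(x, t) \<in> ?C" and yC: "(y, t) \<in> ?C" and r: "0 < r"
      and dbl: "\<And>x' y' t'. norm (x' - x) < r \<Longrightarrow> norm (y' - y) < r \<Longrightarrow> \<bar>t' - t\<bar> < r \<Longrightarrow> t' \<le> T \<Longrightarrow>
       u (x, t) - \<phi> (y, t) + k * norm (x - y) ^ 4 \<le> u (x', t') - \<phi> (y', t') + k * norm (x' - y') ^ 4"
      using doubling[OF cont(1) p[unfolded p_eq] strict[unfolded p_eq] m(1)] by metis
    have tT: "t \<le> T" using xC by (simp add: cylinder_def)
    have y_close: "norm (g (y, t) - g p) < \<delta> / 5" "norm (H (y, t) - H p) < \<delta> / 5"
      "\<bar>d (y, t) - d p\<bar> < \<delta> / 5" "d (y, t) < 0"
      using \<delta>g(2)[OF yC] \<delta>H(2)[OF yC] \<delta>d(2)[OF yC] near m by (auto simp: p_eq)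
    have "x \<noteq> y"
    proof
      assume xy: "x = y"
      have "0 \<le> d (x, t)"
      proof (rule contact_flat[OF xC r])
        show "parabolic_expansion T (\<lambda>q. \<phi> (x, snd q) - k * norm (fst q - x) ^ 4) (x, t) 0 0 (d (x, t))"
          using k by (intro parabolic_expansion_diff_flat parabolic_expansion_quartic
              parabolic_expansion_time_slice[OF C21 op xC]) simp
        fix q assume q: "q \<in> ?C" "norm (fst q - fst (x, t)) < r" "\<bar>snd q - snd (x, t)\<bar> < r"
        then have "u (x, t) - \<phi> (x, t) + k * norm (x - x) ^ 4
            \<le> u (fst q, snd q) - \<phi> (x, snd q) + k * norm (fst q - x) ^ 4"
          using dbl[of "fst q" x "snd q"] r unfolding xy by (simp add: cylinder_def mem_Times_iff)
        then show "u (x, t) - (\<phi> (x, snd (x, t)) - k * norm (fst (x, t) - x) ^ 4)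
            \<le> u q - (\<phi> (x, snd q) - k * norm (fst q - x) ^ 4)"
          by simp
      qed
      with y_close(4) show False by (simp add: xy)
    qed
    have g0: "g (y, t) \<noteq> 0"
    proof (rule doubling_gradient[OF dg[OF yC] r k \<open>x \<noteq> y\<close>])
      show "- \<phi> (y, t) + k * norm (x - y) ^ 4 \<le> - \<phi> (y', t) + k * norm (x - y') ^ 4" if "norm (y' - y) < r" for y'
        using dbl[of x y' t] that r tT by simp
    qed
    have "0 \<le> G_op c \<A> (H (y, t)) (g (y, t)) (d (y, t)) (x, t)"
    proof (rule contact_G_op[OF xC r _ _ g0])
      show "parabolic_expansion T (\<lambda>q. \<phi> (fst q + (y - x), snd q)) (x, t) (g (y, t)) (H (y, t)) (d (y, t))"
        by (rule parabolic_expansion_translate[OF C21_parabolic_expansion[OF C21 op yC]])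
      fix q assume q: "q \<in> ?C" "norm (fst q - fst (x, t)) < r" "\<bar>snd q - snd (x, t)\<bar> < r"
      have "norm (fst q + (y - x) - y) = norm (fst q - x)" "norm (fst q - (fst q + (y - x))) = norm (x - y)"
        by (simp_all add: algebra_simps norm_minus_commute)
      then show "u (x, t) - \<phi> (fst (x, t) + (y - x), snd (x, t)) \<le> u q - \<phi> (fst q + (y - x), snd q)"
        using dbl[of "fst q" "fst q + (y - x)" "snd q"] q by (simp add: cylinder_def mem_Times_iff)
    qed
    then have "0 \<le> G (H (y, t)) (g (y, t)) (d (y, t)) (x, t)"
      using G_noncritical[OF xC g0] by simp
    moreover have "norm (H p - H (y, t)) + \<bar>d p - d (y, t)\<bar> + norm (g p - g (y, t)) +
        norm (fst p - fst (x, t)) + \<bar>snd p - snd (x, t)\<bar> < \<delta>"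
      using y_close near m(2) norm_minus_commute[of "H p" "H (y, t)"] norm_minus_commute[of "g p" "g (y, t)"]
        norm_minus_commute[of x0 x] unfolding p_eq fst_conv snd_conv by argo
    ultimately show ?thesis using sym[OF yC] xC by blast
  qed
qed

section \<open>The operator\<close>

text \<open>A minimum over a compact set of times. It is unique as \<open>s \<noteq> 0\<close>, so that the definite description
  denotes it.\<close>

lemma zero_time_mem:
  assumes p: "p \<in> cylinder \<Omega> T"
  shows "(0, zero_time (\<A> p) s) \<in> \<A> p"
proof (cases "s = 0")
  case True
  then show ?thesis using A1D(4)[OF p] by (simp add: zero_time_def)
next
  case s: False
  define Z where "Z = {r. (0, r) \<in> \<A> p}"
  have "Z = snd ` (\<A> p \<inter> {0} \<times> UNIV)" by (force simp: Z_def)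
  moreover have "compact (snd ` (\<A> p \<inter> {0} \<times> (UNIV :: real set)))"
    by (intro compact_continuous_image compact_Int_closed A1D(1)[OF p] closed_Times continuous_intros)
  ultimately have "compact Z" by simp
  moreover have "Z \<noteq> {}" using A1D(4)[OF p] by (auto simp: Z_def)
  moreover have "continuous_on Z (\<lambda>r. r * s)" by (intro continuous_intros)
  ultimately obtain r where r: "r \<in> Z" "\<And>r'. r' \<in> Z \<Longrightarrow> r * s \<le> r' * s"
    using continuous_attains_inf[of Z "\<lambda>r. r * s"] by blast
  let ?P = "\<lambda>r. (0, r) \<in> \<A> p \<and> (\<forall>r'. (0, r') \<in> \<A> p \<longrightarrow> r * s \<le> r' * s)"
  have P: "?P r" using r by (simp add: Z_def)
  have "r' = r" if "?P r'" for r'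
  proof -
    have "r' * s = r * s" using that P by (intro antisym) auto
    then show ?thesis using s by simp
  qed
  with P have "?P (THE r. ?P r)" by (rule theI)
  then show ?thesis using s by (simp add: zero_time_def)
qed

lemma G_op_bound:
  assumes p: "p \<in> cylinder \<Omega> T"
  shows "\<bar>G_op c \<A> M v s p\<bar> \<le> \<bar>s\<bar> + norm M"
proof -
  have coeff: "\<bar>delay c (snd a) * s\<bar> \<le> \<bar>s\<bar>" if "a \<in> \<A> p" for a
    using delay_A[OF p that] c by (simp add: abs_mult mult_left_le_one_le)
  show ?thesis
  proof (cases "v = 0")
    case True
    have "\<bar>delay c (zero_time (\<A> p) s) * s\<bar> \<le> \<bar>s\<bar>"
      using coeff[OF zero_time_mem[OF p]] by simp
    then have "\<bar>G_op c \<A> M v s p\<bar> \<le> \<bar>s\<bar>" using True by (simp add: G_op_def delay_def)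
    then show ?thesis using norm_ge_zero[of M] by linarith
  next
    case False
    have "\<exists>!q. is_minimizer (\<A> p) v q"
      using A4 p False unfolding property_A4_def by blast
    from theI'[OF this] have m: "minimizer (\<A> p) v \<in> \<A> p"
      by (simp add: minimizer_def is_minimizer_def)
    have "\<bar>(M *v min_dir (\<A> p) v) \<bullet> min_dir (\<A> p) v\<bar> \<le> norm M * 1\<^sup>2"
      by (rule abs_quadratic_form_le) (simp_all add: min_dir_def A1D(2)[OF p m])
    moreover have "\<bar>delay c (min_time (\<A> p) v) * s\<bar> \<le> \<bar>s\<bar>"
      using coeff[OF m] by (simp add: min_time_def)
    moreover have "G_op c \<A> M v s p = delay c (min_time (\<A> p) v) * s - 1/2 * ((M *v min_dir (\<A> p) v) \<bullet> min_dir (\<A> p) v)"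
      using False by (simp add: G_op_def delay_def)
    moreover have "\<bar>a - 1/2 * b\<bar> \<le> S + N" if "\<bar>a\<bar> \<le> S" "\<bar>b\<bar> \<le> N" "0 \<le> N" for a b S N :: real
      using that by argo
    ultimately show ?thesis by (simp only: power_one mult_1_right norm_ge_zero)
  qed
qed

text \<open>At the zero gradient the operator has the sign of \<open>s\<close>.\<close>

lemma G_op_critical:
  assumes "p \<in> cylinder \<Omega> T"
  shows "\<exists>k>0. G_op c \<A> M 0 s p = k * s"
proof (intro exI conjI)
  show "0 < delay c (zero_time (\<A> p) s)"
    using delay_A(1)[OF assms zero_time_mem[OF assms, of s]] c by simp
  show "G_op c \<A> M 0 s p = delay c (zero_time (\<A> p) s) * s"
    by (simp add: G_op_def delay_def)
qed

text \<open>By the symmetry (A2) the minimizer for \<open>- v\<close> is the mirror image of the one for \<open>v\<close>, with the same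
  time.\<close>

lemma G_op_uminus:
  assumes p: "p \<in> cylinder \<Omega> T" and v: "v \<noteq> 0"
  shows "- G_op c \<A> (- M) (- v) (- s) p = G_op c \<A> M v s p"
proof -
  have ex: "\<exists>!q. is_minimizer (\<A> p) v q"
    using A4 p v unfolding property_A4_def by blast
  let ?a = "minimizer (\<A> p) v"
  have a: "is_minimizer (\<A> p) v ?a" unfolding minimizer_def by (rule theI'[OF ex])
  have "is_minimizer (\<A> p) (- v) (- fst ?a, snd ?a)"
  proof -
    have "v \<bullet> fst ?a \<le> v \<bullet> - fst b" if "b \<in> \<A> p" for b
      using a A2D[OF p that] unfolding is_minimizer_def by (metis fst_conv image_eqI)
    moreover have "?a \<in> \<A> p" using a by (simp add: is_minimizer_def)
    ultimately show ?thesis using A2D[OF p] by (auto simp: is_minimizer_def)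
  qed
  then have "minimizer (\<A> p) (- v) = (- fst ?a, snd ?a)"
    using v by (intro minimizer_eq[OF p]) simp_all
  moreover have "(- M) *v (- w) = M *v w" for w
    by (simp add: linear_neg[OF matrix_vector_mul_linear] vec_eq_iff matrix_vector_mult_def sum_negf)
  moreover have "G_op c \<A> M' v' s' p =
      delay c (snd (minimizer (\<A> p) v')) * s' - 1/2 * ((M' *v fst (minimizer (\<A> p) v')) \<bullet> fst (minimizer (\<A> p) v'))"
    if "v' \<noteq> 0" for M' v' s'
    using that by (simp add: G_op_def delay_def min_dir_def min_time_def)
  ultimately show ?thesis using v by simp
qed

lemma upper_envelope_at_strict_min:
  assumes C21: "has_C21_derivs \<Omega> T \<phi> g H d" and p: "p \<in> cylinder \<Omega> T"
    and strict: "strict_min_on (\<lambda>q. u q - \<phi> q) (closure (cylinder \<Omega> T)) p"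
    and bound: "\<And>M v s q. q \<in> cylinder \<Omega> T \<Longrightarrow> \<bar>G M v s q\<bar> \<le> \<bar>s\<bar> + norm M"
    and noncritical: "\<And>M v s q. q \<in> cylinder \<Omega> T \<Longrightarrow> v \<noteq> 0 \<Longrightarrow> G M v s q = G_op c \<A> M v s q"
    and critical: "\<And>M s q. q \<in> cylinder \<Omega> T \<Longrightarrow> 0 \<le> s \<Longrightarrow> 0 \<le> G M 0 s q"
  shows "0 \<le> upper_envelope (cylinder \<Omega> T) G (H p) (g p) (d p) p"
  by (rule upper_envelope_nonneg[OF bound])
    (assumption, rule nearby_supersolution[OF C21 p strict noncritical critical])

end

section \<open>Both halves of the definition of a viscosity solution\<close>

lemma has_C21_derivs_uminus:
  assumes "has_C21_derivs \<Omega> T \<phi> g H d"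
  shows "has_C21_derivs \<Omega> T (\<lambda>q. - \<phi> q) (\<lambda>q. - g q) (\<lambda>q. - H q) (\<lambda>q. - d q)"
proof -
  have neg: "(\<lambda>w. - M *v w) = (\<lambda>w. - (M *v w))" for M :: "real^'a^'a"
    by (simp add: fun_eq_iff vec_eq_iff matrix_vector_mult_def sum_negf)
  show ?thesis
    using assms unfolding has_C21_derivs_def neg gderiv_def
    by (auto intro!: continuous_on_minus has_derivative_minus DERIV_minus
        simp: inner_minus_right)
qed

text \<open>Reflecting \<open>(M, v, s)\<close> maps neighbourhoods onto neighbourhoods.\<close>

lemma upper_envelope_uminus:
  fixes G :: "real^'n^'n \<Rightarrow> real^'n \<Rightarrow> real \<Rightarrow> (real^'n) \<times> real \<Rightarrow> real"
  shows "upper_envelope C (\<lambda>M v s q. - G (- M) (- v) (- s) q) (- M) (- v) (- s) p =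
    upper_envelope C (\<lambda>M v s q. - G M v s q) M v s p"
proof -
  let ?near = "\<lambda>M v s M' v' s' p'. norm (M - M') + \<bar>s - s'\<bar> + norm (v - v') + norm (fst p - fst p') + \<bar>snd p - snd p'\<bar>"
  have tr: "transpose (- M' :: real^'n^'n) = - transpose M'" for M'
    by (simp add: transpose_def vec_eq_iff)
  have flip: "?near (- M) (- v) (- s) (- M') (- v') (- s') p' = ?near M v s M' v' s' p'" for M' v' s' p'
    by (simp add: norm_minus_commute abs_minus_commute)
  have "{- G (- M') (- v') (- s') p' | M' v' s' p'. transpose M' = M' \<and> p' \<in> C \<and> ?near (- M) (- v) (- s) M' v' s' p' < \<epsilon>} =
      {- G M' v' s' p' | M' v' s' p'. transpose M' = M' \<and> p' \<in> C \<and> ?near M v s M' v' s' p' < \<epsilon>}" (is "?L = ?R") for \<epsilon>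
  proof (intro equalityI subsetI)
    fix y assume "y \<in> ?L"
    then obtain M' v' s' p' where *: "y = - G (- M') (- v') (- s') p'" "transpose M' = M'" "p' \<in> C"
      "?near (- M) (- v) (- s) M' v' s' p' < \<epsilon>" by blast
    have "?near (- M) (- v) (- s) (- (- M')) (- (- v')) (- (- s')) p' = ?near M v s (- M') (- v') (- s') p'"
      by (rule flip)
    with *(4) have "?near M v s (- M') (- v') (- s') p' < \<epsilon>" by simp
    moreover have "transpose (- M') = - M'" using *(2) tr by simp
    ultimately show "y \<in> ?R" using * by blast
  next
    fix y assume "y \<in> ?R"
    then obtain M' v' s' p' where *: "y = - G M' v' s' p'" "transpose M' = M'" "p' \<in> C"
      "?near M v s M' v' s' p' < \<epsilon>" by blast
    have "?near (- M) (- v) (- s) (- M') (- v') (- s') p' < \<epsilon>" using *(4) flip by simp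
    moreover have "transpose (- M') = - M'" using *(2) tr by simp
    moreover have "y = - G (- (- M')) (- (- v')) (- (- s')) p'" using *(1) by simp
    ultimately show "y \<in> ?L" using *(3) by blast
  qed
  then show ?thesis unfolding upper_envelope_def by simp
qed

text \<open>Boundedness and nonemptiness exclude an empty boundary, to which every distance is 0 by
  convention.\<close>

lemma infdist_le_of_outer_strip:
  fixes \<Omega> :: "(real^'n) set"
  assumes "bounded \<Omega>" "\<Omega> \<noteq> {}" "x \<in> outer_strip \<Omega> \<epsilon>"
  shows "x \<in> enlarged_domain \<Omega> \<epsilon>"
proof -
  have "frontier \<Omega> \<noteq> {}" using assms(1,2) not_bounded_UNIV by (auto simp: frontier_eq_empty)
  then obtain z where z: "z \<in> frontier \<Omega>" "infdist x (frontier \<Omega>) = dist x z"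
    using infdist_attains_inf[of "frontier \<Omega>" x] by auto
  have "z \<in> closure \<Omega>" using z(1) by (simp add: frontier_def)
  then have "infdist z \<Omega> = 0" using in_closure_iff_infdist_zero[OF assms(2)] by simp
  then have "infdist x \<Omega> \<le> dist x z" using infdist_triangle[of x \<Omega> z] by simp
  then show ?thesis using assms(3) z(2) by (simp add: enlarged_domain_def outer_strip_def)
qed

lemma lipschitz_bounded_on_enlarged_domain:
  fixes \<Omega> :: "(real^'n) set" and f :: "real^'n \<Rightarrow> real"
  assumes \<Omega>: "bounded \<Omega>" "\<Omega> \<noteq> {}" and \<eta>: "0 < \<eta>" and f: "L-lipschitz_on (enlarged_domain \<Omega> \<eta>) f"
  obtains B where "\<And>x. x \<in> enlarged_domain \<Omega> \<eta> \<Longrightarrow> \<bar>f x\<bar> \<le> B"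
proof -
  obtain a where a: "a \<in> \<Omega>" using \<Omega>(2) by blast
  obtain K where K: "\<And>y. y \<in> \<Omega> \<Longrightarrow> dist a y \<le> K" using \<Omega>(1) bounded_any_center[of \<Omega> a] by blast
  have aE: "a \<in> enlarged_domain \<Omega> \<eta>" using a \<eta> by (simp add: enlarged_domain_def)
  have L: "0 \<le> L" using f by (rule lipschitz_on_nonneg)
  show thesis
  proof (rule that)
    fix x assume x: "x \<in> enlarged_domain \<Omega> \<eta>"
    then have "infdist x \<Omega> < \<eta> + 1" by (simp add: enlarged_domain_def)
    then obtain y where y: "y \<in> \<Omega>" "dist x y < \<eta> + 1"
      using \<Omega>(2) by (auto simp: infdist_def cInf_less_iff split: if_splits)
    have "dist x a \<le> dist x y + dist a y" by (rule dist_triangle2)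
    then have "dist x a \<le> \<eta> + 1 + K" using y(2) K[OF y(1)] by linarith
    then have "L * dist x a \<le> L * (\<eta> + 1 + K)" using L by (rule mult_left_mono)
    moreover have "dist (f x) (f a) \<le> L * dist x a" by (rule lipschitz_onD[OF f x aE])
    ultimately show "\<bar>f x\<bar> \<le> \<bar>f a\<bar> + L * (\<eta> + 1 + K)"
      unfolding dist_real_def by linarith
  qed
qed

lemma parabolic_boundary_subset_terminal_set:
  fixes \<Omega> :: "(real^'n) set"
  assumes "open \<Omega>" "0 < \<epsilon>" "0 \<le> T"
  shows "parabolic_boundary \<Omega> T \<subseteq> terminal_set \<Omega> T \<epsilon>"
proof
  fix p assume p: "p \<in> parabolic_boundary \<Omega> T"
  obtain x t where xt: "p = (x, t)" by fastforce
  have out: "x \<in> outer_strip \<Omega> \<epsilon>" if "x \<in> frontier \<Omega>"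
    using that assms(1,2) by (auto simp: outer_strip_def frontier_def interior_open)
  have inside: "x \<in> enlarged_domain \<Omega> \<epsilon>" if "x \<in> closure \<Omega>"
  proof -
    have "\<Omega> \<noteq> {}" using that by auto
    then have "infdist x \<Omega> = 0" using that in_closure_iff_infdist_zero by blast
    then show ?thesis using assms(2) by (simp add: enlarged_domain_def)
  qed
  have "x \<in> closure \<Omega>" using p closure_subset by (auto simp: xt parabolic_boundary_def frontier_def)
  then show "p \<in> terminal_set \<Omega> T \<epsilon>"
    using p out inside assms(2)
    by (cases "t = 0") (auto simp: xt parabolic_boundary_def terminal_set_def)
qed

lemma parabolic_boundary_subset_closure:
  assumes "0 < T"
  shows "parabolic_boundary \<Omega> T \<subseteq> closure (cylinder \<Omega> T)"
  using assms closure_subset[of \<Omega>]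
  unfolding parabolic_boundary_def cylinder_def closure_Times by (auto simp: frontier_def)

theorem theorem4p3:
  fixes \<Omega> :: "(real^'n) set" and T c \<eta> :: real
    and \<A> :: "(real^'n) \<times> real \<Rightarrow> ((real^'n) \<times> real) set"
    and f :: "real^'n \<Rightarrow> real" and F :: "(real^'n) \<times> real \<Rightarrow> real"
    and ueps :: "real \<Rightarrow> (real^'n) \<times> real \<Rightarrow> real"
    and u :: "(real^'n) \<times> real \<Rightarrow> real"
  assumes "0 < T" and "0 < c" and "c < 1" and "0 < \<eta>"
    and "open \<Omega>" and "\<Omega> \<noteq> {}" and "bounded \<Omega>" and "convex \<Omega>"
    and "C2_boundary \<Omega>" and "positive_curvature \<Omega>"
    and "\<exists>L. L-lipschitz_on (enlarged_domain \<Omega> \<eta>) f"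
    and "F = (\<lambda>(x, t). f x)"
    and "property_A1 (cylinder \<Omega> T) c \<A>"
    and "property_A2 (cylinder \<Omega> T) \<A>"
    and "property_A3 (cylinder \<Omega> T) \<A>"
    and "property_A4 (cylinder \<Omega> T) \<A>"
    and "\<And>\<epsilon>. 0 < \<epsilon> \<Longrightarrow> \<epsilon> \<le> \<eta> \<Longrightarrow> is_game_value \<Omega> T c \<A> \<epsilon> F (ueps \<epsilon>)"
    and "continuous_on (closure (cylinder \<Omega> T)) u"
    and "uniform_limit (closure (cylinder \<Omega> T)) ueps u (at_right 0)"
  shows "viscosity_solution \<Omega> T (G_op c \<A>) F u"
proof -
  note T = assms(1) and c = assms(2,3) and \<eta> = assms(4) and op = assms(5) and F = assms(12)
    and A = assms(13-16) and game = assms(17) and cont = assms(18) and unif = assms(19)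
  let ?C = "cylinder \<Omega> T" and ?G = "G_op c \<A>"
  obtain L where L: "L-lipschitz_on (enlarged_domain \<Omega> \<eta>) f" using assms(11) by blast
  obtain B where B: "\<And>x. x \<in> enlarged_domain \<Omega> \<eta> \<Longrightarrow> \<bar>f x\<bar> \<le> B"
    using lipschitz_bounded_on_enlarged_domain[OF assms(7,6) \<eta> L] by blast
  have F_bound: "\<bar>F p\<bar> \<le> B" if "p \<in> terminal_set \<Omega> T \<epsilon>" "\<epsilon> \<le> \<eta>" for p \<epsilon>
  proof -
    have "fst p \<in> enlarged_domain \<Omega> \<epsilon>"
      using that(1) infdist_le_of_outer_strip[OF assms(7,6)] by (auto simp: terminal_set_def)
    then have "fst p \<in> enlarged_domain \<Omega> \<eta>" using that(2) by (simp add: enlarged_domain_def)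
    then show ?thesis using B by (simp add: F case_prod_beta)
  qed
  have tug: "tug_payoff \<Omega> T c \<A> \<epsilon> F B" "tug_payoff \<Omega> T c \<A> \<epsilon> (\<lambda>p. - F p) B" if "0 < \<epsilon>" "\<epsilon> \<le> \<eta>" for \<epsilon>
    by unfold_locales (use c that A(1) F_bound in auto)
  have game': "is_game_value \<Omega> T c \<A> \<epsilon> (\<lambda>p. - F p) (\<lambda>p. - ueps \<epsilon> p)" if "0 < \<epsilon>" "\<epsilon> \<le> \<eta>" for \<epsilon>
    by (rule tug_payoff.is_game_value_uminus[OF tug(1)[OF that] game[OF that]])
  interpret lower: game_limit \<Omega> T c \<A> \<eta> ueps u
    by unfold_locales
      (use c \<eta> op A cont unif tug_payoff.dynamic_programming_ge[OF tug(1) game] in auto)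
  interpret upper: game_limit \<Omega> T c \<A> \<eta> "\<lambda>\<epsilon> p. - ueps \<epsilon> p" "\<lambda>p. - u p"
    by unfold_locales
      (use c \<eta> op A tug_payoff.dynamic_programming_ge[OF tug(2) game'] in
        \<open>auto intro!: continuous_on_minus cont uniform_limit_uminus unif\<close>)
  have boundary: "u p = F p" if p: "p \<in> parabolic_boundary \<Omega> T" for p
  proof -
    have pC: "p \<in> closure ?C" using parabolic_boundary_subset_closure[OF T] p by blast
    have eq: "\<forall>\<^sub>F \<epsilon> in at_right 0. ueps \<epsilon> p = F p"
      unfolding eventually_at_right_field
    proof (intro exI[of _ \<eta>] conjI allI impI \<eta>)
      fix \<epsilon> assume \<epsilon>: "0 < \<epsilon>" "\<epsilon> < \<eta>"
      have "p \<in> terminal_set \<Omega> T \<epsilon>"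
        by (rule subsetD[OF parabolic_boundary_subset_terminal_set[OF op \<epsilon>(1) less_imp_le[OF T]] p])
      then show "ueps \<epsilon> p = F p" using game[of \<epsilon>] \<epsilon> by (simp add: is_game_value_def)
    qed
    have "((\<lambda>\<epsilon>. ueps \<epsilon> p) \<longlongrightarrow> u p) (at_right 0)" by (rule tendsto_uniform_limitI[OF unif pC])
    moreover have "((\<lambda>\<epsilon>. ueps \<epsilon> p) \<longlongrightarrow> F p) (at_right 0)" by (rule tendsto_eventually[OF eq])
    ultimately show ?thesis by (rule tendsto_unique[rotated]) simp
  qed
  have super: "0 \<le> upper_envelope ?C ?G (H p) (g p) (d p) p"
    if "has_C21_derivs \<Omega> T \<phi> g H d" "p \<in> ?C" "strict_min_on (\<lambda>q. u q - \<phi> q) (closure ?C) p" for \<phi> g H d p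
  proof (rule lower.upper_envelope_at_strict_min[OF that lower.G_op_bound refl])
    show "0 \<le> ?G M 0 s q" if "q \<in> ?C" "0 \<le> s" for M s q
      using lower.G_op_critical[OF that(1), of M s] that(2) by auto
  qed
  have sub: "lower_envelope ?C ?G (H p) (g p) (d p) p \<le> 0"
    if C21: "has_C21_derivs \<Omega> T \<phi> g H d" and p: "p \<in> ?C"
      and strict: "strict_max_on (\<lambda>q. u q - \<phi> q) (closure ?C) p" for \<phi> g H d p
  proof -
    define G' where "G' = (\<lambda>M v s q. - ?G (- M) (- v) (- s) q)"
    have C21': "has_C21_derivs \<Omega> T (\<lambda>q. - \<phi> q) (\<lambda>q. - g q) (\<lambda>q. - H q) (\<lambda>q. - d q)"
      by (rule has_C21_derivs_uminus[OF C21])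
    have strict': "strict_min_on (\<lambda>q. - u q - - \<phi> q) (closure ?C) p"
      unfolding strict_min_on_def
    proof (intro conjI ballI impI)
      show "p \<in> closure ?C" using strict by (simp add: strict_max_on_def)
      fix q assume "q \<in> closure ?C" "q \<noteq> p"
      then have "u q - \<phi> q < u p - \<phi> p" using strict by (simp add: strict_max_on_def)
      then show "- u p - - \<phi> p < - u q - - \<phi> q" by simp
    qed
    have "0 \<le> upper_envelope ?C G' (- H p) (- g p) (- d p) p"
    proof (rule upper.upper_envelope_at_strict_min[OF C21' p strict'])
      show "\<bar>G' M v s q\<bar> \<le> \<bar>s\<bar> + norm M" if "q \<in> ?C" for M v s q
        using lower.G_op_bound[OF that, of "- M" "- v" "- s"] by (simp add: G'_def)
      show "G' M v s q = ?G M v s q" if "q \<in> ?C" "v \<noteq> 0" for M v s q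
        unfolding G'_def by (rule lower.G_op_uminus[OF that])
      show "0 \<le> G' M 0 s q" if "q \<in> ?C" "0 \<le> s" for M s q
        using lower.G_op_critical[OF that(1), of "- M" "- s"] that(2) by (auto simp: G'_def)
    qed
    also have "\<dots> = upper_envelope ?C (\<lambda>M v s q. - ?G M v s q) (H p) (g p) (d p) p"
      unfolding G'_def by (rule upper_envelope_uminus)
    finally show ?thesis by (simp add: lower_envelope_def)
  qed
  show ?thesis
    unfolding viscosity_solution_def using cont boundary super sub by blast
qed

end
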